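(* Let $G$ be a locally compact group and $(B,\beta,\phi)$ a weak $G\rtimes G$-algebra. Let $\omega\in Z^2(G,\mathbb T)$, let $\sigma_\omega=(\mathbb T\stackrel{\iota}{\hookrightarrow}G_\omega\twoheadrightarrow G)$ be the extension corresponding to $\omega$, and let $\mathfrak s:G\to G_\omega$, $\mathfrak s(g)=(g,1)$, be the canonical cross-section. Let $D_\omega(G)$ denote the $G$-invariant closed *-subalgebra of $L^\infty(G)$ generated by $$\{f\circ\mathfrak s: f\in C_0(G_\omega,\iota)\}\cup\{\omega(\cdot,g):g\in G\}.$$ If $\phi:C_0(G)\to\mathcal M(B)$ extends to a $G$-equivariant unital *-homomorphism $\tilde\phi:D_\omega(G)\to\mathcal M(B)$, then there exists an isomorphism of Hilbert $B$-modules $$\Phi:\mathcal L(G_\omega,B):=C_0(G_\omega,\iota)\otimes_\phi B\stackrel{\sim}{\longrightarrow}B,\qquad f\otimes b\mapsto\tilde\phi(f\circ\mathfrak s)b,$$ which intertwines $\phi_\omega$ with $\phi$, and transforms the action $\beta_\omega$ on $B_\omega\cong B$ to the action $s\mapsto\mathrm{Ad}\,U_\omega(s)\circ\beta_s$, where $U_\omega(s):=\tilde\phi(u_\omega(s))$ with $u_\omega(s)\in\mathcal U(D_\omega(G))$ defined by $u_\omega(s)(t):=\overline{\omega(t,s)}$.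
   Context: $Z^2(G,\mathbb T)$ is the set of Borel 2-cocycles $\omega:G\times G\to\mathbb T$: $\omega(s,e)=\omega(e,s)=1$ and $\omega(s,t)\omega(st,r)=\omega(s,tr)\omega(t,r)$. $G_\omega$ is the set $G\times\mathbb T$ with multiplication $(g,z)(h,w)=(gh,\omega(g,h)zw)$, equipped with the unique locally compact group topology whose Borel structure is that of $G\times\mathbb T$; with $\iota(z)=(e,z)$ and $(g,z)\mapsto g$ this is a central extension $\sigma_\omega$ of $G$ by $\mathbb T$. Actions on C*-algebras are point-norm continuous; $\mathrm{rt}_g(f)(h)=f(hg)$ (also on $L^\infty(G)$, and $G$-equivariance of $\tilde\phi$ means $\mathrm{rt}$-$\beta$ equivariance). A weak $G\rtimes G$-algebra is a triple $(B,\beta,\phi)$ with an action $\beta:G\curvearrowright B$ on a C*-algebra and a nondegenerate $\mathrm{rt}$-$\beta$ equivariant *-homomorphism $\phi:C_0(G)\to\mathcal M(B)$. $C_0(G_\omega,\iota)=\{\xi\in C_0(G_\omega):\xi(\tilde gz)=\bar z\xi(\tilde g)\ \forall \tilde g\in G_\omega,z\in\mathbb T\}$ is a $C_0(G)$-$C_0(G)$ equivalence bimodule with pointwise actions, $\langle\xi,\eta\rangle_{C_0(G)}(g)=\overline{\xi(\tilde g)}\eta(\tilde g)$ and ${}_{C_0(G)}\langle\xi,\eta\rangle(g)=\xi(\tilde g)\overline{\eta(\tilde g)}$ for $\tilde g$ over $g$; $\widetilde{\mathrm{rt}}$ is right translation of $G_\omega$ on it. $B_\omega:=\mathcal K(\mathcal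 L(G_\omega,B))$ carries the action $\beta_\omega:=\mathrm{Ad}(\widetilde{\mathrm{rt}}\otimes\beta)$, which factors through $G$, and the homomorphism $\phi_\omega:C_0(G)\to\mathcal M(B_\omega)$ given by the left action of $C_0(G)$ on $C_0(G_\omega,\iota)$. $D_\omega(G)$ contains $C_0(G)$. *)

theory Defs
  imports "HOL-Analysis.Analysis" "HOL-Algebra.Group"
begin

section \<open>C*-algebras and Hilbert modules\<close>

class cstar_algebra = real_normed_algebra + banach +
  fixes scaleC :: "complex \<Rightarrow> 'a \<Rightarrow> 'a" (infixr \<open>*\<^sub>C\<close> 75)
    and star :: "'a \<Rightarrow> 'a"
  assumes scaleR_scaleC: "r *\<^sub>R x = complex_of_real r *\<^sub>C x"
    and scaleC_add_right: "c *\<^sub>C (x + y) = c *\<^sub>C x + c *\<^sub>C y"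
    and scaleC_add_left: "(c + d) *\<^sub>C x = c *\<^sub>C x + d *\<^sub>C x"
    and scaleC_scaleC: "c *\<^sub>C d *\<^sub>C x = (c * d) *\<^sub>C x"
    and norm_scaleC: "norm (c *\<^sub>C x) = cmod c * norm x"
    and mult_scaleC_left: "(c *\<^sub>C x) * y = c *\<^sub>C (x * y)"
    and mult_scaleC_right: "x * (c *\<^sub>C y) = c *\<^sub>C (x * y)"
    and star_star: "star (star x) = x"
    and star_add: "star (x + y) = star x + star y"
    and star_scaleC: "star (c *\<^sub>C x) = cnj c *\<^sub>C star x"
    and star_mult: "star (x * y) = star y * star x"
    and cstar_identity: "norm (star x * x) = (norm x)\<^sup>2"

record 'a star_alg =
  sa_carrier :: "'a set"
  sa_add :: "'a \<Rightarrow> 'a \<Rightarrow> 'a"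
  sa_scale :: "complex \<Rightarrow> 'a \<Rightarrow> 'a"
  sa_mult :: "'a \<Rightarrow> 'a \<Rightarrow> 'a"
  sa_star :: "'a \<Rightarrow> 'a"

definition star_hom :: "'a star_alg \<Rightarrow> 'c star_alg \<Rightarrow> ('a \<Rightarrow> 'c) \<Rightarrow> bool" where
  "star_hom A C h \<longleftrightarrow>
     h \<in> sa_carrier A \<rightarrow> sa_carrier C \<and>
     (\<forall>x\<in>sa_carrier A. \<forall>y\<in>sa_carrier A. h (sa_add A x y) = sa_add C (h x) (h y)) \<and>
     (\<forall>c. \<forall>x\<in>sa_carrier A. h (sa_scale A c x) = sa_scale C c (h x)) \<and>
     (\<forall>x\<in>sa_carrier A. \<forall>y\<in>sa_carrier A. h (sa_mult A x y) = sa_mult C (h x) (h y)) \<and>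
     (\<forall>x\<in>sa_carrier A. h (sa_star A x) = sa_star C (h x))"

definition star_iso :: "'a star_alg \<Rightarrow> 'c star_alg \<Rightarrow> ('a \<Rightarrow> 'c) \<Rightarrow> bool" where
  "star_iso A C h \<longleftrightarrow> star_hom A C h \<and> bij_betw h (sa_carrier A) (sa_carrier C)"

definition self_alg :: "('b::cstar_algebra) star_alg" where
  "self_alg = \<lparr>sa_carrier = UNIV, sa_add = (+), sa_scale = (*\<^sub>C), sa_mult = (*), sa_star = star\<rparr>"

definition fun_alg :: "('x \<Rightarrow> complex) set \<Rightarrow> ('x \<Rightarrow> complex) star_alg" where
  "fun_alg S = \<lparr>sa_carrier = S, sa_add = (\<lambda>f g x. f x + g x), sa_scale = (\<lambda>c f x. c * f x),
                sa_mult = (\<lambda>f g x. f x * g x), sa_star = (\<lambda>f x. cnj (f x))\<rparr>"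

text \<open>Right modules with an algebra-valued inner product, conjugate-linear in the first variable.
  The record also serves for pre-Hilbert modules (before separation and completion).\<close>

record ('e, 'b) hmod =
  hm_carrier :: "'e set"
  hm_zero :: 'e
  hm_add :: "'e \<Rightarrow> 'e \<Rightarrow> 'e"
  hm_scale :: "complex \<Rightarrow> 'e \<Rightarrow> 'e"
  hm_act :: "'e \<Rightarrow> 'b \<Rightarrow> 'e"
  hm_inner :: "'e \<Rightarrow> 'e \<Rightarrow> 'b"

definition hm_diff :: "('e, 'b) hmod \<Rightarrow> 'e \<Rightarrow> 'e \<Rightarrow> 'e" where
  "hm_diff E x y = hm_add E x (hm_scale E (-1) y)"

definition hm_norm :: "('e, 'b::cstar_algebra) hmod \<Rightarrow> 'e \<Rightarrow> real" where
  "hm_norm E x = sqrt (norm (hm_inner E x x))"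

definition self_module :: "('b, 'b::cstar_algebra) hmod" where
  "self_module = \<lparr>hm_carrier = UNIV, hm_zero = 0, hm_add = (+), hm_scale = (*\<^sub>C),
                  hm_act = (*), hm_inner = (\<lambda>a b. star a * b)\<rparr>"

definition hm_iso :: "('e, 'b) hmod \<Rightarrow> ('f, 'b) hmod \<Rightarrow> ('e \<Rightarrow> 'f) \<Rightarrow> bool" where
  "hm_iso E F \<Phi> \<longleftrightarrow>
     bij_betw \<Phi> (hm_carrier E) (hm_carrier F) \<and>
     (\<forall>x\<in>hm_carrier E. \<forall>y\<in>hm_carrier E. \<Phi> (hm_add E x y) = hm_add F (\<Phi> x) (\<Phi> y)) \<and>
     (\<forall>c. \<forall>x\<in>hm_carrier E. \<Phi> (hm_scale E c x) = hm_scale F c (\<Phi> x)) \<and>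
     (\<forall>x\<in>hm_carrier E. \<forall>b. \<Phi> (hm_act E x b) = hm_act F (\<Phi> x) b) \<and>
     (\<forall>x\<in>hm_carrier E. \<forall>y\<in>hm_carrier E. hm_inner F (\<Phi> x) (\<Phi> y) = hm_inner E x y)"

text \<open>Operators on a module are extensional functions on its carrier, so that equality of
  operators is equality of functions.\<close>

definition is_adjoint :: "('e, 'b) hmod \<Rightarrow> ('e \<Rightarrow> 'e) \<Rightarrow> ('e \<Rightarrow> 'e) \<Rightarrow> bool" where
  "is_adjoint E T S \<longleftrightarrow> S \<in> hm_carrier E \<rightarrow>\<^sub>E hm_carrier E \<and>
     (\<forall>x\<in>hm_carrier E. \<forall>y\<in>hm_carrier E. hm_inner E (T x) y = hm_inner E x (S y))"

definition adjointables :: "('e, 'b) hmod \<Rightarrow> ('e \<Rightarrow> 'e) set" where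
  "adjointables E = {T \<in> hm_carrier E \<rightarrow>\<^sub>E hm_carrier E. \<exists>S. is_adjoint E T S}"

definition adjointable_alg :: "('e, 'b) hmod \<Rightarrow> ('e \<Rightarrow> 'e) star_alg" where
  "adjointable_alg E =
     \<lparr>sa_carrier = adjointables E,
      sa_add = (\<lambda>S T. \<lambda>x\<in>hm_carrier E. hm_add E (S x) (T x)),
      sa_scale = (\<lambda>c T. \<lambda>x\<in>hm_carrier E. hm_scale E c (T x)),
      sa_mult = (\<lambda>S T. compose (hm_carrier E) S T),
      sa_star = (\<lambda>T. THE S. is_adjoint E T S)\<rparr>"

definition finite_rank_op :: "('e, 'b) hmod \<Rightarrow> ('e \<times> 'e) list \<Rightarrow> 'e \<Rightarrow> 'e" where
  "finite_rank_op E ps z =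
     foldr (\<lambda>(x, y) v. hm_add E (hm_act E x (hm_inner E y z)) v) ps (hm_zero E)"

text \<open>The operator-norm closure, inside the adjointable operators, of the span of the operators
  \<open>z \<mapsto> x \<langle>y, z\<rangle>\<close>; scalars are absorbed in \<open>x\<close>.\<close>

definition compacts :: "('e, 'b::cstar_algebra) hmod \<Rightarrow> ('e \<Rightarrow> 'e) set" where
  "compacts E = {T \<in> adjointables E. \<forall>\<epsilon>>0. \<exists>ps \<in> lists (hm_carrier E \<times> hm_carrier E).
     \<forall>z\<in>hm_carrier E. hm_norm E (hm_diff E (T z) (finite_rank_op E ps z)) \<le> \<epsilon> * hm_norm E z}"

definition compact_alg :: "('e, 'b::cstar_algebra) hmod \<Rightarrow> ('e \<Rightarrow> 'e) star_alg" where
  "compact_alg E = adjointable_alg E \<lparr>sa_carrier := compacts E\<rparr>"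

text \<open>The multiplier algebra of \<open>B\<close>, realised as the adjointable operators on \<open>B\<close> regarded as a
  Hilbert module over itself; \<open>B\<close> sits inside it by left multiplication.\<close>

definition multiplier_alg :: "('b \<Rightarrow> 'b::cstar_algebra) star_alg" where
  "multiplier_alg = adjointable_alg self_module"

text \<open>Canonical extension of an automorphism of \<open>B\<close> to the multiplier algebra.\<close>

definition mult_ext :: "('b \<Rightarrow> 'b) \<Rightarrow> ('b \<Rightarrow> 'b) \<Rightarrow> ('b \<Rightarrow> 'b)" where
  "mult_ext \<alpha> m = \<alpha> \<circ> m \<circ> inv_into UNIV \<alpha>"

text \<open>\<open>Ad U (b) = U b U*\<close>, where the right multiplication by \<open>U*\<close> is
  \<open>b U* = (U b*)*\<close>.\<close>

definition Ad_mult :: "('b \<Rightarrow> 'b) \<Rightarrow> 'b::cstar_algebra \<Rightarrow> 'b" where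
  "Ad_mult U b = U (star (U (star b)))"

section \<open>Internal tensor products\<close>

text \<open>Separated completion of a semi-inner-product module: Cauchy sequences modulo sequences
  whose seminorm tends to zero.\<close>

definition hm_Cauchy :: "('e, 'b::cstar_algebra) hmod \<Rightarrow> (nat \<Rightarrow> 'e) \<Rightarrow> bool" where
  "hm_Cauchy P u \<longleftrightarrow> (\<forall>n. u n \<in> hm_carrier P) \<and>
     (\<forall>\<epsilon>>0. \<exists>N. \<forall>m\<ge>N. \<forall>n\<ge>N. hm_norm P (hm_diff P (u m) (u n)) < \<epsilon>)"

definition hm_class :: "('e, 'b::cstar_algebra) hmod \<Rightarrow> (nat \<Rightarrow> 'e) \<Rightarrow> (nat \<Rightarrow> 'e) set" where
  "hm_class P u = {v. hm_Cauchy P v \<and> (\<lambda>n. hm_norm P (hm_diff P (u n) (v n))) \<longlonglongrightarrow> 0}"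

definition hm_rep :: "(nat \<Rightarrow> 'e) set \<Rightarrow> nat \<Rightarrow> 'e" where
  "hm_rep X = (SOME u. u \<in> X)"

definition hm_completion :: "('e, 'b::cstar_algebra) hmod \<Rightarrow> ((nat \<Rightarrow> 'e) set, 'b) hmod" where
  "hm_completion P =
     \<lparr>hm_carrier = hm_class P ` {u. hm_Cauchy P u},
      hm_zero = hm_class P (\<lambda>n. hm_zero P),
      hm_add = (\<lambda>X Y. hm_class P (\<lambda>n. hm_add P (hm_rep X n) (hm_rep Y n))),
      hm_scale = (\<lambda>c X. hm_class P (\<lambda>n. hm_scale P c (hm_rep X n))),
      hm_act = (\<lambda>X b. hm_class P (\<lambda>n. hm_act P (hm_rep X n) b)),
      hm_inner = (\<lambda>X Y. lim (\<lambda>n. hm_inner P (hm_rep X n) (hm_rep Y n)))\<rparr>"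

text \<open>Continuous extension to the completion of a map that is uniformly continuous for the
  seminorm.\<close>

definition completion_map ::
  "('e, 'b::cstar_algebra) hmod \<Rightarrow> ('e \<Rightarrow> 'e) \<Rightarrow> (nat \<Rightarrow> 'e) set \<Rightarrow> (nat \<Rightarrow> 'e) set" where
  "completion_map P f = (\<lambda>X\<in>hm_carrier (hm_completion P). hm_class P (\<lambda>n. f (hm_rep X n)))"

text \<open>The list \<open>[(x1, b1), ..., (xn, bn)]\<close> stands for \<open>x1 \<otimes> b1 + ... + xn \<otimes> bn\<close>, with
  \<open>\<langle>x \<otimes> b, y \<otimes> c\<rangle> = b* \<phi>(\<langle>x, y\<rangle>) c\<close>. The relations of the balanced algebraic tensor product hold
  for these formal sums modulo vectors of seminorm zero, hence exactly in the completion.\<close>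

definition formal_tensor ::
  "('x, 'a) hmod \<Rightarrow> ('a \<Rightarrow> 'b \<Rightarrow> 'b) \<Rightarrow> (('x \<times> 'b) list, 'b::cstar_algebra) hmod" where
  "formal_tensor X \<phi> =
     \<lparr>hm_carrier = lists (hm_carrier X \<times> UNIV),
      hm_zero = [],
      hm_add = (@),
      hm_scale = (\<lambda>c. map (\<lambda>(x, b). (x, c *\<^sub>C b))),
      hm_act = (\<lambda>u a. map (\<lambda>(x, b). (x, b * a)) u),
      hm_inner = (\<lambda>u v. \<Sum>(x, b)\<leftarrow>u. \<Sum>(y, c)\<leftarrow>v. star b * \<phi> (hm_inner X x y) c)\<rparr>"

definition internal_tensor ::
  "('x, 'a) hmod \<Rightarrow> ('a \<Rightarrow> 'b \<Rightarrow> 'b) \<Rightarrow> ((nat \<Rightarrow> ('x \<times> 'b) list) set, 'b::cstar_algebra) hmod" where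
  "internal_tensor X \<phi> = hm_completion (formal_tensor X \<phi>)"

definition elem_tensor ::
  "('x, 'a) hmod \<Rightarrow> ('a \<Rightarrow> 'b \<Rightarrow> 'b) \<Rightarrow> 'x \<Rightarrow> 'b::cstar_algebra \<Rightarrow> (nat \<Rightarrow> ('x \<times> 'b) list) set" where
  "elem_tensor X \<phi> x b = hm_class (formal_tensor X \<phi>) (\<lambda>n. [(x, b)])"

definition tensor_map ::
  "('x, 'a) hmod \<Rightarrow> ('a \<Rightarrow> 'b \<Rightarrow> 'b) \<Rightarrow> ('x \<Rightarrow> 'x) \<Rightarrow> ('b \<Rightarrow> 'b)
     \<Rightarrow> (nat \<Rightarrow> ('x \<times> 'b) list) set \<Rightarrow> (nat \<Rightarrow> ('x \<times> 'b::cstar_algebra) list) set" where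
  "tensor_map X \<phi> p q = completion_map (formal_tensor X \<phi>) (map (\<lambda>(x, b). (p x, q b)))"

section \<open>Locally compact groups and weak algebras\<close>

definition locally_compact_group :: "('g, 'm) monoid_scheme \<Rightarrow> 'g topology \<Rightarrow> bool" where
  "locally_compact_group G T \<longleftrightarrow>
     group G \<and> topspace T = carrier G \<and> Hausdorff_space T \<and> locally_compact_space T \<and>
     continuous_map (prod_topology T T) T (\<lambda>(x, y). x \<otimes>\<^bsub>G\<^esub> y) \<and>
     continuous_map T T (\<lambda>x. inv\<^bsub>G\<^esub> x)"

definition borel_of :: "'g topology \<Rightarrow> 'g measure" where
  "borel_of T = sigma (topspace T) {U. openin T U}"

text \<open>Functions on a space are represented by functions vanishing outside its underlying set.\<close>

definition C0 :: "'g topology \<Rightarrow> ('g \<Rightarrow> complex) set" where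
  "C0 T = {f. continuous_map T euclidean f \<and>
              (\<forall>\<epsilon>>0. compactin T {x \<in> topspace T. \<epsilon> \<le> cmod (f x)}) \<and>
              (\<forall>x. x \<notin> topspace T \<longrightarrow> f x = 0)}"

definition rt :: "('g, 'm) monoid_scheme \<Rightarrow> 'g \<Rightarrow> ('g \<Rightarrow> complex) \<Rightarrow> 'g \<Rightarrow> complex" where
  "rt G g f = (\<lambda>h. if h \<in> carrier G then f (h \<otimes>\<^bsub>G\<^esub> g) else 0)"

definition cstar_action ::
  "('g, 'm) monoid_scheme \<Rightarrow> 'g topology \<Rightarrow> ('g \<Rightarrow> 'b \<Rightarrow> 'b::cstar_algebra) \<Rightarrow> bool" where
  "cstar_action G T \<beta> \<longleftrightarrow>
     (\<forall>g\<in>carrier G. star_iso self_alg self_alg (\<beta> g)) \<and>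
     \<beta> \<one>\<^bsub>G\<^esub> = id \<and>
     (\<forall>g\<in>carrier G. \<forall>h\<in>carrier G. \<beta> (g \<otimes>\<^bsub>G\<^esub> h) = \<beta> g \<circ> \<beta> h) \<and>
     (\<forall>b. continuous_map T euclidean (\<lambda>g. \<beta> g b))"

definition equivariant ::
  "('g, 'm) monoid_scheme \<Rightarrow> ('g \<Rightarrow> 'b \<Rightarrow> 'b) \<Rightarrow> ('g \<Rightarrow> complex) set
     \<Rightarrow> (('g \<Rightarrow> complex) \<Rightarrow> 'b \<Rightarrow> 'b) \<Rightarrow> bool" where
  "equivariant G \<beta> A \<phi> \<longleftrightarrow>
     (\<forall>g\<in>carrier G. \<forall>f\<in>A. \<phi> (rt G g f) = mult_ext (\<beta> g) (\<phi> f))"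

definition weak_algebra ::
  "('g, 'm) monoid_scheme \<Rightarrow> 'g topology \<Rightarrow> ('g \<Rightarrow> 'b \<Rightarrow> 'b)
     \<Rightarrow> (('g \<Rightarrow> complex) \<Rightarrow> 'b \<Rightarrow> 'b::cstar_algebra) \<Rightarrow> bool" where
  "weak_algebra G T \<beta> \<phi> \<longleftrightarrow>
     cstar_action G T \<beta> \<and>
     star_hom (fun_alg (C0 T)) multiplier_alg \<phi> \<and>
     closure (span {\<phi> f b | f b. f \<in> C0 T}) = UNIV \<and>
     equivariant G \<beta> (C0 T) \<phi>"

section \<open>Haar measure and bounded measurable functions\<close>

definition haar_measure :: "('g, 'm) monoid_scheme \<Rightarrow> 'g topology \<Rightarrow> 'g measure \<Rightarrow> bool" where
  "haar_measure G T \<mu> \<longleftrightarrow>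
     sets \<mu> = sets (borel_of T) \<and>
     emeasure \<mu> (carrier G) \<noteq> 0 \<and>
     (\<forall>K. compactin T K \<longrightarrow> emeasure \<mu> K < \<infinity>) \<and>
     (\<forall>A\<in>sets \<mu>. emeasure \<mu> A = (INF U\<in>{U. openin T U \<and> A \<subseteq> U}. emeasure \<mu> U)) \<and>
     (\<forall>U. openin T U \<longrightarrow> emeasure \<mu> U = (SUP K\<in>{K. compactin T K \<and> K \<subseteq> U}. emeasure \<mu> K)) \<and>
     (\<forall>g\<in>carrier G. \<forall>A\<in>sets \<mu>. emeasure \<mu> ((\<lambda>x. g \<otimes>\<^bsub>G\<^esub> x) ` A) = emeasure \<mu> A)"

text \<open>For groups that are not \<open>\<sigma>\<close>-compact, \<open>L\<^sup>\<infinity>\<close> is formed modulo \<^emph>\<open>locally\<close> null sets.\<close>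

definition loc_ae :: "'g topology \<Rightarrow> 'g measure \<Rightarrow> ('g \<Rightarrow> bool) \<Rightarrow> bool" where
  "loc_ae T \<mu> P \<longleftrightarrow> (\<forall>K. compactin T K \<longrightarrow> (AE x in \<mu>. x \<in> K \<longrightarrow> P x))"

text \<open>Elements of \<open>L\<^sup>\<infinity>\<close> are handled through representatives: sets of classes correspond to
  saturated sets of functions (sets closed for \<open>Linf_norm\<close> are saturated), and maps
  defined on classes to maps that identify locally a.e. equal functions.\<close>

definition Linf :: "'g topology \<Rightarrow> 'g measure \<Rightarrow> ('g \<Rightarrow> complex) set" where
  "Linf T \<mu> = {f \<in> borel_measurable (borel_of T). \<exists>C. loc_ae T \<mu> (\<lambda>x. cmod (f x) \<le> C)}"

definition Linf_norm :: "'g topology \<Rightarrow> 'g measure \<Rightarrow> ('g \<Rightarrow> complex) \<Rightarrow> real" where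
  "Linf_norm T \<mu> f = Inf {C. 0 \<le> C \<and> loc_ae T \<mu> (\<lambda>x. cmod (f x) \<le> C)}"

definition invariant_closed_star_subalgebra ::
  "('g, 'm) monoid_scheme \<Rightarrow> 'g topology \<Rightarrow> 'g measure \<Rightarrow> ('g \<Rightarrow> complex) set \<Rightarrow> bool" where
  "invariant_closed_star_subalgebra G T \<mu> A \<longleftrightarrow>
     A \<subseteq> Linf T \<mu> \<and> (\<lambda>x. 0) \<in> A \<and>
     (\<forall>f\<in>A. \<forall>h\<in>A. (\<lambda>x. f x + h x) \<in> A) \<and>
     (\<forall>c. \<forall>f\<in>A. (\<lambda>x. c * f x) \<in> A) \<and>
     (\<forall>f\<in>A. \<forall>h\<in>A. (\<lambda>x. f x * h x) \<in> A) \<and>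
     (\<forall>f\<in>A. (\<lambda>x. cnj (f x)) \<in> A) \<and>
     (\<forall>g\<in>carrier G. \<forall>f\<in>A. rt G g f \<in> A) \<and>
     (\<forall>f\<in>Linf T \<mu>. (\<forall>\<epsilon>>0. \<exists>h\<in>A. Linf_norm T \<mu> (\<lambda>x. f x - h x) < \<epsilon>) \<longrightarrow> f \<in> A)"

definition respects_loc_ae ::
  "'g topology \<Rightarrow> 'g measure \<Rightarrow> ('g \<Rightarrow> complex) set \<Rightarrow> (('g \<Rightarrow> complex) \<Rightarrow> 'c) \<Rightarrow> bool" where
  "respects_loc_ae T \<mu> A \<psi> \<longleftrightarrow>
     (\<forall>f\<in>A. \<forall>h\<in>A. loc_ae T \<mu> (\<lambda>x. f x = h x) \<longrightarrow> \<psi> f = \<psi> h)"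

section \<open>Cocycles and the associated extensions\<close>

definition Z2 :: "('g, 'm) monoid_scheme \<Rightarrow> 'g topology \<Rightarrow> ('g \<times> 'g \<Rightarrow> complex) set" where
  "Z2 G T = {\<omega> \<in> borel_measurable (borel_of (prod_topology T T)).
     (\<forall>s\<in>carrier G. \<forall>t\<in>carrier G. cmod (\<omega> (s, t)) = 1) \<and>
     (\<forall>s\<in>carrier G. \<omega> (s, \<one>\<^bsub>G\<^esub>) = 1 \<and> \<omega> (\<one>\<^bsub>G\<^esub>, s) = 1) \<and>
     (\<forall>s\<in>carrier G. \<forall>t\<in>carrier G. \<forall>r\<in>carrier G.
        \<omega> (s, t) * \<omega> (s \<otimes>\<^bsub>G\<^esub> t, r) = \<omega> (s, t \<otimes>\<^bsub>G\<^esub> r) * \<omega> (t, r))}"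

abbreviation circle :: "complex set" where
  "circle \<equiv> sphere 0 1"

definition ext_group ::
  "('g, 'm) monoid_scheme \<Rightarrow> ('g \<times> 'g \<Rightarrow> complex) \<Rightarrow> ('g \<times> complex) monoid" where
  "ext_group G \<omega> =
     \<lparr>carrier = carrier G \<times> circle,
      mult = (\<lambda>(g, z) (h, w). (g \<otimes>\<^bsub>G\<^esub> h, \<omega> (g, h) * z * w)),
      one = (\<one>\<^bsub>G\<^esub>, 1)\<rparr>"

definition iota :: "('g, 'm) monoid_scheme \<Rightarrow> complex \<Rightarrow> 'g \<times> complex" where
  "iota G z = (\<one>\<^bsub>G\<^esub>, z)"

definition csec :: "'g \<Rightarrow> 'g \<times> complex" where
  "csec g = (g, 1)"

text \<open>The locally compact group topology on \<open>ext_group G \<omega>\<close> with the Borel structure of the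
  product. Such a topology is unique, and the conditions on \<open>iota\<close> and \<open>fst\<close>, which say that
  \<open>circle \<rightarrow> ext_group G \<omega> \<rightarrow> G\<close> is an extension of topological groups, follow from the other ones
  by automatic continuity of Borel homomorphisms.\<close>

definition extension_topology ::
  "('g, 'm) monoid_scheme \<Rightarrow> 'g topology \<Rightarrow> ('g \<times> 'g \<Rightarrow> complex)
     \<Rightarrow> ('g \<times> complex) topology \<Rightarrow> bool" where
  "extension_topology G T \<omega> T\<omega> \<longleftrightarrow>
     locally_compact_group (ext_group G \<omega>) T\<omega> \<and>
     sets (borel_of T\<omega>) = sets (borel_of (prod_topology T (top_of_set circle))) \<and>
     embedding_map (top_of_set circle) T\<omega> (iota G) \<and>
     continuous_map T\<omega> T fst \<and> open_map T\<omega> T fst"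

definition C0_iota ::
  "('g, 'm) monoid_scheme \<Rightarrow> ('g \<times> 'g \<Rightarrow> complex) \<Rightarrow> ('g \<times> complex) topology
     \<Rightarrow> ('g \<times> complex \<Rightarrow> complex) set" where
  "C0_iota G \<omega> T\<omega> = {\<xi> \<in> C0 T\<omega>. \<forall>x\<in>carrier (ext_group G \<omega>). \<forall>z\<in>circle.
     \<xi> (x \<otimes>\<^bsub>ext_group G \<omega>\<^esub> iota G z) = cnj z * \<xi> x}"

text \<open>In the inner product any point over \<open>g\<close> may be used in place of \<open>csec g\<close>.\<close>

definition C0_iota_module ::
  "('g, 'm) monoid_scheme \<Rightarrow> ('g \<times> 'g \<Rightarrow> complex) \<Rightarrow> ('g \<times> complex) topology
     \<Rightarrow> ('g \<times> complex \<Rightarrow> complex, 'g \<Rightarrow> complex) hmod" where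
  "C0_iota_module G \<omega> T\<omega> =
     \<lparr>hm_carrier = C0_iota G \<omega> T\<omega>,
      hm_zero = (\<lambda>x. 0),
      hm_add = (\<lambda>\<xi> \<eta> x. \<xi> x + \<eta> x),
      hm_scale = (\<lambda>c \<xi> x. c * \<xi> x),
      hm_act = (\<lambda>\<xi> f x. \<xi> x * f (fst x)),
      hm_inner = (\<lambda>\<xi> \<eta> g. cnj (\<xi> (csec g)) * \<eta> (csec g))\<rparr>"

definition D_alg ::
  "('g, 'm) monoid_scheme \<Rightarrow> 'g topology \<Rightarrow> 'g measure \<Rightarrow> ('g \<times> 'g \<Rightarrow> complex)
     \<Rightarrow> ('g \<times> complex) topology \<Rightarrow> ('g \<Rightarrow> complex) set" where
  "D_alg G T \<mu> \<omega> T\<omega> = \<Inter> {A. invariant_closed_star_subalgebra G T \<mu> A \<and>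
     {f \<circ> csec | f. f \<in> C0_iota G \<omega> T\<omega>} \<union> {(\<lambda>t. \<omega> (t, g)) | g. g \<in> carrier G} \<subseteq> A}"

definition L_mod ::
  "('g, 'm) monoid_scheme \<Rightarrow> ('g \<times> 'g \<Rightarrow> complex) \<Rightarrow> ('g \<times> complex) topology
     \<Rightarrow> (('g \<Rightarrow> complex) \<Rightarrow> 'b \<Rightarrow> 'b)
     \<Rightarrow> ((nat \<Rightarrow> (('g \<times> complex \<Rightarrow> complex) \<times> 'b) list) set, 'b::cstar_algebra) hmod" where
  "L_mod G \<omega> T\<omega> \<phi> = internal_tensor (C0_iota_module G \<omega> T\<omega>) \<phi>"

definition rt_tensor_beta ::
  "('g, 'm) monoid_scheme \<Rightarrow> ('g \<times> 'g \<Rightarrow> complex) \<Rightarrow> ('g \<times> complex) topology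
     \<Rightarrow> (('g \<Rightarrow> complex) \<Rightarrow> 'b \<Rightarrow> 'b) \<Rightarrow> ('g \<Rightarrow> 'b \<Rightarrow> 'b) \<Rightarrow> 'g \<times> complex
     \<Rightarrow> (nat \<Rightarrow> (('g \<times> complex \<Rightarrow> complex) \<times> 'b) list) set
     \<Rightarrow> (nat \<Rightarrow> (('g \<times> complex \<Rightarrow> complex) \<times> 'b::cstar_algebra) list) set" where
  "rt_tensor_beta G \<omega> T\<omega> \<phi> \<beta> x =
     tensor_map (C0_iota_module G \<omega> T\<omega>) \<phi> (rt (ext_group G \<omega>) x) (\<beta> (fst x))"

text \<open>Since the action of \<open>ext_group G \<omega>\<close> by conjugation factors through \<open>G\<close>, it may be evaluated
  at \<open>csec s\<close>, or at any other point over \<open>s\<close>.\<close>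

definition beta_omega ::
  "('g, 'm) monoid_scheme \<Rightarrow> ('g \<times> 'g \<Rightarrow> complex) \<Rightarrow> ('g \<times> complex) topology
     \<Rightarrow> (('g \<Rightarrow> complex) \<Rightarrow> 'b \<Rightarrow> 'b) \<Rightarrow> ('g \<Rightarrow> 'b \<Rightarrow> 'b) \<Rightarrow> 'g
     \<Rightarrow> ((nat \<Rightarrow> (('g \<times> complex \<Rightarrow> complex) \<times> 'b) list) set
         \<Rightarrow> (nat \<Rightarrow> (('g \<times> complex \<Rightarrow> complex) \<times> 'b) list) set)
     \<Rightarrow> (nat \<Rightarrow> (('g \<times> complex \<Rightarrow> complex) \<times> 'b) list) set
     \<Rightarrow> (nat \<Rightarrow> (('g \<times> complex \<Rightarrow> complex) \<times> 'b::cstar_algebra) list) set" where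
  "beta_omega G \<omega> T\<omega> \<phi> \<beta> s k =
     (let E = hm_carrier (L_mod G \<omega> T\<omega> \<phi>); \<gamma> = rt_tensor_beta G \<omega> T\<omega> \<phi> \<beta> (csec s)
      in (\<lambda>x\<in>E. \<gamma> (k (inv_into E \<gamma> x))))"

text \<open>Left action of \<open>C\<^sub>0(G)\<close> by adjointable operators; these are multipliers of the compact
  operators by composition.\<close>

definition phi_omega ::
  "('g, 'm) monoid_scheme \<Rightarrow> ('g \<times> 'g \<Rightarrow> complex) \<Rightarrow> ('g \<times> complex) topology
     \<Rightarrow> (('g \<Rightarrow> complex) \<Rightarrow> 'b \<Rightarrow> 'b) \<Rightarrow> ('g \<Rightarrow> complex)
     \<Rightarrow> (nat \<Rightarrow> (('g \<times> complex \<Rightarrow> complex) \<times> 'b) list) set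
     \<Rightarrow> (nat \<Rightarrow> (('g \<times> complex \<Rightarrow> complex) \<times> 'b::cstar_algebra) list) set" where
  "phi_omega G \<omega> T\<omega> \<phi> f =
     tensor_map (C0_iota_module G \<omega> T\<omega>) \<phi> (\<lambda>\<xi> x. f (fst x) * \<xi> x) id"

definition u_omega :: "('g \<times> 'g \<Rightarrow> complex) \<Rightarrow> 'g \<Rightarrow> 'g \<Rightarrow> complex" where
  "u_omega \<omega> s = (\<lambda>t. cnj (\<omega> (t, s)))"

definition unitaries :: "'g topology \<Rightarrow> 'g measure \<Rightarrow> ('g \<Rightarrow> complex) set \<Rightarrow> ('g \<Rightarrow> complex) set" where
  "unitaries T \<mu> A = {u \<in> A. loc_ae T \<mu> (\<lambda>x. cnj (u x) * u x = 1)}"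

end

theory Submission
  imports Defs
begin

text \<open>
  The coordinate map \<open>\<xi> \<otimes> b \<mapsto> \<phi>' (\<xi> \<circ> csec) b\<close> preserves inner products because the inner product of
  the bimodule is the pointwise product \<open>cnj (\<xi> \<circ> csec) * (\<eta> \<circ> csec)\<close>, and \<open>\<phi>'\<close> is a *-homomorphism
  that extends \<open>\<phi>\<close>.  Its image is dense: the functions \<open>\<eta> * cnj \<xi>\<close> span a dense subspace of \<open>C\<^sub>0(G)\<close>
  (\<open>C0_approx_inner\<close>), and \<open>\<phi>\<close> is nondegenerate.  Hence the completion defining the tensor product
  is \<open>B\<close> itself (locale \<open>dense_coordinates\<close>), and every map between such modules becomes a concrete
  map of \<open>B\<close>.

  Compact operators on \<open>B\<close> are left multiplications (\<open>compacts_eq\<close>); this needs that sums of products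
  are dense in a C*-algebra (\<open>approx_product_sums\<close>).  Right translation by \<open>(s, z)\<close> multiplies a
  section by \<open>cnj (\<omega> (t, s) z)\<close> besides translating it, so in coordinates the action of \<open>(s, z)\<close>
  on the module is \<open>cnj z U s \<beta> s\<close> (\<open>section_rt\<close>), and conjugation by it is \<open>Ad U s \<circ> \<beta> s\<close>
  (\<open>beta_omega_left_op\<close>).

  That \<open>s \<mapsto> Ad U s \<circ> \<beta> s\<close> is multiplicative is the cocycle identity up to scalars, which conjugation
  does not see (\<open>\<gamma>_mult\<close>, \<open>\<alpha>_mult\<close>).  Its continuity is not visible on \<open>G\<close>, where \<open>\<omega>\<close> is only
  Borel.  On the extension the operators \<open>cnj z U s \<beta> s\<close> depend continuously on \<open>(s, z)\<close>, because
  translation is norm continuous on functions vanishing at infinity and \<open>\<phi>'\<close> is contractive on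
  sections; the resulting continuity of the conjugation action descends along the open projection
  to \<open>G\<close> (\<open>\<alpha>_continuous\<close>).

  All norm estimates for *-homomorphisms come from one elementary observation
  (\<open>norm_le_of_pythagoras\<close>): if \<open>A\<^sup>2 + (1 - H)\<^sup>2 = 1\<close> for commuting self-adjoint multipliers, then
  \<open>(1 - H) \<plusminus> i A\<close> are isometries and therefore \<open>A\<close> is a contraction.
\<close>

section \<open>C*-algebras\<close>

lemma scaleC_zero_right [simp]: "c *\<^sub>C (0 :: 'b::cstar_algebra) = 0"
  using scaleC_add_right[of c 0 0] by simp

lemma scaleC_zero_left [simp]: "0 *\<^sub>C (x :: 'b::cstar_algebra) = 0"
  using scaleC_add_left[of 0 0 x] by simp

lemma scaleC_one [simp]: "1 *\<^sub>C (x :: 'b::cstar_algebra) = x"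
  using scaleR_scaleC[of 1 x] by simp

lemma scaleC_minus_one: "(-1) *\<^sub>C (x :: 'b::cstar_algebra) = - x"
  using scaleR_scaleC[of "-1" x] by simp

lemma scaleC_minus_right: "c *\<^sub>C (- x :: 'b::cstar_algebra) = - (c *\<^sub>C x)"
  by (metis add.right_inverse neg_eq_iff_add_eq_0 scaleC_add_right scaleC_zero_right)

lemma scaleC_diff_right: "c *\<^sub>C (x - y :: 'b::cstar_algebra) = c *\<^sub>C x - c *\<^sub>C y"
  using scaleC_add_right[of c x "- y"] by (simp add: scaleC_minus_right)

lemma star_zero [simp]: "star (0 :: 'b::cstar_algebra) = 0"
  using star_add[of "0 :: 'b" 0] by simp

lemma star_minus: "star (- x :: 'b::cstar_algebra) = - star x"
  by (metis add.right_inverse neg_eq_iff_add_eq_0 star_add star_zero)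

lemma star_diff: "star (x - y :: 'b::cstar_algebra) = star x - star y"
  using star_add[of x "- y"] by (simp add: star_minus)

lemma star_eq_iff [simp]: "star x = star y \<longleftrightarrow> x = (y :: 'b::cstar_algebra)"
  by (metis star_star)

lemma star_scaleR: "star (r *\<^sub>R x :: 'b::cstar_algebra) = r *\<^sub>R star x"
  by (simp add: scaleR_scaleC star_scaleC)

lemma norm_star [simp]: "norm (star x) = norm (x :: 'b::cstar_algebra)"
proof -
  have le: "norm y \<le> norm (star y)" for y :: 'b
  proof (cases "y = 0")
    case False
    have "norm y * norm y \<le> norm (star y) * norm y"
      using cstar_identity[of y] norm_mult_ineq[of "star y" y] by (simp add: power2_eq_square)
    then show ?thesis using False by simp
  qed simp
  show ?thesis using le[of x] le[of "star x"] by (simp add: star_star)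
qed

lemma bounded_linear_star: "bounded_linear (star :: 'b::cstar_algebra \<Rightarrow> 'b)"
  by (rule bounded_linear_intro[where K = 1]) (simp_all add: star_add star_scaleR)

lemma tendsto_star [tendsto_intros]:
  "(f \<longlongrightarrow> (l :: 'b::cstar_algebra)) F \<Longrightarrow> ((\<lambda>x. star (f x)) \<longlongrightarrow> star l) F"
  by (rule bounded_linear.tendsto[OF bounded_linear_star])

lemma tendsto_scaleC [tendsto_intros]:
  assumes "(f \<longlongrightarrow> (l :: 'b::cstar_algebra)) F"
  shows "((\<lambda>x. c *\<^sub>C f x) \<longlongrightarrow> c *\<^sub>C l) F"
proof -
  have "bounded_linear (\<lambda>x :: 'b. c *\<^sub>C x)"
    by (rule bounded_linear_intro[where K = "cmod c"])
      (simp_all add: scaleC_add_right norm_scaleC scaleR_scaleC scaleC_scaleC mult.commute)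
  then show ?thesis using assms by (rule bounded_linear.tendsto)
qed

lemma star_mult_self_eq_0_iff: "star x * x = 0 \<longleftrightarrow> x = (0 :: 'b::cstar_algebra)"
  using cstar_identity[of x] by auto

lemma cstar_eqI_left:
  assumes "\<And>y. star y * a = star y * (b :: 'b::cstar_algebra)"
  shows "a = b"
proof -
  have "star (a - b) * (a - b) = 0" using assms[of "a - b"] by (simp add: algebra_simps)
  then show ?thesis by (simp add: star_mult_self_eq_0_iff)
qed

lemma cstar_eqI_right:
  assumes "\<And>y. a * y = b * (y :: 'b::cstar_algebra)"
  shows "a = b"
proof -
  have "star y * star a = star y * star b" for y
    using arg_cong[OF assms[of y], of star] by (simp add: star_mult)
  then have "star a = star b" by (rule cstar_eqI_left)
  then show ?thesis by simp
qed

text \<open>Left multiplication is isometric: testing on \<open>z = b*\<close> gives \<open>norm (b b*) = (norm b)\<^sup>2\<close>.\<close>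

lemma norm_le_of_left_mult:
  fixes b :: "'b::cstar_algebra"
  assumes "\<And>z. norm (b * z) \<le> c * norm z" and "0 \<le> c"
  shows "norm b \<le> c"
proof (cases "b = 0")
  case False
  have "(norm b)\<^sup>2 \<le> c * norm b"
    using cstar_identity[of "star b"] assms(1)[of "star b"] by (simp add: star_star)
  then show ?thesis using False by (simp add: power2_eq_square)
qed (use assms in simp)

lemma norm_le_of_inner_self:
  fixes a b :: "'b::cstar_algebra"
  assumes "star a * a = star b * b"
  shows "norm a = norm b"
  using cstar_identity[of a] cstar_identity[of b] assms by simp

subsection \<open>Products are dense\<close>

definition product_sums :: "'b::cstar_algebra set" where
  "product_sums = {\<Sum>(x, y)\<leftarrow>ps. x * star y | ps. True}"

lemma product_sums_zero: "0 \<in> product_sums"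
  unfolding product_sums_def by (auto intro!: exI[of _ "[]"])

lemma product_sums_mult: "x * y \<in> product_sums"
  unfolding product_sums_def by (auto simp: star_star intro!: exI[of _ "[(x, star y)]"])

lemma product_sums_add:
  assumes "x \<in> product_sums" "y \<in> product_sums"
  shows "x + y \<in> product_sums"
proof -
  obtain p q where "x = (\<Sum>(x, y)\<leftarrow>p. x * star y)" "y = (\<Sum>(x, y)\<leftarrow>q. x * star y)"
    using assms unfolding product_sums_def by auto
  then have "x + y = (\<Sum>(x, y)\<leftarrow>p @ q. x * star y)" by simp
  then show ?thesis unfolding product_sums_def by blast
qed

lemma product_sums_scaleC:
  assumes "x \<in> product_sums"
  shows "c *\<^sub>C x \<in> product_sums"
proof -
  obtain p where "x = (\<Sum>(x, y)\<leftarrow>p. x * star y)"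
    using assms unfolding product_sums_def by auto
  moreover have "c *\<^sub>C (\<Sum>(x, y)\<leftarrow>p. x * star y)
      = (\<Sum>(x, y)\<leftarrow>map (\<lambda>(x, y). (c *\<^sub>C x, y)) p. x * star y)"
    by (induction p) (auto simp: scaleC_add_right mult_scaleC_left)
  ultimately show ?thesis unfolding product_sums_def by blast
qed

lemma product_sums_diff:
  "x \<in> product_sums \<Longrightarrow> y \<in> product_sums \<Longrightarrow> x - y \<in> product_sums"
  using product_sums_add[of x "- y"] product_sums_scaleC[of y "-1"] by (simp add: scaleC_minus_one)

text \<open>The operator \<open>1 + c x\<close> on \<open>B\<close>, which stands for an element of the unitization.\<close>

definition one_plus :: "complex \<Rightarrow> 'b::cstar_algebra \<Rightarrow> 'b \<Rightarrow> 'b" where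
  "one_plus c x b = b + c *\<^sub>C (x * b)"

text \<open>The power \<open>(1 + c x)\<^sup>n\<close> is \<open>1 + n c x\<close> up to terms of order at least two in \<open>x\<close>, and such
  terms are products.\<close>

lemma one_plus_power_expand:
  "\<exists>q\<in>product_sums. \<forall>b. (one_plus c x ^^ n) b = b + (of_nat n * c) *\<^sub>C (x * b) + q * b"
proof (induction n)
  case 0
  then show ?case by (auto intro!: bexI[of _ 0] product_sums_zero)
next
  case (Suc n)
  then obtain q where q: "q \<in> product_sums"
    and IH: "\<And>b. (one_plus c x ^^ n) b = b + (of_nat n * c) *\<^sub>C (x * b) + q * b" by blast
  let ?q = "q + (c * (of_nat n * c)) *\<^sub>C (x * x) + c *\<^sub>C (x * q)"
  have "?q \<in> product_sums"
    by (intro product_sums_add product_sums_scaleC product_sums_mult q)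
  moreover have "(one_plus c x ^^ Suc n) b = b + (of_nat (Suc n) * c) *\<^sub>C (x * b) + ?q * b" for b
    by (simp add: IH one_plus_def algebra_simps scaleC_add_right scaleC_add_left mult_scaleC_left
        mult_scaleC_right scaleC_scaleC)
  ultimately show ?case by blast
qed

text \<open>For self-adjoint \<open>x\<close> one has \<open>(1 \<plusminus> i x)* (1 \<plusminus> i x) = 1 + x\<^sup>2\<close>, so \<open>1 \<plusminus> i x\<close> is isometric up to
  second order in \<open>x\<close>.\<close>

lemma norm_one_plus_power_le:
  fixes x b :: "'b::cstar_algebra"
  assumes sa: "star x = x" and c: "c = \<i> \<or> c = - \<i>"
  shows "norm ((one_plus c x ^^ n) b) \<le> sqrt (1 + (norm x)\<^sup>2) ^ n * norm b"
proof (induction n)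
  case (Suc n)
  have step: "norm (one_plus c x y) \<le> sqrt (1 + (norm x)\<^sup>2) * norm y" for y
  proof -
    have cc: "cnj c = - c" "c * c = -1" using c by auto
    have "star (one_plus c x y) * one_plus c x y = star y * y + star (x * y) * (x * y)"
    proof -
      have star_op: "star (one_plus c x y) = star y - c *\<^sub>C (star y * x)"
        using scaleC_scaleC[of "-1" c "star y * x"]
        by (simp add: one_plus_def star_add star_scaleC cc star_mult sa scaleC_minus_one)
      moreover have "c *\<^sub>C c *\<^sub>C z = - z" for z :: 'b
        by (simp add: scaleC_scaleC cc scaleC_minus_one)
      ultimately show ?thesis
        unfolding star_op
        by (simp add: one_plus_def distrib_left distrib_right left_diff_distrib right_diff_distrib
            mult.assoc mult_scaleC_left mult_scaleC_right scaleC_add_right scaleC_diff_right star_mult sa)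
    qed
    then have "(norm (one_plus c x y))\<^sup>2 \<le> (norm y)\<^sup>2 + (norm (x * y))\<^sup>2"
      using cstar_identity[of "one_plus c x y"] cstar_identity[of y] cstar_identity[of "x * y"]
        norm_triangle_ineq[of "star y * y" "star (x * y) * (x * y)"] by simp
    also have "\<dots> \<le> (norm y)\<^sup>2 + (norm x * norm y)\<^sup>2"
      by (intro add_left_mono power_mono norm_mult_ineq) simp
    also have "\<dots> = (sqrt (1 + (norm x)\<^sup>2) * norm y)\<^sup>2"
      by (simp add: power_mult_distrib algebra_simps)
    finally show ?thesis by (rule power2_le_imp_le) simp
  qed
  have "norm ((one_plus c x ^^ Suc n) b) \<le> sqrt (1 + (norm x)\<^sup>2) * norm ((one_plus c x ^^ n) b)"
    using step by simp
  also have "\<dots> \<le> sqrt (1 + (norm x)\<^sup>2) * (sqrt (1 + (norm x)\<^sup>2) ^ n * norm b)"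
    by (intro mult_left_mono Suc.IH) simp
  finally show ?case by (simp add: mult.assoc)
qed simp

text \<open>Put \<open>x = (s / n) a\<close>.  Modulo products, \<open>(1 + i x)\<^sup>n - (1 - i x)\<^sup>n\<close> equals \<open>2 i s a\<close>, while its norm
  stays below a constant when \<open>n\<close> is large compared with \<open>(s norm a)\<^sup>2\<close>.  Dividing by \<open>2 i s\<close> and letting
  \<open>s\<close> grow brings \<open>a\<close> arbitrarily close to sums of products.  This replaces an approximate unit:
  the difference is a polynomial substitute for \<open>2 i sin (s a)\<close>.\<close>

lemma self_adjoint_approx_product_sums:
  fixes a :: "'b::cstar_algebra"
  assumes sa: "star a = a" and "\<epsilon> > 0"
  shows "\<exists>q\<in>product_sums. norm (a - q) < \<epsilon>"
proof -
  (* The final bound is exp 1 / s, which this choice makes equal to \<epsilon> / 2. *)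
  define s where "s = 2 * exp 1 / \<epsilon>"
  have s: "s > 0" using \<open>\<epsilon> > 0\<close> by (simp add: s_def)
  obtain n :: nat where n: "real n > max 1 ((s * norm a)\<^sup>2)" using reals_Archimedean2 by blast
  then have n0: "n > 0" by (cases n) auto
  define x where "x = (s / n) *\<^sub>R a"
  have sx: "star x = x" by (simp add: x_def star_scaleR sa)
  obtain p where p: "p \<in> product_sums"
    "\<And>b. (one_plus \<i> x ^^ n) b = b + ((of_nat :: nat \<Rightarrow> complex) n * \<i>) *\<^sub>C (x * b) + p * b"
    using one_plus_power_expand[where c = \<i> and x = x and n = n] by auto
  obtain r where r: "r \<in> product_sums"
    "\<And>b. (one_plus (-\<i>) x ^^ n) b = b + ((of_nat :: nat \<Rightarrow> complex) n * (-\<i>)) *\<^sub>C (x * b) + r * b"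
    using one_plus_power_expand[where c = "- \<i>" and x = x and n = n] by blast
  have C: "sqrt (1 + (norm x)\<^sup>2) ^ n \<le> exp 1"
  proof -
    have "(norm x)\<^sup>2 = (s * norm a)\<^sup>2 / (real n)\<^sup>2"
      using s by (simp add: x_def power_divide)
    also have "\<dots> \<le> real n / (real n)\<^sup>2" using n by (intro divide_right_mono) auto
    also have "\<dots> = 1 / real n" by (simp add: power2_eq_square)
    finally have "(norm x)\<^sup>2 \<le> 1 / real n" .
    then have "1 + (norm x)\<^sup>2 \<le> 1 + 1 / real n" by simp
    moreover have "sqrt (1 + (norm x)\<^sup>2) \<le> 1 + (norm x)\<^sup>2" by (rule real_le_lsqrt) (auto simp: power2_eq_square algebra_simps)
    ultimately have "sqrt (1 + (norm x)\<^sup>2) \<le> 1 + 1 / real n" by linarith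
    also have "\<dots> \<le> exp (1 / real n)" by (rule exp_ge_add_one_self)
    finally have "sqrt (1 + (norm x)\<^sup>2) ^ n \<le> exp (1 / real n) ^ n" by (rule power_mono) simp
    then show ?thesis using n0 by (simp flip: exp_of_nat_mult)
  qed
  define w where "w = (2 * \<i> * s) *\<^sub>C a + (p - r)"
  have "norm w \<le> 2 * exp 1"
  proof (rule norm_le_of_left_mult)
    fix z
    have "w * z = (one_plus \<i> x ^^ n) z - (one_plus (-\<i>) x ^^ n) z"
    proof -
      have "((of_nat :: nat \<Rightarrow> complex) n * \<i>) *\<^sub>C (x * z) = (\<i> * s) *\<^sub>C (a * z)"
        using n0 by (simp add: x_def scaleR_scaleC scaleC_scaleC mult_scaleC_left)
      moreover have "((of_nat :: nat \<Rightarrow> complex) n * -\<i>) *\<^sub>C (x * z) = (- \<i> * s) *\<^sub>C (a * z)"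
        using n0 by (simp add: x_def scaleR_scaleC scaleC_scaleC mult_scaleC_left)
      moreover have "(2 * \<i> * s) *\<^sub>C (a * z) = (\<i> * s) *\<^sub>C (a * z) - (- \<i> * s) *\<^sub>C (a * z)"
        using scaleC_add_left[of "2 * \<i> * s" "- \<i> * s" "a * z"] by (simp add: algebra_simps)
      ultimately show ?thesis
        unfolding p(2) r(2) w_def by (simp add: algebra_simps mult_scaleC_left)
    qed
    also have "norm \<dots> \<le> exp 1 * norm z + exp 1 * norm z"
      using norm_triangle_ineq4[of "(one_plus \<i> x ^^ n) z" "(one_plus (-\<i>) x ^^ n) z"]
        norm_one_plus_power_le[OF sx, of \<i> n z] norm_one_plus_power_le[OF sx, of "-\<i>" n z]
        mult_right_mono[OF C, of "norm z"] by (smt (verit) norm_ge_zero)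
    finally show "norm (w * z) \<le> 2 * exp 1 * norm z" by (simp add: algebra_simps)
  qed simp
  define q where "q = (- 1 / (2 * \<i> * s)) *\<^sub>C (p - r)"
  have "- q = (1 / (2 * \<i> * s)) *\<^sub>C (p - r)"
    unfolding q_def by (subst scaleC_minus_one[symmetric]) (simp add: scaleC_scaleC)
  then have "a - q = (1 / (2 * \<i> * s)) *\<^sub>C w"
    using s by (simp add: w_def scaleC_add_right scaleC_scaleC diff_conv_add_uminus
        del: add_uminus_conv_diff)
  then have "norm (a - q) = norm w / (2 * s)"
    using s by (simp add: norm_scaleC norm_divide norm_mult)
  also have "\<dots> \<le> 2 * exp 1 / (2 * s)" using \<open>norm w \<le> 2 * exp 1\<close> s by (intro divide_right_mono) auto
  also have "\<dots> = \<epsilon> / 2" using \<open>\<epsilon> > 0\<close> by (simp add: s_def)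
  also have "\<dots> < \<epsilon>" using \<open>\<epsilon> > 0\<close> by simp
  finally have "norm (a - q) < \<epsilon>" .
  moreover have "q \<in> product_sums"
    unfolding q_def using p(1) r(1) by (intro product_sums_scaleC product_sums_diff)
  ultimately show ?thesis by blast
qed

lemma approx_product_sums:
  fixes b :: "'b::cstar_algebra"
  assumes "\<epsilon> > 0"
  shows "\<exists>q\<in>product_sums. norm (b - q) < \<epsilon>"
proof -
  define a1 where "a1 = (1/2) *\<^sub>R (b + star b)"
  define a2 where "a2 = (1/2 * \<i>) *\<^sub>C (star b - b)"
  have "star a1 = a1" by (simp add: a1_def star_scaleR star_add star_star add.commute)
  then obtain q1 where q1: "q1 \<in> product_sums" "norm (a1 - q1) < \<epsilon> / 2"
    using self_adjoint_approx_product_sums[of a1 "\<epsilon>/2"] assms by auto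
  have "star a2 = (- 1/2 * \<i>) *\<^sub>C (- 1) *\<^sub>C (star b - b)"
    by (simp add: a2_def star_scaleC star_diff star_star scaleC_minus_one)
  then have "star a2 = a2" by (simp add: a2_def scaleC_scaleC)
  then obtain q2 where q2: "q2 \<in> product_sums" "norm (a2 - q2) < \<epsilon> / 2"
    using self_adjoint_approx_product_sums[of a2 "\<epsilon>/2"] assms by auto
  have "\<i> *\<^sub>C a2 = (-1/2) *\<^sub>C (star b - b)" by (simp add: a2_def scaleC_scaleC)
  also have "\<dots> = (-1/2) *\<^sub>R (star b - b)" by (simp add: scaleR_scaleC)
  finally have "b = a1 + \<i> *\<^sub>C a2" 
    by (simp add: a1_def scaleR_right_distrib scaleR_right_diff_distrib flip: scaleR_add_left)
  then have "b - (q1 + \<i> *\<^sub>C q2) = (a1 - q1) + \<i> *\<^sub>C (a2 - q2)"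
    by (simp add: scaleC_diff_right)
  also have "norm \<dots> \<le> norm (a1 - q1) + norm (a2 - q2)"
    using norm_triangle_ineq[of "a1 - q1" "\<i> *\<^sub>C (a2 - q2)"] by (simp add: norm_scaleC)
  finally have "norm (b - (q1 + \<i> *\<^sub>C q2)) < \<epsilon>" using q1 q2 by simp
  then show ?thesis using q1 q2 by (meson product_sums_add product_sums_scaleC)
qed

section \<open>Multipliers\<close>

lemma is_adjoint_self_module:
  "is_adjoint self_module T S \<longleftrightarrow> (\<forall>x y. star (T x) * y = star x * S y)"
  by (simp add: is_adjoint_def self_module_def)

lemma adjointables_self_module:
  "adjointables self_module = {T. \<exists>S. is_adjoint self_module T S}"
  by (simp add: adjointables_def) (simp add: self_module_def)

lemma adjoint_sym:
  assumes "is_adjoint self_module T S"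
  shows "is_adjoint self_module S T"
proof -
  have "star (S x) * y = star x * T y" for x y
    using assms[unfolded is_adjoint_self_module, rule_format, of y x]
    by (metis star_mult star_star)
  then show ?thesis by (simp add: is_adjoint_self_module)
qed

lemma adjoint_unique:
  assumes "is_adjoint self_module T S" "is_adjoint self_module T S'"
  shows "S = S'"
proof
  fix y
  show "S y = S' y"
    by (rule cstar_eqI_left) (metis assms is_adjoint_self_module)
qed

lemma the_adjoint_self_module:
  assumes "is_adjoint self_module T S"
  shows "(THE S. is_adjoint self_module T S) = S"
  using assms adjoint_unique by blast

lemma adjointable_linear:
  assumes "is_adjoint self_module T S"
  shows adjointable_add: "T (x + y) = T x + T y"
    and adjointable_scaleC: "T (c *\<^sub>C x) = c *\<^sub>C T x"
    and adjointable_mult: "T (x * y) = T x * y"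
proof -
  have adj: "star z * T u = star (S z) * u" for z u
    using adjoint_sym[OF assms] by (simp add: is_adjoint_self_module)
  show "T (x + y) = T x + T y"
    by (rule cstar_eqI_left) (simp add: distrib_left adj)
  show "T (c *\<^sub>C x) = c *\<^sub>C T x"
    by (rule cstar_eqI_left) (simp add: mult_scaleC_right adj)
  show "T (x * y) = T x * y"
    by (rule cstar_eqI_left) (simp add: adj flip: mult.assoc)
qed

lemma adjointable_diff:
  assumes "is_adjoint self_module T S"
  shows "T (x - y) = T x - T y"
  using adjointable_add[OF assms, of x "(-1) *\<^sub>C y"] adjointable_scaleC[OF assms, of "-1" y]
  by (simp add: scaleC_minus_one)

lemma adjointable_zero:
  assumes "is_adjoint self_module T S"
  shows "T 0 = 0"
  using adjointable_diff[OF assms, of 0 0] by simp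

lemma is_adjoint_left_mult: "is_adjoint self_module ((*) b) ((*) (star b))"
  by (simp add: is_adjoint_self_module star_mult mult.assoc)

text \<open>If \<open>A\<close> and \<open>H\<close> are commuting self-adjoint multipliers with \<open>A\<^sup>2 + (1 - H)\<^sup>2 = 1\<close>, then
  \<open>(1 - H) \<plusminus> i A\<close> are isometries whose difference is \<open>2 i A\<close>.  This is how norm
  estimates for *-homomorphisms are obtained below without any spectral theory.\<close>

lemma norm_le_of_pythagoras:
  assumes A: "is_adjoint self_module A A" and H: "is_adjoint self_module H H"
    and comm: "\<And>b. A (H b) = H (A b)" and pyth: "\<And>b. A (A b) + H (H b) = H b + H b"
  shows "norm (A b) \<le> norm b"
proof -
  let ?u = "\<lambda>c. (b - H b) + c *\<^sub>C A b"
  have adj: "star (A x) * y = star x * A y" "star (H x) * y = star x * H y" for x y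
    using A H by (simp_all add: is_adjoint_self_module)
  have iso: "norm (?u c) = norm b" if c: "c = \<i> \<or> c = - \<i>" for c
  proof (rule norm_le_of_inner_self)
    have cc: "cnj c = - c" "c * c = - 1" using c by auto
    have star_u: "star (?u c) = star (b - H b) - c *\<^sub>C star (A b)"
      using scaleC_scaleC[of "-1" c "star (A b)"]
      by (simp add: star_add star_scaleC cc scaleC_minus_one)
    have "star (?u c) * ?u c = star (b - H b) * (b - H b) - c *\<^sub>C c *\<^sub>C (star (A b) * A b)
       + c *\<^sub>C (star (b - H b) * A b - star (A b) * (b - H b))"
      by (simp only: star_u distrib_left left_diff_distrib mult_scaleC_left mult_scaleC_right
          scaleC_diff_right scaleC_add_right) simp
    (* The cross terms cancel because A and H commute. *)
    also have "star (b - H b) * A b - star (A b) * (b - H b) = 0"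
      by (simp add: star_diff left_diff_distrib right_diff_distrib adj comm adjointable_diff[OF A])
    also have "c *\<^sub>C c *\<^sub>C (star (A b) * A b) = - (star (A b) * A b)"
      by (simp add: scaleC_scaleC cc scaleC_minus_one)
    also have "star (b - H b) * (b - H b) - - (star (A b) * A b) + c *\<^sub>C 0
        = star b * (b - (H b + H b) + (A (A b) + H (H b)))"
      by (simp add: star_diff left_diff_distrib right_diff_distrib adj adjointable_diff[OF H]
         distrib_left)
    also have "\<dots> = star b * b" unfolding pyth by simp
    finally show "star (?u c) * ?u c = star b * b" .
  qed
  have "(2 * \<i>) *\<^sub>C A b = ?u \<i> - ?u (- \<i>)"
    using scaleC_add_left[of "\<i>" "\<i>" "A b"] scaleC_scaleC[of "-1" \<i> "A b"]
    by (simp add: scaleC_minus_one) (metis add.inverse_inverse)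
  then have "norm ((2 * \<i>) *\<^sub>C A b) \<le> norm b + norm b"
    using norm_triangle_ineq4[of "?u \<i>" "?u (- \<i>)"] iso by simp
  then show ?thesis by (simp add: norm_scaleC norm_mult)
qed

subsection \<open>Algebraic *-homomorphisms are contractive\<close>

text \<open>The element \<open>g = 1 - sqrt (1 - a\<^sup>2)\<close>, obtained as the fixed point of \<open>g \<mapsto> (a\<^sup>2 + g\<^sup>2) / 2\<close>, which
  is a contraction of the ball of radius \<open>1 - sqrt (1 - (norm a)\<^sup>2)\<close>.  The construction takes place
  in \<open>B\<close>, which may lack a unit.\<close>

lemma one_minus_sqrt_exists:
  fixes a :: "'b::cstar_algebra"
  assumes sa: "star a = a" and na: "norm a < 1"
  shows "\<exists>g. star g = g \<and> a * g = g * a \<and> a * a + g * g = g + g"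
proof -
  define r where "r = (norm a)\<^sup>2"
  have r: "0 \<le> r" "r < 1" using na by (auto simp: r_def power_less_one_iff)
  define \<rho> where "\<rho> = 1 - sqrt (1 - r)"
  have \<rho>: "0 \<le> \<rho>" "\<rho> < 1" "r + \<rho> * \<rho> = 2 * \<rho>"
    using r by (auto simp: \<rho>_def algebra_simps)
  define S where "S = {g. norm g \<le> \<rho> \<and> star g = g \<and> a * g = g * a}"
  define F where "F g = (1/2) *\<^sub>R (a * a + g * g)" for g
  have "closed S"
  proof -
    have "S = cball 0 \<rho> \<inter> {g. star g - g = 0} \<inter> {g. a * g - g * a = 0}"
      by (auto simp: S_def)
    moreover have "continuous_on UNIV (star :: 'b \<Rightarrow> 'b)"
      by (intro linear_continuous_on bounded_linear_star)
    ultimately show ?thesis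
      by (auto intro!: closed_Int closed_Collect_eq continuous_intros)
  qed
  moreover have "0 \<in> S" using \<rho> by (simp add: S_def)
  moreover have "F ` S \<subseteq> S"
  proof (intro image_subsetI)
    fix g assume g: "g \<in> S"
    have "norm (F g) \<le> (1/2) * (norm (a * a) + norm (g * g))"
      unfolding F_def using norm_triangle_ineq[of "a * a" "g * g"] by simp
    also have "\<dots> \<le> (1/2) * (r + \<rho> * \<rho>)"
    proof -
      have "norm (a * a) \<le> r" using norm_mult_ineq[of a a] by (simp add: r_def power2_eq_square)
      moreover have "norm (g * g) \<le> \<rho> * \<rho>"
        using norm_mult_ineq[of g g] mult_mono[of "norm g" \<rho> "norm g" \<rho>] g \<rho> by (simp add: S_def)
      ultimately show ?thesis by simp
    qed
    finally have "norm (F g) \<le> \<rho>" using \<rho> by simp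
    moreover have "star (F g) = F g"
      using g by (simp add: F_def S_def star_scaleR star_add star_mult sa)
    moreover have "a * F g = F g * a"
    proof -
      have "a * (g * g) = (g * g) * a" using g by (simp add: S_def) (metis mult.assoc)
      then show ?thesis by (simp add: F_def algebra_simps)
    qed
    ultimately show "F g \<in> S" by (simp add: S_def)
  qed
  moreover have "dist (F g) (F h) \<le> \<rho> * dist g h" if "g \<in> S" "h \<in> S" for g h
  proof -
    have "F g - F h = (1/2) *\<^sub>R (g * (g - h) + (g - h) * h)"
      by (simp add: F_def algebra_simps)
    then have "norm (F g - F h) \<le> (1/2) * (norm g * norm (g - h) + norm (g - h) * norm h)"
      using norm_triangle_ineq[of "g * (g - h)" "(g - h) * h"] norm_mult_ineq[of g "g - h"]
        norm_mult_ineq[of "g - h" h] by simp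
    also have "\<dots> = ((norm g + norm h) / 2) * norm (g - h)" by (simp add: algebra_simps)
    also have "\<dots> \<le> \<rho> * norm (g - h)"
      using that by (intro mult_right_mono) (auto simp: S_def)
    finally show ?thesis by (simp add: dist_norm)
  qed
  ultimately have "\<exists>!g\<in>S. F g = g"
    using \<rho> by (intro Banach_fix[where c = \<rho>]) (auto simp: complete_eq_closed)
  then obtain g where g: "g \<in> S" "F g = g" by blast
  have "g + g = 2 *\<^sub>R F g" using g by (simp add: scaleR_2)
  also have "\<dots> = a * a + g * g" by (simp add: F_def)
  finally show ?thesis using g by (auto simp: S_def intro!: exI[of _ g])
qed

lemma star_hom_self_alg:
  fixes h :: "'b::cstar_algebra \<Rightarrow> 'c::cstar_algebra"
  assumes "star_hom self_alg self_alg h"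
  shows "h (x + y) = h x + h y" "h (c *\<^sub>C x) = c *\<^sub>C h x" "h (x * y) = h x * h y" 
    "h (star x) = star (h x)" "h (x - y) = h x - h y"
proof -
  show *: "h (x + y) = h x + h y" "h (c *\<^sub>C x) = c *\<^sub>C h x" "h (x * y) = h x * h y" 
    "h (star x) = star (h x)" for x y c
    using assms by (simp_all add: star_hom_def self_alg_def)
  show "h (x - y) = h x - h y"
    using *(1)[of "x - y" y] by simp
qed

text \<open>With \<open>g\<close> from the previous lemma the images of \<open>a\<close> and \<open>g\<close> satisfy the same relations, so
  \<open>h a\<close> is a contraction; the C*-identity passes from self-adjoint to arbitrary elements.  In
  particular algebraic automorphisms are isometric, hence continuous.\<close>

lemma star_hom_norm_le:
  fixes h :: "'b::cstar_algebra \<Rightarrow> 'c::cstar_algebra"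
  assumes h: "star_hom self_alg self_alg h"
  shows "norm (h b) \<le> norm b"
proof -
  note hom = star_hom_self_alg[OF h]
  have unit: "norm (h a) \<le> 1" if a: "star a = a" "norm a < 1" for a
  proof -
    obtain g where g: "star g = g" "a * g = g * a" "a * a + g * g = g + g"
      using one_minus_sqrt_exists[OF a] by blast
    have sa: "is_adjoint self_module ((*) (h x)) ((*) (h x))" if "star x = x" for x
      using is_adjoint_left_mult[of "h x"] that hom(4)[of x] by simp
    have "norm (h a * z) \<le> 1 * norm z" for z
    proof -
      have "norm (h a * z) \<le> norm z"
      proof (rule norm_le_of_pythagoras[OF sa sa, OF a(1) g(1)])
        show "h a * (h g * b) = h g * (h a * b)" for b
          by (metis g(2) hom(3) mult.assoc)
        show "h a * (h a * b) + h g * (h g * b) = h g * b + h g * b" for b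
          by (metis g(3) hom(1,3) mult.assoc distrib_right)
      qed
      then show ?thesis by simp
    qed
    then show ?thesis by (rule norm_le_of_left_mult) simp
  qed
  have sa: "norm (h a) \<le> norm a" if a: "star a = a" for a
  proof (rule field_le_epsilon)
    fix e :: real assume e: "e > 0"
    let ?r = "norm a + e"
    have r: "?r > 0" using e norm_ge_zero[of a] by linarith
    let ?a = "complex_of_real (1 / ?r) *\<^sub>C a"
    have "norm ?a < 1" using r e by (simp only: norm_scaleC norm_of_real) (simp add: field_simps)
    moreover have "star ?a = ?a" using a by (simp add: star_scaleC)
    ultimately have "norm (h ?a) \<le> 1" by (rule unit[rotated])
    then have "1 / ?r * norm (h a) \<le> 1" using r by (simp only: hom(2) norm_scaleC norm_of_real) simp
    then show "norm (h a) \<le> norm a + e" using r by (simp add: field_simps)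
  qed
  have "(norm (h b))\<^sup>2 = norm (h (star b * b))"
    by (simp add: hom cstar_identity)
  also have "\<dots> \<le> norm (star b * b)" by (rule sa) (simp add: star_mult star_star)
  finally have "(norm (h b))\<^sup>2 \<le> (norm b)\<^sup>2" by (simp add: cstar_identity)
  then show ?thesis by (rule power2_le_imp_le) simp
qed

lemma star_iso_inverse:
  assumes "star_iso self_alg self_alg (h :: 'b::cstar_algebra \<Rightarrow> 'b)"
  shows "star_iso self_alg self_alg (inv_into UNIV h)"
proof -
  have bij: "bij h" and hom: "star_hom self_alg self_alg h"
    using assms by (simp_all add: star_iso_def self_alg_def)
  note hs = star_hom_self_alg[OF hom]
  have hi: "h (inv_into UNIV h x) = x" for x using bij by (simp add: bij_is_surj surj_f_inv_f)
  have inj: "h x = h y \<Longrightarrow> x = y" for x y using bij by (meson bij_is_inj injD)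
  have inv_eq: "h x = y \<Longrightarrow> inv_into UNIV h y = x" for x y using hi inj by blast
  have "star_hom self_alg self_alg (inv_into UNIV h)"
    unfolding star_hom_def self_alg_def
    by (simp, intro conjI allI inv_eq) (simp_all add: hs hi)
  then show ?thesis using bij by (simp add: star_iso_def self_alg_def bij_imp_bij_inv)
qed

lemma star_iso_norm:
  assumes "star_iso self_alg self_alg (h :: 'b::cstar_algebra \<Rightarrow> 'b)"
  shows "norm (h b) = norm b"
proof (rule antisym)
  show "norm (h b) \<le> norm b" using assms by (simp add: star_iso_def star_hom_norm_le)
  have "norm (inv_into UNIV h (h b)) \<le> norm (h b)"
    using star_iso_inverse[OF assms] by (simp add: star_iso_def star_hom_norm_le)
  moreover have "inv_into UNIV h (h b) = b"
    using assms by (simp add: star_iso_def self_alg_def bij_is_inj)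
  ultimately show "norm b \<le> norm (h b)" by simp
qed

subsection \<open>Unitary multipliers\<close>

definition unitary_multiplier :: "('b \<Rightarrow> 'b::cstar_algebra) \<Rightarrow> ('b \<Rightarrow> 'b) \<Rightarrow> bool" where
  "unitary_multiplier U V \<longleftrightarrow> is_adjoint self_module U V \<and> U \<circ> V = id \<and> V \<circ> U = id"

lemma unitary_multiplier_sym: "unitary_multiplier U V \<Longrightarrow> unitary_multiplier V U"
  by (auto simp: unitary_multiplier_def adjoint_sym)

lemma unitary_multiplier_inverse:
  assumes "unitary_multiplier U V"
  shows "U (V b) = b" "V (U b) = b"
  using assms by (simp_all add: unitary_multiplier_def fun_eq_iff)

lemma unitary_multiplier_norm:
  assumes "unitary_multiplier U V"
  shows "norm (U b) = norm b"
proof (rule norm_le_of_inner_self)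
  have "star (U b) * U b = star b * V (U b)"
    using assms by (simp add: unitary_multiplier_def is_adjoint_self_module)
  then show "star (U b) * U b = star b * b" by (simp add: unitary_multiplier_inverse[OF assms])
qed

context
  fixes U V :: "'b \<Rightarrow> 'b::cstar_algebra"
  assumes UV: "unitary_multiplier U V"
begin

text \<open>The operator of left multiplication by \<open>Ad U (b)\<close> is \<open>U b U*\<close>; by cancellation this determines
  \<open>Ad U (b)\<close> and yields its algebraic properties.\<close>

lemma Ad_mult_mult: "Ad_mult U b * a = U (b * V a)"
  using UV unfolding Ad_mult_def unitary_multiplier_def
  by (metis adjointable_mult is_adjoint_self_module star_star)

lemma Ad_mult_rank_one: "Ad_mult U (a * star c) = U a * star (U c)"
  using UV unfolding Ad_mult_def unitary_multiplier_def
  by (metis adjointable_mult star_mult star_star)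

lemma Ad_mult_star_hom: "star_hom self_alg self_alg (Ad_mult U)"
proof -
  note lin = adjointable_linear[of U V] adjointable_linear[of V U]
  have adj: "is_adjoint self_module U V" "is_adjoint self_module V U"
    using UV by (simp_all add: unitary_multiplier_def adjoint_sym)
  have "Ad_mult U (x + y) = Ad_mult U x + Ad_mult U y" for x y
    by (rule cstar_eqI_right) (simp add: Ad_mult_mult distrib_right lin adj)
  moreover have "Ad_mult U (c *\<^sub>C x) = c *\<^sub>C Ad_mult U x" for c x
    by (rule cstar_eqI_right) (simp add: Ad_mult_mult mult_scaleC_left lin adj)
  moreover have "Ad_mult U (x * y) = Ad_mult U x * Ad_mult U y" for x y
  proof (rule cstar_eqI_right)
    fix a
    have "Ad_mult U x * (Ad_mult U y * a) = U (x * (y * V a))"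
      by (simp only: Ad_mult_mult unitary_multiplier_inverse[OF UV])
    then show "Ad_mult U (x * y) * a = Ad_mult U x * Ad_mult U y * a"
      by (metis Ad_mult_mult mult.assoc)
  qed
  moreover have "Ad_mult U (star x) = star (Ad_mult U x)" for x
  proof (rule cstar_eqI_right, rule cstar_eqI_left)
    fix a y
    have "star y * (Ad_mult U (star x) * a) = star (V y) * (star x * V a)"
      using adj(2) by (simp add: Ad_mult_mult is_adjoint_self_module)
    also have "\<dots> = star (x * V y) * V a" by (simp add: star_mult mult.assoc)
    also have "\<dots> = star (U (x * V y)) * a" using adj(1) by (simp add: is_adjoint_self_module)
    also have "\<dots> = star y * (star (Ad_mult U x) * a)"
      by (simp add: star_mult mult.assoc flip: Ad_mult_mult)
    finally show "star y * (Ad_mult U (star x) * a) = star y * (star (Ad_mult U x) * a)" .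
  qed
  ultimately show ?thesis by (simp add: star_hom_def self_alg_def)
qed

end

lemma Ad_mult_star_iso:
  assumes UV: "unitary_multiplier U V"
  shows "star_iso self_alg self_alg (Ad_mult U)"
proof -
  have inverse: "Ad_mult S (Ad_mult W b) = b" if "unitary_multiplier S W" for S W and b :: 'a
    by (rule cstar_eqI_right)
      (simp add: Ad_mult_mult[OF that] Ad_mult_mult[OF unitary_multiplier_sym[OF that]]
        unitary_multiplier_inverse[OF that])
  have "bij (Ad_mult U)"
    using inverse[OF UV] inverse[OF unitary_multiplier_sym[OF UV]]
    by (intro bij_betw_byWitness[where f' = "Ad_mult V"]) auto
  then show ?thesis
    using Ad_mult_star_hom[OF UV] by (simp add: star_iso_def self_alg_def)
qed

section \<open>Modules isomorphic to the algebra\<close>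

text \<open>The predicate \<open>hm_iso\<close> speaks about the values of the operations only after applying \<open>\<Phi>\<close>, so
  closure of the carrier is listed separately.\<close>

locale self_module_iso =
  fixes E :: "('e, 'b::cstar_algebra) hmod" and \<Phi> :: "'e \<Rightarrow> 'b"
  assumes iso: "hm_iso E self_module \<Phi>"
    and zero_closed: "hm_zero E \<in> hm_carrier E" and \<Phi>_zero: "\<Phi> (hm_zero E) = 0"
    and add_closed: "x \<in> hm_carrier E \<Longrightarrow> y \<in> hm_carrier E \<Longrightarrow> hm_add E x y \<in> hm_carrier E"
    and scale_closed: "x \<in> hm_carrier E \<Longrightarrow> hm_scale E c x \<in> hm_carrier E"
    and act_closed: "x \<in> hm_carrier E \<Longrightarrow> hm_act E x b \<in> hm_carrier E"
begin

lemma \<Phi>_hom: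
  assumes "x \<in> hm_carrier E"
  shows \<Phi>_add: "y \<in> hm_carrier E \<Longrightarrow> \<Phi> (hm_add E x y) = \<Phi> x + \<Phi> y"
    and \<Phi>_scale: "\<Phi> (hm_scale E c x) = c *\<^sub>C \<Phi> x"
    and \<Phi>_act: "\<Phi> (hm_act E x b) = \<Phi> x * b"
    and \<Phi>_inner: "y \<in> hm_carrier E \<Longrightarrow> hm_inner E x y = star (\<Phi> x) * \<Phi> y"
  using iso assms by (auto simp: hm_iso_def self_module_def)

lemma \<Phi>_bij: "bij_betw \<Phi> (hm_carrier E) UNIV"
  using iso by (simp add: hm_iso_def self_module_def)

definition vec :: "'b \<Rightarrow> 'e" where
  "vec = inv_into (hm_carrier E) \<Phi>"

lemma vec_in [simp]: "vec a \<in> hm_carrier E"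
  and \<Phi>_vec [simp]: "\<Phi> (vec a) = a"
  using \<Phi>_bij by (auto simp: vec_def bij_betw_def intro!: inv_into_into f_inv_into_f)

lemma vec_\<Phi> [simp]: "x \<in> hm_carrier E \<Longrightarrow> vec (\<Phi> x) = x"
  using \<Phi>_bij by (auto simp: vec_def bij_betw_def)

lemma \<Phi>_inj: "x \<in> hm_carrier E \<Longrightarrow> y \<in> hm_carrier E \<Longrightarrow> \<Phi> x = \<Phi> y \<Longrightarrow> x = y"
  by (metis vec_\<Phi>)

lemma norm_diff_eq:
  assumes "x \<in> hm_carrier E" "y \<in> hm_carrier E"
  shows "hm_norm E (hm_diff E x y) = norm (\<Phi> x - \<Phi> y)" and "hm_norm E x = norm (\<Phi> x)"
  using assms by (simp_all add: hm_norm_def hm_diff_def \<Phi>_hom add_closed scale_closed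
      cstar_identity scaleC_minus_one)

lemma finite_rank_op_coord:
  assumes "ps \<in> lists (hm_carrier E \<times> hm_carrier E)" "z \<in> hm_carrier E"
  shows "finite_rank_op E ps z \<in> hm_carrier E \<and>
    \<Phi> (finite_rank_op E ps z) = (\<Sum>(x, y)\<leftarrow>ps. \<Phi> x * star (\<Phi> y)) * \<Phi> z"
  using assms(1)
proof (induction ps)
  case Nil
  then show ?case by (simp add: finite_rank_op_def zero_closed \<Phi>_zero)
next
  case (Cons p ps)
  obtain x y where p: "p = (x, y)" by force
  have xy: "x \<in> hm_carrier E" "y \<in> hm_carrier E" using Cons p by auto
  have "finite_rank_op E (p # ps) z = hm_add E (hm_act E x (hm_inner E y z)) (finite_rank_op E ps z)"
    by (simp add: finite_rank_op_def p)
  then show ?case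
    using Cons xy assms(2) by (simp add: p add_closed act_closed \<Phi>_hom distrib_right mult.assoc)
qed

definition left_op :: "'b \<Rightarrow> 'e \<Rightarrow> 'e" where
  "left_op b = (\<lambda>x\<in>hm_carrier E. vec (b * \<Phi> x))"

lemma left_op_in: "left_op b \<in> hm_carrier E \<rightarrow>\<^sub>E hm_carrier E"
  by (simp add: left_op_def)

lemma left_op_apply [simp]: "x \<in> hm_carrier E \<Longrightarrow> left_op b x = vec (b * \<Phi> x)"
  by (simp add: left_op_def)

lemma left_op_eqI:
  assumes "T \<in> extensional (hm_carrier E)" "\<And>x. x \<in> hm_carrier E \<Longrightarrow> T x = vec (b * \<Phi> x)"
  shows "T = left_op b"
  by (rule extensionalityI[of _ "hm_carrier E"]) (use assms in \<open>auto simp: left_op_def\<close>)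

lemma left_op_inj: "left_op a = left_op b \<longleftrightarrow> a = b"
proof
  assume eq: "left_op a = left_op b"
  show "a = b"
  proof (rule cstar_eqI_right)
    fix y
    show "a * y = b * y"
      using arg_cong[OF fun_cong[OF eq, of "vec y"], of \<Phi>] by simp
  qed
qed simp

lemma is_adjoint_left_op: "is_adjoint E (left_op b) (left_op (star b))"
  using left_op_in by (simp add: is_adjoint_def \<Phi>_inner star_mult mult.assoc)

lemma adjoint_unique_E:
  assumes "is_adjoint E T S" "is_adjoint E T S'"
  shows "S = S'"
proof (rule extensionalityI[of _ "hm_carrier E"])
  show "S \<in> extensional (hm_carrier E)" "S' \<in> extensional (hm_carrier E)"
    using assms by (auto simp: is_adjoint_def PiE_def)
  fix y assume y: "y \<in> hm_carrier E"
  have S: "S y \<in> hm_carrier E" "S' y \<in> hm_carrier E"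
    using assms y by (auto simp: is_adjoint_def PiE_def)
  have "star a * \<Phi> (S y) = star a * \<Phi> (S' y)" for a
  proof -
    have "hm_inner E (vec a) (S y) = hm_inner E (vec a) (S' y)"
      using assms y by (metis is_adjoint_def vec_in)
    then show ?thesis using S by (simp add: \<Phi>_inner)
  qed
  then show "S y = S' y" using S by (intro \<Phi>_inj) (auto intro: cstar_eqI_left)
qed

text \<open>The compact operators on \<open>B\<close> are the left multiplications: finite rank operators are left
  multiplications by sums of products \<open>x y*\<close>, left multiplication is isometric, and these sums are
  dense in \<open>B\<close>.\<close>

lemma compacts_eq: "compacts E = range left_op"
proof (intro equalityI subsetI)
  fix T assume T: "T \<in> compacts E"
  then have T_in: "T \<in> hm_carrier E \<rightarrow>\<^sub>E hm_carrier E"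
    by (simp add: compacts_def adjointables_def)
  then have T_closed: "x \<in> hm_carrier E \<Longrightarrow> T x \<in> hm_carrier E" for x by auto
  have "\<forall>n. \<exists>q. \<forall>z\<in>hm_carrier E. norm (\<Phi> (T z) - q * \<Phi> z) \<le> inverse (Suc n) * norm (\<Phi> z)"
  proof
    fix n
    obtain ps where ps: "ps \<in> lists (hm_carrier E \<times> hm_carrier E)"
      "\<forall>z\<in>hm_carrier E. hm_norm E (hm_diff E (T z) (finite_rank_op E ps z))
         \<le> inverse (Suc n) * hm_norm E z"
      using T[unfolded compacts_def, THEN CollectD, THEN conjunct2, rule_format, of "inverse (Suc n)"]
      by auto
    show "\<exists>q. \<forall>z\<in>hm_carrier E. norm (\<Phi> (T z) - q * \<Phi> z) \<le> inverse (Suc n) * norm (\<Phi> z)"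
      using ps(2) finite_rank_op_coord[OF ps(1)]
      by (intro exI[of _ "\<Sum>(x, y)\<leftarrow>ps. \<Phi> x * star (\<Phi> y)"]) (simp add: norm_diff_eq T_closed)
  qed
  then obtain q where q: "norm (\<Phi> (T z) - q n * \<Phi> z) \<le> inverse (Suc n) * norm (\<Phi> z)"
    if "z \<in> hm_carrier E" for n z
    by metis
  have q': "norm (\<Phi> (T (vec a)) - q n * a) \<le> inverse (Suc n) * norm a" for n a
    using q[of "vec a" n] by simp
  have "Cauchy q"
  proof (rule metric_CauchyI)
    fix e :: real assume e: "e > 0"
    obtain N where N: "inverse (real (Suc N)) < e / 2" using reals_Archimedean[of "e/2"] e by auto
    have "dist (q m) (q n) < e" if "m \<ge> N" "n \<ge> N" for m n
    proof -
      have le: "inverse (real (Suc k)) \<le> inverse (real (Suc N))" if "k \<ge> N" for k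
        using that by (intro le_imp_inverse_le) auto
      have "norm (q m - q n) \<le> 2 * inverse (real (Suc N))"
      proof (rule norm_le_of_left_mult)
        fix a
        let ?t = "\<Phi> (T (vec a))"
        have "(q m - q n) * a = (?t - q n * a) - (?t - q m * a)" by (simp add: algebra_simps)
        then have "norm ((q m - q n) * a) \<le> norm (?t - q n * a) + norm (?t - q m * a)"
          by (metis norm_triangle_ineq4)
        also have "\<dots> \<le> inverse (real (Suc n)) * norm a + inverse (real (Suc m)) * norm a"
          by (intro add_mono q')
        also have "\<dots> \<le> inverse (real (Suc N)) * norm a + inverse (real (Suc N)) * norm a"
          using le[OF \<open>m \<ge> N\<close>] le[OF \<open>n \<ge> N\<close>] by (intro add_mono mult_right_mono) auto
        finally show "norm ((q m - q n) * a) \<le> 2 * inverse (real (Suc N)) * norm a" by (simp add: algebra_simps)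
      qed simp
      then show ?thesis using N by (simp add: dist_norm)
    qed
    then show "\<exists>M. \<forall>m\<ge>M. \<forall>n\<ge>M. dist (q m) (q n) < e" by blast
  qed
  then obtain b where b: "q \<longlonglongrightarrow> b" using Cauchy_convergent convergentD by blast
  have "\<Phi> (T (vec a)) = b * a" for a
  proof -
    have "(\<lambda>n. \<Phi> (T (vec a)) - q n * a) \<longlonglongrightarrow> \<Phi> (T (vec a)) - b * a"
      by (intro tendsto_intros b)
    moreover have "(\<lambda>n. \<Phi> (T (vec a)) - q n * a) \<longlonglongrightarrow> 0"
    proof (rule Lim_null_comparison)
      show "\<forall>\<^sub>F n in sequentially. norm (\<Phi> (T (vec a)) - q n * a) \<le> inverse (Suc n) * norm a"
        using q' by (simp add: eventually_sequentially)
      show "(\<lambda>n. inverse (real (Suc n)) * norm a) \<longlonglongrightarrow> 0"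
        using tendsto_mult_right[OF LIMSEQ_inverse_real_of_nat, of "norm a"] by simp
    qed
    ultimately show ?thesis by (metis LIMSEQ_unique right_minus_eq)
  qed
  then have "T x = vec (b * \<Phi> x)" if "x \<in> hm_carrier E" for x
    using that T_closed by (metis vec_\<Phi>)
  then have "T = left_op b" using T_in by (intro left_op_eqI) (auto simp: PiE_def)
  then show "T \<in> range left_op" by blast
next
  fix T assume "T \<in> range left_op"
  then obtain b where T: "T = left_op b" by blast
  have "\<exists>ps\<in>lists (hm_carrier E \<times> hm_carrier E).
     \<forall>z\<in>hm_carrier E. hm_norm E (hm_diff E (T z) (finite_rank_op E ps z)) \<le> \<epsilon> * hm_norm E z"
    if "\<epsilon> > 0" for \<epsilon>
  proof -
    obtain q where q: "q \<in> product_sums" "norm (b - q) < \<epsilon>"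
      using approx_product_sums \<open>\<epsilon> > 0\<close> by blast
    obtain ps where ps: "q = (\<Sum>(x, y)\<leftarrow>ps. x * star y)"
      using q(1) by (auto simp: product_sums_def)
    let ?ps = "map (\<lambda>(x, y). (vec x, vec y)) ps"
    have ps_in: "?ps \<in> lists (hm_carrier E \<times> hm_carrier E)" by auto
    have sum: "(\<Sum>(x, y)\<leftarrow>?ps. \<Phi> x * star (\<Phi> y)) = q"
      unfolding ps by (simp add: comp_def case_prod_unfold)
    have "hm_norm E (hm_diff E (T z) (finite_rank_op E ?ps z)) \<le> \<epsilon> * hm_norm E z"
      if z: "z \<in> hm_carrier E" for z
    proof -
      have "hm_norm E (hm_diff E (T z) (finite_rank_op E ?ps z)) = norm ((b - q) * \<Phi> z)"
        using finite_rank_op_coord[OF ps_in z] z sum by (simp add: norm_diff_eq T algebra_simps)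
      also have "\<dots> \<le> norm (b - q) * norm (\<Phi> z)" by (rule norm_mult_ineq)
      also have "\<dots> \<le> \<epsilon> * norm (\<Phi> z)" using q by (intro mult_right_mono) auto
      finally show ?thesis using z by (simp add: norm_diff_eq)
    qed
    then show ?thesis using ps_in by blast
  qed
  moreover have "T \<in> adjointables E"
    using is_adjoint_left_op left_op_in by (auto simp: adjointables_def T)
  ultimately show "T \<in> compacts E" by (simp add: compacts_def)
qed

definition compact_coord :: "('e \<Rightarrow> 'e) \<Rightarrow> 'b" where
  "compact_coord = inv_into UNIV left_op"

lemma compact_coord_left_op [simp]: "compact_coord (left_op b) = b"
  unfolding compact_coord_def by (intro inv_into_f_f) (auto simp: inj_on_def left_op_inj)

lemma star_iso_compact_coord: "star_iso (compact_alg E) self_alg compact_coord"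
proof -
  have star_left: "(THE S. is_adjoint E (left_op b) S) = left_op (star b)" for b
    using is_adjoint_left_op adjoint_unique_E by blast
  have ops: "(\<lambda>x\<in>hm_carrier E. hm_add E (left_op a x) (left_op b x)) = left_op (a + b)"
    "(\<lambda>x\<in>hm_carrier E. hm_scale E c (left_op a x)) = left_op (c *\<^sub>C a)"
    "compose (hm_carrier E) (left_op a) (left_op b) = left_op (a * b)" for a b c
    by (auto intro!: left_op_eqI \<Phi>_inj simp: add_closed scale_closed \<Phi>_hom distrib_right
        mult_scaleC_left compose_def mult.assoc)
  have "bij_betw compact_coord (range left_op) UNIV"
    by (intro bij_betw_byWitness[where f' = left_op]) auto
  then show ?thesis
    by (auto simp: star_iso_def star_hom_def compact_alg_def adjointable_alg_def self_alg_def
        compacts_eq ops star_left)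
qed

end

section \<open>Completions with dense image in the algebra\<close>

text \<open>A pre-Hilbert module mapped by \<open>\<Theta>\<close>, compatibly with all operations, onto a dense subset
  of \<open>B\<close>.  Its seminorm is the norm of \<open>\<Theta>\<close>, so its separated completion is \<open>B\<close>: an element of the
  completion is the set of all sequences \<open>v\<close> for which \<open>\<Theta> (v n)\<close> has a given limit.\<close>

locale dense_coordinates =
  fixes P :: "('e, 'b::cstar_algebra) hmod" and \<Theta> :: "'e \<Rightarrow> 'b"
  assumes zero_in: "hm_zero P \<in> hm_carrier P" and \<Theta>_zero: "\<Theta> (hm_zero P) = 0"
    and add_in: "u \<in> hm_carrier P \<Longrightarrow> v \<in> hm_carrier P \<Longrightarrow> hm_add P u v \<in> hm_carrier P"
    and \<Theta>_add: "u \<in> hm_carrier P \<Longrightarrow> v \<in> hm_carrier P \<Longrightarrow> \<Theta> (hm_add P u v) = \<Theta> u + \<Theta> v"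
    and scale_in: "u \<in> hm_carrier P \<Longrightarrow> hm_scale P c u \<in> hm_carrier P"
    and \<Theta>_scale: "u \<in> hm_carrier P \<Longrightarrow> \<Theta> (hm_scale P c u) = c *\<^sub>C \<Theta> u"
    and act_in: "u \<in> hm_carrier P \<Longrightarrow> hm_act P u b \<in> hm_carrier P"
    and \<Theta>_act: "u \<in> hm_carrier P \<Longrightarrow> \<Theta> (hm_act P u b) = \<Theta> u * b"
    and \<Theta>_inner: "u \<in> hm_carrier P \<Longrightarrow> v \<in> hm_carrier P \<Longrightarrow> hm_inner P u v = star (\<Theta> u) * \<Theta> v"
    and dense: "\<epsilon> > 0 \<Longrightarrow> \<exists>u\<in>hm_carrier P. norm (b - \<Theta> u) < \<epsilon>"
begin

definition converging_to :: "'b \<Rightarrow> (nat \<Rightarrow> 'e) set" where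
  "converging_to b = {v. (\<forall>n. v n \<in> hm_carrier P) \<and> (\<lambda>n. \<Theta> (v n)) \<longlonglongrightarrow> b}"

lemma norm_diff_P:
  assumes "u \<in> hm_carrier P" "v \<in> hm_carrier P"
  shows "hm_norm P (hm_diff P u v) = norm (\<Theta> u - \<Theta> v)"
  using assms by (simp add: hm_norm_def hm_diff_def \<Theta>_inner \<Theta>_add \<Theta>_scale add_in scale_in
      cstar_identity scaleC_minus_one)

lemma hm_Cauchy_iff: "hm_Cauchy P u \<longleftrightarrow> (\<forall>n. u n \<in> hm_carrier P) \<and> Cauchy (\<lambda>n. \<Theta> (u n))"
  unfolding hm_Cauchy_def Cauchy_def dist_norm by (auto simp: norm_diff_P)

lemma hm_class_eq:
  assumes "\<forall>n. u n \<in> hm_carrier P" "(\<lambda>n. \<Theta> (u n)) \<longlonglongrightarrow> b"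
  shows "hm_class P u = converging_to b"
proof -
  have "hm_Cauchy P v \<and> (\<lambda>n. hm_norm P (hm_diff P (u n) (v n))) \<longlonglongrightarrow> 0 \<longleftrightarrow>
     (\<forall>n. v n \<in> hm_carrier P) \<and> (\<lambda>n. \<Theta> (v n)) \<longlonglongrightarrow> b" (is "?L \<longleftrightarrow> ?R") for v
  proof
    assume L: ?L
    then have v: "\<forall>n. v n \<in> hm_carrier P" by (simp add: hm_Cauchy_iff)
    with L assms have "(\<lambda>n. norm (\<Theta> (u n) - \<Theta> (v n))) \<longlonglongrightarrow> 0" by (simp add: norm_diff_P)
    then have "(\<lambda>n. \<Theta> (u n) - \<Theta> (v n)) \<longlonglongrightarrow> 0" by (rule tendsto_norm_zero_cancel)
    from tendsto_diff[OF assms(2) this] show ?R using v by simp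
  next
    assume R: ?R
    have "(\<lambda>n. norm (\<Theta> (u n) - \<Theta> (v n))) \<longlonglongrightarrow> norm (b - b)"
      using R assms by (intro tendsto_intros) auto
    then show ?L using R assms
      by (auto simp: hm_Cauchy_iff norm_diff_P intro: LIMSEQ_imp_Cauchy)
  qed
  then show ?thesis by (simp add: hm_class_def converging_to_def)
qed

lemma converging_to_nonempty: "\<exists>v. v \<in> converging_to b"
proof -
  have "\<exists>u. \<forall>n. u n \<in> hm_carrier P \<and> norm (b - \<Theta> (u n)) < inverse (real (Suc n))"
    by (intro choice allI) (metis dense inverse_positive_iff_positive of_nat_0_less_iff zero_less_Suc)
  then obtain u where u: "\<And>n. u n \<in> hm_carrier P"
    "\<And>n. norm (b - \<Theta> (u n)) < inverse (real (Suc n))"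
    by blast
  have "(\<lambda>n. b - \<Theta> (u n)) \<longlonglongrightarrow> 0"
    by (rule Lim_null_comparison[OF _ LIMSEQ_inverse_real_of_nat])
      (use u(2) in \<open>auto intro: always_eventually less_imp_le\<close>)
  from tendsto_diff[OF tendsto_const[of b] this] have "(\<lambda>n. \<Theta> (u n)) \<longlonglongrightarrow> b" by simp
  then show ?thesis using u(1) by (auto simp: converging_to_def)
qed

lemma rep_in_converging_to:
  shows hm_rep_in: "hm_rep (converging_to b) n \<in> hm_carrier P"
    and \<Theta>_hm_rep: "(\<lambda>n. \<Theta> (hm_rep (converging_to b) n)) \<longlonglongrightarrow> b"
proof -
  have "hm_rep (converging_to b) \<in> converging_to b"
    unfolding hm_rep_def using converging_to_nonempty someI_ex by metis
  then show "hm_rep (converging_to b) n \<in> hm_carrier P"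
    "(\<lambda>n. \<Theta> (hm_rep (converging_to b) n)) \<longlonglongrightarrow> b"
    by (simp_all add: converging_to_def)
qed

lemma converging_to_inj: "converging_to a = converging_to b \<longleftrightarrow> a = b"
  using LIMSEQ_unique[OF \<Theta>_hm_rep[of a]] \<Theta>_hm_rep[of b] by auto

lemma carrier_completion: "hm_carrier (hm_completion P) = range converging_to"
proof -
  have "hm_class P u \<in> range converging_to" if "hm_Cauchy P u" for u
    using that hm_class_eq[of u] by (auto simp: hm_Cauchy_iff Cauchy_convergent_iff convergent_def)
  moreover have "converging_to b \<in> hm_class P ` {u. hm_Cauchy P u}" for b
    using hm_class_eq[of "hm_rep (converging_to b)" b] rep_in_converging_to[of b]
    by (auto simp: hm_Cauchy_iff intro!: image_eqI[of _ _ "hm_rep (converging_to b)"] LIMSEQ_imp_Cauchy)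
  ultimately show ?thesis by (auto simp: hm_completion_def)
qed

lemma completion_ops:
  "hm_zero (hm_completion P) = converging_to 0"
  "hm_add (hm_completion P) (converging_to a) (converging_to b) = converging_to (a + b)"
  "hm_scale (hm_completion P) c (converging_to a) = converging_to (c *\<^sub>C a)"
  "hm_act (hm_completion P) (converging_to a) b = converging_to (a * b)"
  "hm_inner (hm_completion P) (converging_to a) (converging_to b) = star a * b"
proof -
  note rep = hm_rep_in \<Theta>_hm_rep
  show "hm_zero (hm_completion P) = converging_to 0"
    by (simp add: hm_completion_def) (rule hm_class_eq, simp_all add: zero_in \<Theta>_zero)
  show "hm_add (hm_completion P) (converging_to a) (converging_to b) = converging_to (a + b)"
    by (simp add: hm_completion_def)
      (rule hm_class_eq, simp_all add: rep add_in \<Theta>_add tendsto_add)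
  show "hm_scale (hm_completion P) c (converging_to a) = converging_to (c *\<^sub>C a)"
    by (simp add: hm_completion_def)
      (rule hm_class_eq, simp_all add: rep scale_in \<Theta>_scale tendsto_scaleC)
  show "hm_act (hm_completion P) (converging_to a) b = converging_to (a * b)"
    by (simp add: hm_completion_def)
      (rule hm_class_eq, simp_all add: rep act_in \<Theta>_act tendsto_mult)
  show "hm_inner (hm_completion P) (converging_to a) (converging_to b) = star a * b"
    by (simp add: hm_completion_def \<Theta>_inner rep)
      (intro limI tendsto_mult tendsto_star rep)
qed

definition coord :: "(nat \<Rightarrow> 'e) set \<Rightarrow> 'b" where
  "coord X = (THE b. X = converging_to b)"

lemma coord_converging_to [simp]: "coord (converging_to b) = b"
  unfolding coord_def by (auto simp: converging_to_inj)

lemma self_module_iso_completion: "self_module_iso (hm_completion P) coord"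
proof
  have "bij_betw coord (range converging_to) UNIV"
    by (intro bij_betw_byWitness[where f' = converging_to]) auto
  then show "hm_iso (hm_completion P) self_module coord"
    by (auto simp: hm_iso_def carrier_completion completion_ops self_module_def)
qed (auto simp: carrier_completion completion_ops)

lemma coord_hm_class:
  assumes "\<forall>n. u n \<in> hm_carrier P" "(\<lambda>n. \<Theta> (u n)) \<longlonglongrightarrow> b"
  shows "coord (hm_class P u) = b"
  using hm_class_eq[OF assms] by simp

text \<open>A map on representatives that covers a continuous map \<open>R\<close> of \<open>B\<close> induces \<open>R\<close> on the completion.\<close>

lemma completion_map_coord:
  assumes f_in: "\<And>u. u \<in> hm_carrier P \<Longrightarrow> f u \<in> hm_carrier P"
    and \<Theta>_f: "\<And>u. u \<in> hm_carrier P \<Longrightarrow> \<Theta> (f u) = R (\<Theta> u)"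
    and cont: "\<And>b. isCont R b" and X: "X \<in> hm_carrier (hm_completion P)"
  shows "completion_map P f X \<in> hm_carrier (hm_completion P)"
    and "coord (completion_map P f X) = R (coord X)"
proof -
  obtain b where b: "X = converging_to b" using X by (auto simp: carrier_completion)
  have "hm_class P (\<lambda>n. f (hm_rep (converging_to b) n)) = converging_to (R b)"
    using isCont_tendsto_compose[OF cont \<Theta>_hm_rep[of b]]
    by (intro hm_class_eq) (simp_all add: f_in \<Theta>_f hm_rep_in)
  then have "completion_map P f X = converging_to (R b)"
    using X by (simp add: completion_map_def b)
  then show "completion_map P f X \<in> hm_carrier (hm_completion P)"
    "coord (completion_map P f X) = R (coord X)"
    by (simp_all add: b carrier_completion)
qed

end

section \<open>Continuous functions vanishing at infinity\<close>

lemma continuous_map_euclidean_iff: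
  "continuous_map S euclidean (f :: 'a \<Rightarrow> 'b::topological_space) \<longleftrightarrow>
     (\<forall>x\<in>topspace S. (f \<longlongrightarrow> f x) (atin S x))"
  by (simp add: continuous_map_atin)

lemma continuous_map_metric_iff:
  fixes f :: "'a \<Rightarrow> 'b::metric_space"
  shows "continuous_map S euclidean f \<longleftrightarrow>
    (\<forall>x\<in>topspace S. \<forall>\<epsilon>>0. \<exists>U. openin S U \<and> x \<in> U \<and> (\<forall>y\<in>U. dist (f y) (f x) < \<epsilon>))"
  (is "?L \<longleftrightarrow> ?R")
proof
  assume L: ?L
  show ?R
  proof (intro ballI allI impI)
    fix x and \<epsilon> :: real assume x: "x \<in> topspace S" and e: "\<epsilon> > 0"
    have "openin S {y \<in> topspace S. f y \<in> ball (f x) \<epsilon>}"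
      by (rule openin_continuous_map_preimage[OF L]) (simp flip: open_openin)
    then show "\<exists>U. openin S U \<and> x \<in> U \<and> (\<forall>y\<in>U. dist (f y) (f x) < \<epsilon>)"
      using x e by (intro exI[of _ "{y \<in> topspace S. f y \<in> ball (f x) \<epsilon>}"]) (auto simp: dist_commute)
  qed
next
  assume R: ?R
  show ?L
    unfolding continuous_map_euclidean_iff tendsto_iff eventually_atin
  proof (intro ballI allI impI disjI2)
    fix x and \<epsilon> :: real assume "x \<in> topspace S" "\<epsilon> > 0"
    with R obtain U where "openin S U" "x \<in> U" "\<forall>y\<in>U. dist (f y) (f x) < \<epsilon>" by blast
    then show "\<exists>U. openin S U \<and> x \<in> U \<and> (\<forall>y\<in>U - {x}. dist (f y) (f x) < \<epsilon>)" by blast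
  qed
qed

lemma continuous_map_complex_arith:
  fixes f g :: "'a \<Rightarrow> complex"
  assumes "continuous_map S euclidean f" "continuous_map S euclidean g"
  shows continuous_map_cadd: "continuous_map S euclidean (\<lambda>x. f x + g x)"
    and continuous_map_cdiff: "continuous_map S euclidean (\<lambda>x. f x - g x)"
    and continuous_map_cmult: "continuous_map S euclidean (\<lambda>x. f x * g x)"
    and continuous_map_cnj: "continuous_map S euclidean (\<lambda>x. cnj (f x))"
    and continuous_map_cdivide: "(\<And>x. x \<in> topspace S \<Longrightarrow> g x \<noteq> 0) \<Longrightarrow>
      continuous_map S euclidean (\<lambda>x. f x / g x)"
  using assms by (auto simp: continuous_map_euclidean_iff intro!: tendsto_intros)

lemma C0_D:
  assumes "f \<in> C0 S"
  shows C0_continuous: "continuous_map S euclidean f"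
    and C0_compact: "\<epsilon> > 0 \<Longrightarrow> compactin S {x \<in> topspace S. \<epsilon> \<le> cmod (f x)}"
    and C0_outside: "x \<notin> topspace S \<Longrightarrow> f x = 0"
  using assms by (auto simp: C0_def)

lemma closedin_norm_ge:
  assumes "continuous_map S euclidean (f :: 'a \<Rightarrow> complex)"
  shows "closedin S {x \<in> topspace S. \<epsilon> \<le> cmod (f x)}"
proof -
  have "closedin S {x \<in> topspace S. f x \<in> {z. \<epsilon> \<le> cmod z}}"
    by (rule closedin_continuous_map_preimage[OF assms])
      (auto simp flip: closed_closedin intro!: closed_Collect_le continuous_intros)
  then show ?thesis by simp
qed

lemma C0_bounded:
  assumes "f \<in> C0 S"
  obtains M where "M > 0" "\<And>x. cmod (f x) \<le> M"
proof -
  let ?K = "{x \<in> topspace S. 1 \<le> cmod (f x)}"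
  have "compact (f ` ?K)"
    using image_compactin[OF C0_compact[OF assms, of 1] C0_continuous[OF assms]] by simp
  then obtain M where M: "\<And>z. z \<in> f ` ?K \<Longrightarrow> norm z \<le> M"
    by (meson bounded_iff compact_imp_bounded)
  have "cmod (f x) \<le> max M 1" for x
    using M[of "f x"] C0_outside[OF assms, of x] by (cases "x \<in> ?K") (auto simp: not_le)
  then show ?thesis by (intro that[of "max M 1"]) auto
qed

lemma C0_dominated:
  assumes "continuous_map S euclidean f" "g \<in> C0 S" and le: "\<And>x. cmod (f x) \<le> C * cmod (g x)"
  shows "f \<in> C0 S"
proof -
  define D where "D = max C 1"
  have D: "D > 0" "cmod (f x) \<le> D * cmod (g x)" for x
    using le[of x] mult_right_mono[of C D "cmod (g x)"] by (auto simp: D_def)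
  have "compactin S {x \<in> topspace S. \<epsilon> \<le> cmod (f x)}" if "\<epsilon> > 0" for \<epsilon>
  proof (rule closed_compactin)
    show "compactin S {x \<in> topspace S. \<epsilon> / D \<le> cmod (g x)}"
      using C0_compact[OF assms(2)] that D by simp
    show "{x \<in> topspace S. \<epsilon> \<le> cmod (f x)} \<subseteq> {x \<in> topspace S. \<epsilon> / D \<le> cmod (g x)}"
      using D by (auto simp: divide_le_eq mult.commute intro: order_trans)
  qed (rule closedin_norm_ge[OF assms(1)])
  moreover have "f x = 0" if "x \<notin> topspace S" for x
    using D(2)[of x] C0_outside[OF assms(2) that] by simp
  ultimately show ?thesis using assms(1) by (simp add: C0_def)
qed

lemma C0_zero: "(\<lambda>x. 0) \<in> C0 S"
  by (simp add: C0_def)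

lemma C0_add:
  assumes "f \<in> C0 S" "g \<in> C0 S"
  shows "(\<lambda>x. f x + g x) \<in> C0 S"
proof -
  have cont: "continuous_map S euclidean (\<lambda>x. f x + g x)"
    by (intro continuous_map_cadd C0_continuous assms)
  have "compactin S {x \<in> topspace S. \<epsilon> \<le> cmod (f x + g x)}" if "\<epsilon> > 0" for \<epsilon>
  proof (rule closed_compactin)
    show "compactin S ({x \<in> topspace S. \<epsilon> / 2 \<le> cmod (f x)} \<union> {x \<in> topspace S. \<epsilon> / 2 \<le> cmod (g x)})"
      using that by (intro compactin_Un C0_compact assms) auto
    show "{x \<in> topspace S. \<epsilon> \<le> cmod (f x + g x)}
      \<subseteq> {x \<in> topspace S. \<epsilon> / 2 \<le> cmod (f x)} \<union> {x \<in> topspace S. \<epsilon> / 2 \<le> cmod (g x)}"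
      using norm_triangle_ineq order_trans by (auto simp: not_le) (smt (verit) norm_triangle_ineq field_sum_of_halves)
  qed (rule closedin_norm_ge[OF cont])
  then show ?thesis using cont C0_outside[OF assms(1)] C0_outside[OF assms(2)] by (simp add: C0_def)
qed

lemma C0_mult_bounded:
  assumes "f \<in> C0 S" "continuous_map S euclidean g" "\<And>x. x \<in> topspace S \<Longrightarrow> cmod (g x) \<le> M"
  shows "(\<lambda>x. f x * g x) \<in> C0 S" "(\<lambda>x. g x * f x) \<in> C0 S"
proof -
  show "(\<lambda>x. f x * g x) \<in> C0 S"
  proof (rule C0_dominated[OF _ assms(1), of _ M])
    show "continuous_map S euclidean (\<lambda>x. f x * g x)"
      by (intro continuous_map_cmult C0_continuous assms)
    show "cmod (f x * g x) \<le> M * cmod (f x)" for x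
      using mult_right_mono[OF assms(3)[of x], of "cmod (f x)"] C0_outside[OF assms(1), of x]
      by (cases "x \<in> topspace S") (auto simp: norm_mult mult.commute)
  qed
  then show "(\<lambda>x. g x * f x) \<in> C0 S" by (simp add: mult.commute)
qed

lemma C0_mult: "f \<in> C0 S \<Longrightarrow> g \<in> C0 S \<Longrightarrow> (\<lambda>x. f x * g x) \<in> C0 S"
  by (metis C0_bounded C0_continuous C0_mult_bounded(1))

lemma C0_cnj: "f \<in> C0 S \<Longrightarrow> (\<lambda>x. cnj (f x)) \<in> C0 S"
  by (rule C0_dominated[of _ _ f 1]) (auto intro: continuous_map_cnj C0_continuous)

lemma C0_scale: "f \<in> C0 S \<Longrightarrow> (\<lambda>x. c * f x) \<in> C0 S"
  by (rule C0_mult_bounded(2)[where M = "cmod c"]) auto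

lemma locally_compact_bump:
  assumes S: "locally_compact_space S" "Hausdorff_space S" and U: "openin S U" "x \<in> U"
  obtains f :: "'a \<Rightarrow> real" and K
  where "continuous_map S euclidean f" "f x = 1" "\<And>y. 0 \<le> f y" "\<And>y. f y \<noteq> 0 \<Longrightarrow> y \<in> U \<inter> K"
    "compactin S K"
proof -
  have x: "x \<in> topspace S" using U openin_subset by blast
  obtain V K where VK: "openin S V" "compactin S K" "x \<in> V" "V \<subseteq> K"
    using S(1) x unfolding locally_compact_space_def by blast
  have "completely_regular_space S"
    using S locally_compact_Hausdorff_imp_regular_space
      locally_compact_regular_imp_completely_regular_space by blast
  moreover have "closedin S (topspace S - U \<inter> V)" using U VK by blast
  ultimately obtain g where g: "continuous_map S (top_of_set {0..1::real}) g" "g x = 0"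
    "g ` (topspace S - U \<inter> V) \<subseteq> {1}"
    using x U VK unfolding completely_regular_space_def by (metis Diff_iff IntI)
  have g': "continuous_map S euclidean g" "\<And>y. y \<in> topspace S \<Longrightarrow> g y \<in> {0..1}"
    using g(1) by (auto simp: continuous_map_in_subtopology)
  define f where "f y = (if y \<in> topspace S then 1 - g y else 0)" for y
  have "continuous_map S euclidean (\<lambda>y. 1 - g y)"
    using g'(1) by (auto simp: continuous_map_euclidean_iff intro!: tendsto_intros)
  then have "continuous_map S euclidean f"
    by (rule continuous_map_eq) (simp add: f_def)
  moreover have "f y \<noteq> 0 \<Longrightarrow> y \<in> U \<inter> K" for y
    using g(3) VK(4) by (auto simp: f_def split: if_splits)
  ultimately show ?thesis
    using g' x g(2) VK(2) by (intro that[of f K]) (auto simp: f_def)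
qed

subsection \<open>Translation is continuous on functions vanishing at infinity\<close>

text \<open>On the compact set where \<open>\<bar>f\<bar> \<ge> \<epsilon> / 2\<close> the tube lemma gives a neighbourhood of the identity that
  works for all \<open>y\<close> at once.  Making it symmetric also covers the case where only \<open>y w\<close> lies in
  the compact set, and otherwise both values are small.\<close>

lemma C0_uniformly_continuous:
  fixes H (structure)
  assumes H: "locally_compact_group H S" and f: "f \<in> C0 S" and e: "\<epsilon> > 0"
  shows "\<exists>W. openin S W \<and> \<one> \<in> W \<and> (\<forall>w\<in>W. \<forall>y\<in>carrier H. cmod (f (y \<otimes> w) - f y) < \<epsilon>)"
proof -
  interpret group H using H by (simp add: locally_compact_group_def)
  have top: "topspace S = carrier H"
    and cmult: "continuous_map (prod_topology S S) S (\<lambda>(x, y). x \<otimes> y)"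
    and cinv: "continuous_map S S (\<lambda>x. inv x)"
    using H by (simp_all add: locally_compact_group_def)
  define F where "F = (\<lambda>p. f (fst p \<otimes> snd p) - f (fst p))"
  have cF: "continuous_map (prod_topology S S) euclidean F"
  proof -
    have "continuous_map (prod_topology S S) euclidean (\<lambda>p. f (fst p \<otimes> snd p))"
      using continuous_map_compose[OF cmult C0_continuous[OF f]] by (simp add: o_def case_prod_unfold)
    moreover have "continuous_map (prod_topology S S) euclidean (\<lambda>p. f (fst p))"
      using continuous_map_compose[OF continuous_map_fst C0_continuous[OF f]] by (simp add: o_def)
    ultimately show ?thesis
      unfolding F_def by (rule continuous_map_cdiff)
  qed
  let ?K = "{x \<in> topspace S. \<epsilon> / 2 \<le> cmod (f x)}"
  have K: "compactin S ?K" using C0_compact[OF f, of "\<epsilon> / 2"] e by simp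
  define N where "N = {p \<in> topspace (prod_topology S S). F p \<in> ball 0 \<epsilon>}"
  have "openin (prod_topology S S) N"
    unfolding N_def by (rule openin_continuous_map_preimage[OF cF]) (simp flip: open_openin)
  moreover have "?K \<times> {\<one>} \<subseteq> N" using e by (auto simp: N_def F_def top)
  ultimately obtain U V where UV: "openin S U" "openin S V" "?K \<subseteq> U" "\<one> \<in> V" "U \<times> V \<subseteq> N"
    using tube_lemma_left[OF _ K, of S N \<one>] top by auto
  define W where "W = V \<inter> {w \<in> topspace S. inv w \<in> V}"
  have "openin S W"
    unfolding W_def by (intro openin_Int UV openin_continuous_map_preimage[OF cinv])
  moreover have "\<one> \<in> W" using UV top by (simp add: W_def)
  moreover have "cmod (f (y \<otimes> w) - f y) < \<epsilon>" if w: "w \<in> W" and y: "y \<in> carrier H" for w y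
  proof -
    have wH: "w \<in> carrier H" using w UV(2) top openin_subset by (auto simp: W_def)
    have N: "cmod (f (x \<otimes> v) - f x) < \<epsilon>" if "x \<in> ?K" "v \<in> V" for x v
    proof -
      have "(x, v) \<in> N" using that UV by blast
      then show ?thesis by (simp add: N_def F_def)
    qed
    consider "y \<in> ?K" | "y \<otimes> w \<in> ?K" | "cmod (f y) < \<epsilon> / 2" "cmod (f (y \<otimes> w)) < \<epsilon> / 2"
      using y wH top by force
    then show ?thesis
    proof cases
      case 1
      then show ?thesis using N w by (simp add: W_def)
    next
      case 2
      then have "cmod (f (y \<otimes> w \<otimes> inv w) - f (y \<otimes> w)) < \<epsilon>"
        using w by (intro N) (auto simp: W_def)
      moreover have "y \<otimes> w \<otimes> inv w = y" using y wH by (simp add: m_assoc)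
      ultimately show ?thesis by (simp add: norm_minus_commute)
    next
      case 3
      then show ?thesis using norm_triangle_ineq4[of "f (y \<otimes> w)" "f y"] by simp
    qed
  qed
  ultimately show ?thesis by blast
qed

lemma C0_translation_continuous:
  fixes H (structure)
  assumes H: "locally_compact_group H S" and f: "f \<in> C0 S" and e: "\<epsilon> > 0" and x0: "x0 \<in> carrier H"
  shows "\<exists>V. openin S V \<and> x0 \<in> V \<and> (\<forall>x\<in>V. \<forall>y\<in>carrier H. cmod (f (y \<otimes> x) - f (y \<otimes> x0)) < \<epsilon>)"
proof -
  interpret group H using H by (simp add: locally_compact_group_def)
  have top: "topspace S = carrier H"
    and cmult: "continuous_map (prod_topology S S) S (\<lambda>(x, y). x \<otimes> y)"
    using H by (simp_all add: locally_compact_group_def)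
  obtain W where W: "openin S W" "\<one> \<in> W"
    "\<And>w y. w \<in> W \<Longrightarrow> y \<in> carrier H \<Longrightarrow> cmod (f (y \<otimes> w) - f y) < \<epsilon>"
    using C0_uniformly_continuous[OF H f e] by blast
  have "continuous_map S S (\<lambda>x. inv x0 \<otimes> x)"
  proof -
    have "continuous_map S (prod_topology S S) (\<lambda>x. (inv x0, x))"
      using x0 top by (intro continuous_map_pairedI) auto
    from continuous_map_compose[OF this cmult] show ?thesis by (simp add: o_def)
  qed
  then have "openin S {x \<in> topspace S. inv x0 \<otimes> x \<in> W}"
    using W(1) by (rule openin_continuous_map_preimage)
  moreover have "x0 \<in> {x \<in> topspace S. inv x0 \<otimes> x \<in> W}" using x0 W(2) top by simp
  moreover have "cmod (f (y \<otimes> x) - f (y \<otimes> x0)) < \<epsilon>"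
    if "x \<in> {x \<in> topspace S. inv x0 \<otimes> x \<in> W}" "y \<in> carrier H" for x y
  proof -
    have x: "x \<in> carrier H" "inv x0 \<otimes> x \<in> W" using that top by auto
    have "y \<otimes> x0 \<otimes> (inv x0 \<otimes> x) = y \<otimes> x"
      using x x0 that(2) by (metis inv_closed inv_solve_left m_assoc m_closed)
    then show ?thesis using W(3)[OF x(2), of "y \<otimes> x0"] that(2) x0 by simp
  qed
  ultimately show ?thesis by blast
qed

subsection \<open>Integrals over the circle\<close>

lemma continuous_map_integral:
  fixes h :: "'a \<Rightarrow> real \<Rightarrow> complex"
  assumes h: "continuous_map (prod_topology S euclidean) euclidean (\<lambda>(x, t). h x t)" and ab: "a \<le> b"
  shows "continuous_map S euclidean (\<lambda>x. integral {a..b} (h x))"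
  unfolding continuous_map_metric_iff
proof (intro ballI allI impI)
  fix x0 and \<epsilon> :: real assume x0: "x0 \<in> topspace S" and e: "\<epsilon> > 0"
  have cont: "continuous_on UNIV (h x)" if "x \<in> topspace S" for x
  proof -
    have "continuous_map euclidean (prod_topology S euclidean) (\<lambda>t :: real. (x, t))"
      using that by (intro continuous_map_pairedI) auto
    from continuous_map_compose[OF this h] show ?thesis by (simp add: o_def)
  qed
  define \<delta> where "\<delta> = \<epsilon> / (2 * (b - a + 1))"
  have \<delta>: "\<delta> > 0" using e ab by (simp add: \<delta>_def)
  have "\<delta> * (b - a) \<le> \<delta> * (b - a + 1)" using \<delta> by simp
  also have "\<dots> = \<epsilon> / 2" using ab by (simp add: \<delta>_def field_simps)
  finally have \<delta>_less: "\<delta> * (b - a) < \<epsilon>" using e by simp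
  have c0: "continuous_map (prod_topology S euclidean) euclidean (\<lambda>(x, t). h x0 t)"
  proof -
    have "continuous_map (prod_topology S euclidean) euclidean (\<lambda>p. h x0 (snd p))"
      using continuous_map_compose[OF continuous_map_snd, of "euclidean :: real topology" euclidean "h x0" S]
        cont[OF x0] by (simp add: o_def)
    then show ?thesis by (simp add: case_prod_unfold)
  qed
  define N where "N = {p \<in> topspace (prod_topology S euclidean).
     (\<lambda>(x, t). h x t) p - (\<lambda>(x, t). h x0 t) p \<in> ball 0 \<delta>}"
  have "continuous_map (prod_topology S euclidean) euclidean
     (\<lambda>p. (\<lambda>(x, t). h x t) p - (\<lambda>(x, t). h x0 t) p)"
    by (rule continuous_map_cdiff[OF h c0])
  then have "openin (prod_topology S euclidean) N"
    unfolding N_def by (rule openin_continuous_map_preimage) (simp flip: open_openin)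
  moreover have "{x0} \<times> {a..b} \<subseteq> N" using x0 \<delta> by (auto simp: N_def)
  ultimately obtain U V where UV: "openin S U" "x0 \<in> U" "{a..b} \<subseteq> V" "U \<times> V \<subseteq> N"
    using tube_lemma_right[of S euclidean N "{a..b}" x0] x0 by auto
  have "dist (integral {a..b} (h x)) (integral {a..b} (h x0)) < \<epsilon>" if x: "x \<in> U" for x
  proof -
    have xS: "x \<in> topspace S" using x UV(1) openin_subset by blast
    have int: "h x integrable_on {a..b}" "h x0 integrable_on {a..b}"
      by (auto intro!: integrable_continuous_real continuous_on_subset[OF cont] xS x0)
    have "norm (h x t - h x0 t) \<le> \<delta>" if "t \<in> {a..b}" for t
    proof -
      have "(x, t) \<in> N" using x that UV by blast
      then show ?thesis by (simp add: N_def)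
    qed
    then have "norm (integral {a..b} (\<lambda>t. h x t - h x0 t)) \<le> \<delta> * (b - a)"
      using int ab by (intro integral_bound) (auto intro!: continuous_intros continuous_on_subset[OF cont] xS x0)
    then show ?thesis using \<delta>_less int by (simp add: dist_norm integral_diff)
  qed
  then show "\<exists>U. openin S U \<and> x0 \<in> U \<and>
      (\<forall>x\<in>U. dist (integral {a..b} (h x)) (integral {a..b} (h x0)) < \<epsilon>)"
    using UV by blast
qed

lemma integral_shift_periodic:
  fixes k :: "real \<Rightarrow> complex"
  assumes cont: "continuous_on UNIV k" and per: "\<And>t. k (t + p) = k t" and a: "0 \<le> a" "a \<le> p"
  shows "integral {0..p} (\<lambda>t. k (t + a)) = integral {0..p} k"
proof -
  have int: "k integrable_on {u..v}" for u v
    by (intro integrable_continuous_real continuous_on_subset[OF cont]) auto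
  have shift: "integral {u..v} (\<lambda>t. k (t + c)) = integral {u+c..v+c} k" for u v c
    using integral_shift_Icc_real[of u v k c] by (simp add: o_def add.commute)
  have "integral {0..p} (\<lambda>t. k (t + a)) = integral {a..p} k + integral {p..p+a} k"
    using Henstock_Kurzweil_Integration.integral_combine[where a = a and c = p and b = "p + a" and f = k] a int by (simp add: shift add.commute)
  also have "integral {p..p+a} k = integral {0..a} k"
    using shift[of 0 a p] per by (simp add: add.commute)
  also have "integral {a..p} k + integral {0..a} k = integral {0..p} k"
    using Henstock_Kurzweil_Integration.integral_combine[where a = 0 and c = a and b = p and f = k] a int by (simp add: add.commute)
  finally show ?thesis .
qed

section \<open>The extension defined by a cocycle\<close>

lemma continuous_map_right_translation:
  fixes H (structure)
  assumes H: "locally_compact_group H S" and x: "x \<in> carrier H"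
  shows "continuous_map S S (\<lambda>y. y \<otimes> x)"
proof -
  have top: "topspace S = carrier H"
    and cmult: "continuous_map (prod_topology S S) S (\<lambda>(x, y). x \<otimes> y)"
    using H by (simp_all add: locally_compact_group_def)
  have "continuous_map S (prod_topology S S) (\<lambda>y. (y, x))"
    using x top by (intro continuous_map_pairedI) auto
  from continuous_map_compose[OF this cmult] show ?thesis by (simp add: o_def)
qed

lemma C0_rt:
  fixes H (structure)
  assumes H: "locally_compact_group H S" and f: "f \<in> C0 S" and x: "x \<in> carrier H"
  shows "rt H x f \<in> C0 S"
proof -
  interpret group H using H by (simp add: locally_compact_group_def)
  have top: "topspace S = carrier H" using H by (simp add: locally_compact_group_def)
  note cont = continuous_map_right_translation[OF H]
  have "continuous_map S euclidean (\<lambda>y. f (y \<otimes> x))"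
    using continuous_map_compose[OF cont[OF x] C0_continuous[OF f]] by (simp add: o_def)
  then have c: "continuous_map S euclidean (rt H x f)"
    by (rule continuous_map_eq) (simp add: rt_def top)
  have "compactin S {y \<in> topspace S. \<epsilon> \<le> cmod (rt H x f y)}" if "\<epsilon> > 0" for \<epsilon>
  proof (rule closed_compactin)
    show "compactin S ((\<lambda>y. y \<otimes> inv x) ` {y \<in> topspace S. \<epsilon> \<le> cmod (f y)})"
      using C0_compact[OF f that] cont[OF inv_closed[OF x]] by (rule image_compactin)
    show "{y \<in> topspace S. \<epsilon> \<le> cmod (rt H x f y)}
      \<subseteq> (\<lambda>y. y \<otimes> inv x) ` {y \<in> topspace S. \<epsilon> \<le> cmod (f y)}"
    proof
      fix y assume "y \<in> {y \<in> topspace S. \<epsilon> \<le> cmod (rt H x f y)}"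
      then have "y \<otimes> x \<in> {y \<in> topspace S. \<epsilon> \<le> cmod (f y)}" "y = y \<otimes> x \<otimes> inv x"
        using x by (auto simp: rt_def top m_assoc)
      then show "y \<in> (\<lambda>y. y \<otimes> inv x) ` {y \<in> topspace S. \<epsilon> \<le> cmod (f y)}" by blast
    qed
  qed (rule closedin_norm_ge[OF c])
  then show ?thesis using c by (simp add: C0_def rt_def top)
qed

locale circle_extension =
  fixes G :: "('g, 'm) monoid_scheme" (structure) and T :: "'g topology"
    and \<omega> :: "'g \<times> 'g \<Rightarrow> complex" and T\<omega> :: "('g \<times> complex) topology"
  assumes lcg: "locally_compact_group G T"
    and cocycle: "\<omega> \<in> Z2 G T"
    and extension: "extension_topology G T \<omega> T\<omega>"
begin

abbreviation G\<omega> :: "('g \<times> complex) monoid" where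
  "G\<omega> \<equiv> ext_group G \<omega>"

sublocale group G
  using lcg by (simp add: locally_compact_group_def)

lemma lcg_ext: "locally_compact_group G\<omega> T\<omega>"
  using extension by (simp add: extension_topology_def)

sublocale ext: group G\<omega>
  using lcg_ext by (simp add: locally_compact_group_def)

lemma carrier_ext [simp]: "carrier G\<omega> = carrier G \<times> circle"
  and mult_ext [simp]: "(g, z) \<otimes>\<^bsub>G\<omega>\<^esub> (h, w) = (g \<otimes> h, \<omega> (g, h) * z * w)"
  and one_ext: "\<one>\<^bsub>G\<omega>\<^esub> = (\<one>, 1)"
  by (simp_all add: ext_group_def)

lemma topspaces [simp]: "topspace T = carrier G" "topspace T\<omega> = carrier G \<times> circle"
  using lcg lcg_ext by (auto simp: locally_compact_group_def)

lemma norm_cocycle [simp]: "s \<in> carrier G \<Longrightarrow> t \<in> carrier G \<Longrightarrow> cmod (\<omega> (s, t)) = 1"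
  and cocycle_one [simp]: "s \<in> carrier G \<Longrightarrow> \<omega> (s, \<one>) = 1"
  and cocycle_eq: "s \<in> carrier G \<Longrightarrow> t \<in> carrier G \<Longrightarrow> r \<in> carrier G \<Longrightarrow>
    \<omega> (s, t) * \<omega> (s \<otimes> t, r) = \<omega> (s, t \<otimes> r) * \<omega> (t, r)"
  using cocycle by (auto simp: Z2_def)

lemma fst_continuous: "continuous_map T\<omega> T fst"
  using extension by (simp add: extension_topology_def)

lemma fst_quotient: "quotient_map T\<omega> T fst"
proof -
  have "fst ` topspace T\<omega> = topspace T" by (auto simp: image_iff intro!: bexI[of _ 1])
  then show ?thesis
    using extension by (intro continuous_open_imp_quotient_map) (auto simp: extension_topology_def)
qed

lemma rotation_continuous:
  "continuous_map (prod_topology T\<omega> euclidean) T\<omega> (\<lambda>(x, t). (fst x, snd x * cis t))"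
proof -
  have "homeomorphic_map (top_of_set circle) (subtopology T\<omega> (iota G ` circle)) (iota G)"
    using extension by (simp add: extension_topology_def embedding_map_def)
  then have iota: "continuous_map (top_of_set circle) T\<omega> (iota G)"
    by (intro continuous_map_into_fulltopology[OF homeomorphic_imp_continuous_map])
  have cis: "continuous_map euclidean (top_of_set circle) cis"
    by (auto simp: continuous_map_in_subtopology intro!: continuous_intros)
  have "continuous_map (prod_topology T\<omega> euclidean) (prod_topology T\<omega> T\<omega>)
      (\<lambda>p. (fst p, iota G (cis (snd p))))"
    using continuous_map_compose[OF continuous_map_snd continuous_map_compose[OF cis iota], of T\<omega>]
    by (intro continuous_map_pairedI continuous_map_fst) (simp add: o_def)
  moreover have "continuous_map (prod_topology T\<omega> T\<omega>) T\<omega> (\<lambda>(x, y). x \<otimes>\<^bsub>G\<omega>\<^esub> y)"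
    using lcg_ext by (simp add: locally_compact_group_def)
  ultimately have "continuous_map (prod_topology T\<omega> euclidean) T\<omega>
      ((\<lambda>(x, y). x \<otimes>\<^bsub>G\<omega>\<^esub> y) \<circ> (\<lambda>p. (fst p, iota G (cis (snd p)))))"
    by (rule continuous_map_compose)
  then show ?thesis
    by (rule continuous_map_eq) (auto simp: iota_def)
qed

subsection \<open>Homogeneous functions on the extension\<close>

lemma C0_iota_C0: "\<xi> \<in> C0_iota G \<omega> T\<omega> \<Longrightarrow> \<xi> \<in> C0 T\<omega>"
  by (simp add: C0_iota_def)

lemma C0_iota_fiber:
  assumes "\<xi> \<in> C0_iota G \<omega> T\<omega>" "g \<in> carrier G" "w \<in> circle" "z \<in> circle"
  shows "\<xi> (g, w * z) = cnj z * \<xi> (g, w)"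
proof -
  have "\<xi> ((g, w) \<otimes>\<^bsub>G\<omega>\<^esub> iota G z) = cnj z * \<xi> (g, w)"
    using assms by (simp add: C0_iota_def)
  then show ?thesis using assms by (simp add: iota_def)
qed

lemma C0_iota_csec:
  assumes "\<xi> \<in> C0_iota G \<omega> T\<omega>" "g \<in> carrier G" "z \<in> circle"
  shows "\<xi> (g, z) = cnj z * \<xi> (csec g)"
  using C0_iota_fiber[OF assms(1,2), of 1 z] assms(3) by (simp add: csec_def)

lemma C0_iotaI:
  assumes "\<xi> \<in> C0 T\<omega>"
    and "\<And>g w z. g \<in> carrier G \<Longrightarrow> w \<in> circle \<Longrightarrow> z \<in> circle \<Longrightarrow> \<xi> (g, w * z) = cnj z * \<xi> (g, w)"
  shows "\<xi> \<in> C0_iota G \<omega> T\<omega>"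
  using assms by (auto simp: C0_iota_def iota_def)

lemma C0_iota_add:
  "\<xi> \<in> C0_iota G \<omega> T\<omega> \<Longrightarrow> \<eta> \<in> C0_iota G \<omega> T\<omega> \<Longrightarrow> (\<lambda>x. \<xi> x + \<eta> x) \<in> C0_iota G \<omega> T\<omega>"
  by (rule C0_iotaI) (auto simp: C0_iota_C0 C0_add C0_iota_fiber distrib_left)

lemma C0_iota_mult_bounded:
  assumes "continuous_map T euclidean q" "\<And>g. g \<in> carrier G \<Longrightarrow> cmod (q g) \<le> M"
    and "\<xi> \<in> C0_iota G \<omega> T\<omega>"
  shows "(\<lambda>x. q (fst x) * \<xi> x) \<in> C0_iota G \<omega> T\<omega>"
proof (rule C0_iotaI)
  have "continuous_map T\<omega> euclidean (\<lambda>x. q (fst x))"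
    using continuous_map_compose[OF fst_continuous assms(1)] by (simp add: o_def)
  then show "(\<lambda>x. q (fst x) * \<xi> x) \<in> C0 T\<omega>"
    using assms by (intro C0_mult_bounded(2)[where M = M]) (auto simp: C0_iota_C0)
qed (auto simp: C0_iota_fiber[OF assms(3)])

lemma C0_iota_mult_C0:
  assumes "f \<in> C0 T" "\<xi> \<in> C0_iota G \<omega> T\<omega>"
  shows "(\<lambda>x. f (fst x) * \<xi> x) \<in> C0_iota G \<omega> T\<omega>"
  using C0_bounded[OF assms(1)] C0_iota_mult_bounded[OF C0_continuous[OF assms(1)] _ assms(2)]
  by metis

lemma C0_iota_rt:
  assumes "x \<in> carrier G\<omega>" "\<xi> \<in> C0_iota G \<omega> T\<omega>"
  shows "rt G\<omega> x \<xi> \<in> C0_iota G \<omega> T\<omega>"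
proof (rule C0_iotaI)
  show "rt G\<omega> x \<xi> \<in> C0 T\<omega>" using C0_rt[OF lcg_ext C0_iota_C0[OF assms(2)] assms(1)] .
  fix g w z assume g: "g \<in> carrier G" and w: "w \<in> circle" and z: "z \<in> circle"
  obtain h v where x: "x = (h, v)" "h \<in> carrier G" "v \<in> circle" using assms(1) by auto
  have "\<xi> (g \<otimes> h, \<omega> (g, h) * w * v * z) = cnj z * \<xi> (g \<otimes> h, \<omega> (g, h) * w * v)"
    using g w z x by (intro C0_iota_fiber[OF assms(2)]) (auto simp: norm_mult)
  then show "rt G\<omega> x \<xi> (g, w * z) = cnj z * rt G\<omega> x \<xi> (g, w)"
    using g w z x by (simp add: rt_def norm_mult mult_ac)
qed

text \<open>The function \<open>cnj \<xi> * \<eta>\<close> is constant on the fibres, and the projection onto \<open>G\<close> is an open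
  quotient map, so it descends to a continuous function on \<open>G\<close>.\<close>

lemma C0_iota_inner:
  assumes "\<xi> \<in> C0_iota G \<omega> T\<omega>" "\<eta> \<in> C0_iota G \<omega> T\<omega>"
  shows "(\<lambda>g. cnj (\<xi> (csec g)) * \<eta> (csec g)) \<in> C0 T"
proof -
  define h where "h g = cnj (\<xi> (csec g)) * \<eta> (csec g)" for g
  define k where "k x = cnj (\<xi> x) * \<eta> x" for x
  have k: "k \<in> C0 T\<omega>"
    unfolding k_def using assms by (intro C0_mult C0_cnj C0_iota_C0)
  have hk: "h (fst x) = k x" if x_in: "x \<in> topspace T\<omega>" for x
  proof -
    obtain g z where x: "x = (g, z)" "g \<in> carrier G" "z \<in> circle" using x_in by auto
    have "z * cnj z = 1" using x complex_norm_square[of z] by simp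
    then show ?thesis
      using x by (simp add: h_def k_def C0_iota_csec[OF assms(1)] C0_iota_csec[OF assms(2)]
          flip: mult.assoc)
  qed
  have "continuous_map T\<omega> euclidean (h \<circ> fst)"
    by (rule continuous_map_eq[OF C0_continuous[OF k]]) (simp add: hk)
  then have cont: "continuous_map T euclidean h"
    by (rule continuous_compose_quotient_map[OF fst_quotient])
  have "compactin T {g \<in> topspace T. \<epsilon> \<le> cmod (h g)}" if "\<epsilon> > 0" for \<epsilon>
  proof (rule closed_compactin)
    show "compactin T (fst ` {x \<in> topspace T\<omega>. \<epsilon> \<le> cmod (k x)})"
      by (rule image_compactin[OF C0_compact[OF k that] fst_continuous])
    show "{g \<in> topspace T. \<epsilon> \<le> cmod (h g)} \<subseteq> fst ` {x \<in> topspace T\<omega>. \<epsilon> \<le> cmod (k x)}"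
    proof
      fix g assume "g \<in> {g \<in> topspace T. \<epsilon> \<le> cmod (h g)}"
      then have "csec g \<in> {x \<in> topspace T\<omega>. \<epsilon> \<le> cmod (k x)}" by (auto simp: h_def k_def csec_def)
      then show "g \<in> fst ` {x \<in> topspace T\<omega>. \<epsilon> \<le> cmod (k x)}"
        by (rule image_eqI[rotated]) (simp add: csec_def)
    qed
  qed (rule closedin_norm_ge[OF cont])
  moreover have "h g = 0" if "g \<notin> topspace T" for g
    using that C0_outside[OF C0_iota_C0[OF assms(2)]] by (simp add: h_def csec_def)
  ultimately have "h \<in> C0 T" using cont by (simp add: C0_def)
  then show ?thesis by (simp add: h_def[abs_def])
qed

text \<open>Averaging \<open>z f(x z)\<close> over the circle turns a bump function \<open>f\<close> around the identity into a
  homogeneous function; it does not vanish at the identity when the support of \<open>f\<close> meets the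
  central circle only in the half plane \<open>Re z > 0\<close>.\<close>

lemma C0_iota_nonzero_at_one: "\<exists>\<xi>\<in>C0_iota G \<omega> T\<omega>. \<xi> (\<one>, 1) \<noteq> 0"
proof -
  let ?Z = "{z \<in> circle. 0 < Re z}"
  have "openin (top_of_set circle) ?Z"
  proof -
    have "?Z = circle \<inter> {z. 0 < Re z}" by auto
    then show ?thesis
      by (simp add: openin_open_Int open_Collect_less continuous_on_Re continuous_on_id)
  qed
  moreover have "homeomorphic_map (top_of_set circle) (subtopology T\<omega> (iota G ` circle)) (iota G)"
    using extension by (simp add: extension_topology_def embedding_map_def)
  ultimately have "openin (subtopology T\<omega> (iota G ` circle)) (iota G ` ?Z)"
    using homeomorphic_imp_open_map unfolding open_map_def by blast
  then obtain U where U: "openin T\<omega> U" "iota G ` ?Z = U \<inter> iota G ` circle"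
    by (auto simp: openin_subtopology)
  have "(\<one>, 1) \<in> iota G ` ?Z" by (auto simp: iota_def)
  then have oneU: "(\<one>, 1) \<in> U" using U by auto
  have "locally_compact_space T\<omega>" "Hausdorff_space T\<omega>"
    using lcg_ext by (simp_all add: locally_compact_group_def)
  then obtain f :: "'g \<times> complex \<Rightarrow> real" and K where f: "continuous_map T\<omega> euclidean f"
    "f (\<one>, 1) = 1" "\<And>y. 0 \<le> f y" "\<And>y. f y \<noteq> 0 \<Longrightarrow> y \<in> U \<inter> K" "compactin T\<omega> K"
    using locally_compact_bump[OF _ _ U(1) oneU] by blast
  have f0: "f y = 0" if "y \<notin> topspace T\<omega>" for y
    using f(4)[of y] that U(1) openin_subset by blast
  define \<xi> where "\<xi> x = integral {0..2*pi} (\<lambda>t. cis t * f (fst x, snd x * cis t))" for x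
  let ?R = "\<lambda>(x, t). (fst x, snd x * cis t)"
  have contR: "continuous_map (prod_topology T\<omega> euclidean) euclidean
      (\<lambda>(x, t). cis t * complex_of_real (f (fst x, snd x * cis t)))"
  proof -
    have "continuous_map (prod_topology T\<omega> euclidean) euclidean (\<lambda>p. f (?R p))"
      using continuous_map_compose[OF rotation_continuous f(1)] by (simp add: o_def)
    then have "continuous_map (prod_topology T\<omega> euclidean) euclidean (\<lambda>p. complex_of_real (f (?R p)))"
      unfolding continuous_map_euclidean_iff by (intro ballI tendsto_of_real) blast
    moreover have "continuous_map (prod_topology T\<omega> euclidean) euclidean (\<lambda>p. cis (snd p))"
      using continuous_map_compose[OF continuous_map_snd, of "euclidean :: real topology" euclidean cis T\<omega>]
      by (simp add: o_def continuous_on_cis continuous_on_id)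
    ultimately have "continuous_map (prod_topology T\<omega> euclidean) euclidean
        (\<lambda>p. cis (snd p) * complex_of_real (f (?R p)))"
      by (intro continuous_map_cmult)
    then show ?thesis by (simp add: case_prod_unfold)
  qed
  have cont: "continuous_map T\<omega> euclidean \<xi>"
    unfolding \<xi>_def by (rule continuous_map_integral[OF contR]) simp
  have section_cont: "continuous_on UNIV (\<lambda>t. cis t * complex_of_real (f (g, w * cis t)))"
    if "g \<in> carrier G" "w \<in> circle" for g w
  proof -
    have "continuous_map euclidean (prod_topology T\<omega> euclidean) (\<lambda>t :: real. ((g, w), t))"
      using that by (intro continuous_map_pairedI) auto
    from continuous_map_compose[OF this contR] show ?thesis by (simp add: o_def)
  qed
  have fiber: "\<xi> (g, w * z) = cnj z * \<xi> (g, w)"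
    if g: "g \<in> carrier G" "w \<in> circle" and z: "z \<in> circle" for g w z
  proof -
    define a where "a = Arg2pi z"
    have z_cis: "z = cis a" and a: "0 \<le> a" "a \<le> 2 * pi"
      using complex_norm_eq_1_exp[of z] z Arg2pi_ge_0[of z] Arg2pi_lt_2pi[of z]
      by (auto simp: a_def cis_conv_exp)
    define k where "k t = cis t * complex_of_real (f (g, w * cis t))" for t
    have k: "continuous_on UNIV k" unfolding k_def by (rule section_cont[OF g])
    have per: "k (t + 2 * pi) = k t" for t by (simp add: k_def cis_mult[symmetric])
    have "\<xi> (g, w * z) = integral {0..2*pi} (\<lambda>t. cnj z * k (t + a))"
    proof -
      have "cis t * complex_of_real (f (g, w * z * cis t)) = cnj z * k (t + a)" for t
      proof -
        have "cnj z * k (t + a) = (cnj (cis a) * cis a) * (cis t * complex_of_real (f (g, w * (cis a * cis t))))"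
          by (simp add: k_def z_cis cis_mult[symmetric] mult_ac)
        also have "cnj (cis a) * cis a = 1" by (simp add: cis_cnj cis_mult)
        finally show ?thesis by (simp add: z_cis mult.assoc)
      qed
      then show ?thesis by (simp add: \<xi>_def)
    qed
    also have "\<dots> = cnj z * integral {0..2*pi} (\<lambda>t. k (t + a))" by simp
    also have "integral {0..2*pi} (\<lambda>t. k (t + a)) = integral {0..2*pi} k"
      by (rule integral_shift_periodic[where k = k and p = "2 * pi" and a = a, OF k per a])
    also have "integral {0..2*pi} k = \<xi> (g, w)" by (simp add: \<xi>_def k_def[abs_def])
    finally show ?thesis .
  qed
  (* The support of \<xi> lies in the union of the rotates of K. *)
  define L where "L = ?R ` (K \<times> {- (2*pi)..0})"
  have L: "compactin T\<omega> L"
    unfolding L_def using f(5)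
    by (intro image_compactin[OF _ rotation_continuous]) (simp add: compactin_Times)
  have support: "x \<in> L" if "\<xi> x \<noteq> 0" for x
  proof -
    have "\<exists>t\<in>{0..2*pi}. f (fst x, snd x * cis t) \<noteq> 0"
    proof (rule ccontr)
      assume "\<not> ?thesis"
      then have "\<xi> x = integral {0..2*pi} (\<lambda>t. 0)"
        unfolding \<xi>_def by (intro integral_cong) auto
      then show False using that by simp
    qed
    then obtain t where t: "t \<in> {0..2*pi}" "(fst x, snd x * cis t) \<in> K" using f(4) by blast
    have "cis t * cis (- t) = 1" by (simp add: cis_mult)
    then have "x = ?R ((fst x, snd x * cis t), - t)" by (simp add: prod_eq_iff mult.assoc)
    then show ?thesis unfolding L_def by (rule image_eqI) (use t in auto)
  qed
  have "compactin T\<omega> {x \<in> topspace T\<omega>. \<epsilon> \<le> cmod (\<xi> x)}" if "\<epsilon> > 0" for \<epsilon>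
  proof (rule closed_compactin[OF L])
    show "{x \<in> topspace T\<omega>. \<epsilon> \<le> cmod (\<xi> x)} \<subseteq> L" by (intro subsetI support) (use that in auto)
  qed (rule closedin_norm_ge[OF cont])
  moreover have "\<xi> x = 0" if "x \<notin> topspace T\<omega>" for x
    using support[of x] that compactin_subset_topspace[OF L] by blast
  ultimately have "\<xi> \<in> C0 T\<omega>" using cont by (simp add: C0_def)
  then have "\<xi> \<in> C0_iota G \<omega> T\<omega>" using fiber by (rule C0_iotaI)
  moreover have "\<xi> (\<one>, 1) \<noteq> 0"
  proof
    assume zero: "\<xi> (\<one>, 1) = 0"
    let ?k = "\<lambda>t. cis t * complex_of_real (f (\<one>, cis t))"
    have kc: "continuous_on UNIV ?k" using section_cont[of \<one> 1] by simp
    have "(?k has_integral 0) {0..2*pi}"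
      using zero integrable_integral[OF integrable_continuous_real[OF continuous_on_subset[OF kc]], of 0 "2*pi"]
      by (simp add: \<xi>_def)
    from has_integral_Re[OF this]
    have int: "((\<lambda>t. Re (?k t)) has_integral 0) (cbox 0 (2*pi))" by simp
    have "0 \<le> Re (?k t)" for t
    proof (cases "f (\<one>, cis t) = 0")
      case False
      then have "iota G (cis t) \<in> U \<inter> iota G ` circle" using f(4) by (auto simp: iota_def)
      then have "iota G (cis t) \<in> iota G ` ?Z" using U by simp
      then have "0 < cos t" by (auto simp: iota_def)
      then show ?thesis using f(3) by simp
    qed simp
    moreover have "continuous_on (cbox 0 (2*pi)) (\<lambda>t. Re (?k t))"
      by (intro continuous_on_Re continuous_on_subset[OF kc]) auto
    moreover have "box 0 (2 * pi) \<noteq> {}" by (simp add: not_le)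
    ultimately have "Re (?k 0) = 0"
      by (intro has_integral_0_cbox_imp_0[OF _ _ int]) auto
    then show False using f(2) by simp
  qed
  ultimately show ?thesis by blast
qed

text \<open>Right translation moves the base point.\<close>

lemma C0_iota_nonzero:
  assumes "g \<in> carrier G"
  shows "\<exists>\<xi>\<in>C0_iota G \<omega> T\<omega>. \<xi> (csec g) \<noteq> 0"
proof -
  obtain \<xi> where \<xi>: "\<xi> \<in> C0_iota G \<omega> T\<omega>" "\<xi> (\<one>, 1) \<noteq> 0"
    using C0_iota_nonzero_at_one by blast
  have g: "csec g \<in> carrier G\<omega>" using assms by (simp add: csec_def)
  have "rt G\<omega> (inv\<^bsub>G\<omega>\<^esub> csec g) \<xi> (csec g) = \<xi> (\<one>, 1)"
    using g ext.r_inv[OF g] by (simp add: rt_def one_ext del: carrier_ext)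
  then show ?thesis using C0_iota_rt[OF ext.inv_closed[OF g] \<xi>(1)] \<xi>(2) by metis
qed

text \<open>Fullness of the bimodule: if \<open>p = \<Sum>i. cnj \<xi>i * \<xi>i\<close> is positive on a compact set outside of
  which \<open>f\<close> is small, then \<open>f\<close> is close to \<open>f p / (p + \<eta>)\<close> for small \<open>\<eta> > 0\<close>, and this is the sum of
  the inner products of \<open>\<xi>i\<close> with \<open>f / (p + \<eta>) \<xi>i\<close>.\<close>

lemma C0_approx_inner:
  assumes f: "f \<in> C0 T" and e: "\<epsilon> > 0"
  shows "\<exists>ps\<in>lists (C0_iota G \<omega> T\<omega> \<times> C0_iota G \<omega> T\<omega>).
    \<forall>g. cmod (f g - (\<Sum>(\<xi>, \<eta>)\<leftarrow>ps. cnj (\<xi> (csec g)) * \<eta> (csec g))) < \<epsilon>"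
proof -
  define K where "K = {g \<in> topspace T. \<epsilon> / 2 \<le> cmod (f g)}"
  have K: "compactin T K" unfolding K_def using C0_compact[OF f, of "\<epsilon> / 2"] e by simp
  have K_sub: "K \<subseteq> carrier G" by (auto simp: K_def)
  obtain \<Xi> where \<Xi>: "\<And>g. g \<in> carrier G \<Longrightarrow> \<Xi> g \<in> C0_iota G \<omega> T\<omega>"
    "\<And>g. g \<in> carrier G \<Longrightarrow> \<Xi> g (csec g) \<noteq> 0"
    using C0_iota_nonzero by metis
  define O' where "O' g = {h \<in> topspace T. cnj (\<Xi> g (csec h)) * \<Xi> g (csec h) \<in> - {0}}" for g
  have O': "openin T (O' g)" "g \<in> O' g" if "g \<in> K" for g
  proof -
    have g: "g \<in> carrier G" using that K_sub by blast
    show "openin T (O' g)"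
      unfolding O'_def
      by (rule openin_continuous_map_preimage[OF C0_continuous[OF C0_iota_inner[OF \<Xi>(1)[OF g] \<Xi>(1)[OF g]]]])
        (auto simp flip: open_openin intro: open_Compl)
    show "g \<in> O' g" using \<Xi>(2)[OF g] g by (simp add: O'_def)
  qed
  have "\<exists>\<F>. finite \<F> \<and> \<F> \<subseteq> O' ` K \<and> K \<subseteq> \<Union>\<F>"
    by (rule compactinD[OF K]) (use O' in auto)
  then obtain \<F> where \<F>: "finite \<F>" "\<F> \<subseteq> O' ` K" "K \<subseteq> \<Union>\<F>" by blast
  obtain D where D: "D \<subseteq> K" "finite D" and \<F>_eq: "\<F> = O' ` D"
    using finite_subset_image[OF \<F>(1,2)] by auto
  have K_cover: "K \<subseteq> \<Union>(O' ` D)" using \<F>(3) \<F>_eq by simp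
  obtain xs where xs: "set xs = \<Xi> ` D" using finite_list[of "\<Xi> ` D"] D(2) by auto
  have xs_in: "\<xi> \<in> C0_iota G \<omega> T\<omega>" if "\<xi> \<in> set xs" for \<xi> using that xs D(1) K_sub \<Xi>(1) by auto
  define p where "p g = (\<Sum>\<xi>\<leftarrow>xs. (cmod (\<xi> (csec g)))\<^sup>2)" for g
  have p_eq: "complex_of_real (p g) = (\<Sum>\<xi>\<leftarrow>xs. cnj (\<xi> (csec g)) * \<xi> (csec g))" for g
    unfolding p_def by (induction xs) (simp_all add: complex_norm_square mult.commute del: of_real_power)
  have p_nonneg: "0 \<le> p g" for g unfolding p_def by (rule sum_list_nonneg) auto
  have p_cont: "continuous_map T euclidean (\<lambda>g. complex_of_real (p g))"
    unfolding p_eq using xs_in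
    by (induction xs) (auto intro!: continuous_map_cadd intro: C0_continuous[OF C0_iota_inner])
  have p_pos: "0 < p g" if g: "g \<in> K" for g
  proof -
    obtain h where h: "h \<in> D" "g \<in> O' h" using g K_cover by blast
    have "(cmod (\<Xi> h (csec g)))\<^sup>2 \<le> p g"
      unfolding p_def using h(1) xs by (intro member_le_sum_list) auto
    moreover have "\<Xi> h (csec g) \<noteq> 0" using h(2) by (auto simp: O'_def)
    ultimately show ?thesis by (smt (verit) zero_less_norm_iff zero_less_power)
  qed
  obtain \<delta> where \<delta>: "\<delta> > 0" "\<And>g. g \<in> K \<Longrightarrow> \<delta> \<le> p g"
  proof (cases "K = {}")
    case True
    then show ?thesis using that[of 1] by simp
  next
    case False
    have "compact ((\<lambda>g. complex_of_real (p g)) ` K)"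
      using image_compactin[OF K p_cont] by simp
    then have "compact (Re ` (\<lambda>g. complex_of_real (p g)) ` K)"
      by (intro compact_continuous_image continuous_on_Re continuous_on_id)
    then have "compact (p ` K)" by (simp add: image_image)
    then obtain m where "m \<in> p ` K" "\<forall>y\<in>p ` K. m \<le> y"
      using compact_attains_inf[of "p ` K"] False by auto
    then show ?thesis using p_pos that[of m] by auto
  qed
  obtain M where M: "M > 0" "\<And>g. cmod (f g) \<le> M" using C0_bounded[OF f] by blast
  (* On K the error is at most M e' / \<delta> = \<epsilon> / 2. *)
  define e' where "e' = \<epsilon> * \<delta> / (2 * M)"
  have e': "e' > 0" using e \<delta>(1) M(1) by (simp add: e'_def)
  define q where "q g = f g / (complex_of_real (p g) + complex_of_real e')" for g
  have pe: "cmod (complex_of_real (p g) + complex_of_real e') = p g + e'" for g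
    using p_nonneg[of g] e' by (metis abs_of_nonneg add_nonneg_nonneg less_imp_le norm_of_real of_real_add)
  have pe0: "complex_of_real (p g) + complex_of_real e' \<noteq> 0" for g
    using pe[of g] p_nonneg[of g] e' by auto
  have q_cont: "continuous_map T euclidean q"
    unfolding q_def using pe0
    by (intro continuous_map_cdivide continuous_map_cadd p_cont C0_continuous[OF f]) auto
  have q_bound: "cmod (q g) \<le> M / e'" for g
  proof -
    have "cmod (q g) = cmod (f g) / (p g + e')" by (simp add: q_def norm_divide pe)
    also have "\<dots> \<le> M / e'" using M e' p_nonneg[of g] by (intro frac_le) auto
    finally show ?thesis .
  qed
  let ?ps = "map (\<lambda>\<xi>. (\<xi>, \<lambda>x. q (fst x) * \<xi> x)) xs"
  have ps_in: "?ps \<in> lists (C0_iota G \<omega> T\<omega> \<times> C0_iota G \<omega> T\<omega>)"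
    using xs_in C0_iota_mult_bounded[OF q_cont q_bound] by auto
  have sum: "(\<Sum>(\<xi>, \<eta>)\<leftarrow>?ps. cnj (\<xi> (csec g)) * \<eta> (csec g)) = q g * complex_of_real (p g)" for g
    unfolding p_eq by (induction xs) (auto simp: csec_def algebra_simps)
  have "cmod (f g - q g * complex_of_real (p g)) < \<epsilon>" for g
  proof -
    have "f g - q g * complex_of_real (p g) = f g * complex_of_real e' / (complex_of_real (p g) + complex_of_real e')"
      using pe0[of g] by (simp add: q_def field_simps)
    then have eq: "cmod (f g - q g * complex_of_real (p g)) = cmod (f g) * (e' / (p g + e'))"
      using e' by (simp add: norm_divide norm_mult pe)
    show ?thesis
    proof (cases "g \<in> K")
      case True
      have "cmod (f g) * (e' / (p g + e')) \<le> M * (e' / \<delta>)"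
        using M e' \<delta>(1) \<delta>(2)[OF True] by (intro mult_mono frac_le) auto
      also have "\<dots> = \<epsilon> / 2" using M \<delta> by (simp add: e'_def)
      finally show ?thesis using e unfolding eq by linarith
    next
      case False
      then have small: "cmod (f g) \<le> \<epsilon> / 2"
        using C0_outside[OF f, of g] e by (cases "g \<in> topspace T") (auto simp: K_def)
      have "cmod (f g) * (e' / (p g + e')) \<le> cmod (f g) * 1"
        using e' p_nonneg[of g] by (intro mult_left_mono) auto
      then show ?thesis using e small unfolding eq by linarith
    qed
  qed
  then show ?thesis using ps_in sum by (intro bexI[of _ ?ps]) simp_all
qed

end

section \<open>The algebra generated by the cocycle and the homogeneous functions\<close>

lemma isCont_of_norm_le:
  fixes R :: "'a::real_normed_vector \<Rightarrow> 'b::real_normed_vector"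
  assumes diff: "\<And>x y. R (x - y) = R x - R y" and bound: "\<And>x. norm (R x) \<le> M * norm x"
  shows "isCont R b"
proof -
  have "((\<lambda>x. R x - R b) \<longlongrightarrow> 0) (at b)"
  proof (rule Lim_null_comparison)
    show "\<forall>\<^sub>F x in at b. norm (R x - R b) \<le> M * norm (x - b)"
      using bound by (simp flip: diff)
    have "((\<lambda>x. M * norm (x - b)) \<longlongrightarrow> M * norm (b - b)) (at b)" by (intro tendsto_intros)
    then show "((\<lambda>x. M * norm (x - b)) \<longlongrightarrow> 0) (at b)" by simp
  qed
  then show ?thesis unfolding isCont_def by (rule LIM_zero_cancel)
qed

lemma continuous_map_uniform_approx:
  fixes f :: "'a \<Rightarrow> 'b::real_normed_vector"
  assumes "\<And>\<epsilon>. \<epsilon> > 0 \<Longrightarrow> \<exists>g. continuous_map S euclidean g \<and> (\<forall>x\<in>topspace S. norm (f x - g x) < \<epsilon>)"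
  shows "continuous_map S euclidean f"
  unfolding continuous_map_metric_iff
proof (intro ballI allI impI)
  fix x and \<epsilon> :: real assume x: "x \<in> topspace S" and e: "\<epsilon> > 0"
  obtain g where g: "continuous_map S euclidean g" "\<forall>x\<in>topspace S. norm (f x - g x) < \<epsilon> / 3"
    using assms[of "\<epsilon> / 3"] e by auto
  obtain U where U: "openin S U" "x \<in> U" "\<forall>y\<in>U. dist (g y) (g x) < \<epsilon> / 3"
    using g(1)[unfolded continuous_map_metric_iff, rule_format, of x "\<epsilon> / 3"] x e by auto
  have "dist (f y) (f x) < \<epsilon>" if y: "y \<in> U" for y
  proof -
    have yS: "y \<in> topspace S" using y U(1) openin_subset by blast
    have "dist (f y) (f x) \<le> dist (f y) (g y) + dist (g y) (g x) + dist (g x) (f x)"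
      using dist_triangle[of "f y" "f x" "g y"] dist_triangle[of "g y" "f x" "g x"] by linarith
    also have "\<dots> < \<epsilon> / 3 + \<epsilon> / 3 + \<epsilon> / 3"
      using g(2) U(3) y yS x by (intro add_strict_mono) (auto simp: dist_norm norm_minus_commute)
    finally show ?thesis by simp
  qed
  then show "\<exists>U. openin S U \<and> x \<in> U \<and> (\<forall>y\<in>U. dist (f y) (f x) < \<epsilon>)" using U by blast
qed

locale extended_weak_algebra = circle_extension G T \<omega> T\<omega>
  for G :: "('g, 'm) monoid_scheme" (structure) and T \<omega> T\<omega> +
  fixes \<mu> :: "'g measure" and \<beta> :: "'g \<Rightarrow> 'b \<Rightarrow> 'b::cstar_algebra"
    and \<phi> \<phi>' :: "('g \<Rightarrow> complex) \<Rightarrow> 'b \<Rightarrow> 'b"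
  assumes sets_\<mu>: "sets \<mu> = sets (borel_of T)"
    and weak: "weak_algebra G T \<beta> \<phi>"
    and hom: "star_hom (fun_alg (D_alg G T \<mu> \<omega> T\<omega>)) multiplier_alg \<phi>'"
    and respects: "respects_loc_ae T \<mu> (D_alg G T \<mu> \<omega> T\<omega>) \<phi>'"
    and unital: "\<phi>' (\<lambda>t. 1) = id"
    and equivar: "equivariant G \<beta> (D_alg G T \<mu> \<omega> T\<omega>) \<phi>'"
    and extends: "\<forall>f\<in>C0 T. \<phi>' f = \<phi> f"
begin

abbreviation D :: "('g \<Rightarrow> complex) set" where
  "D \<equiv> D_alg G T \<mu> \<omega> T\<omega>"

lemma D_gen_C0_iota: "\<xi> \<in> C0_iota G \<omega> T\<omega> \<Longrightarrow> \<xi> \<circ> csec \<in> D"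
  and D_gen_cocycle: "g \<in> carrier G \<Longrightarrow> (\<lambda>t. \<omega> (t, g)) \<in> D"
  and D_add: "f \<in> D \<Longrightarrow> h \<in> D \<Longrightarrow> (\<lambda>x. f x + h x) \<in> D"
  and D_scale: "f \<in> D \<Longrightarrow> (\<lambda>x. c * f x) \<in> D"
  and D_mult: "f \<in> D \<Longrightarrow> h \<in> D \<Longrightarrow> (\<lambda>x. f x * h x) \<in> D"
  and D_cnj: "f \<in> D \<Longrightarrow> (\<lambda>x. cnj (f x)) \<in> D"
  and D_rt: "g \<in> carrier G \<Longrightarrow> f \<in> D \<Longrightarrow> rt G g f \<in> D"
  and D_zero: "(\<lambda>x. 0) \<in> D"
  unfolding D_alg_def invariant_closed_star_subalgebra_def by blast+

lemma D_closed:
  assumes "f \<in> Linf T \<mu>" "\<And>\<epsilon>. \<epsilon> > 0 \<Longrightarrow> \<exists>h\<in>D. Linf_norm T \<mu> (\<lambda>x. f x - h x) < \<epsilon>"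
  shows "f \<in> D"
  unfolding D_alg_def
proof (intro InterI)
  fix A assume A: "A \<in> {A. invariant_closed_star_subalgebra G T \<mu> A \<and>
     {f \<circ> csec | f. f \<in> C0_iota G \<omega> T\<omega>} \<union> {(\<lambda>t. \<omega> (t, g)) | g. g \<in> carrier G} \<subseteq> A}"
  then have "D \<subseteq> A" unfolding D_alg_def by blast
  then have "\<forall>\<epsilon>>0. \<exists>h\<in>A. Linf_norm T \<mu> (\<lambda>x. f x - h x) < \<epsilon>" using assms(2) by blast
  then show "f \<in> A" using A assms(1) by (simp add: invariant_closed_star_subalgebra_def)
qed

lemma space_\<mu>: "space \<mu> = carrier G"
  using sets_eq_imp_space_eq[OF sets_\<mu>] by (simp add: borel_of_def space_measure_of_conv)

lemma loc_ae_I: "(\<And>x. x \<in> carrier G \<Longrightarrow> P x) \<Longrightarrow> loc_ae T \<mu> P"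
  unfolding loc_ae_def by (auto intro!: AE_I2 simp: space_\<mu>)

lemma Linf_norm_le:
  assumes "\<And>x. x \<in> carrier G \<Longrightarrow> cmod (f x) \<le> C" "0 \<le> C"
  shows "Linf_norm T \<mu> f \<le> C"
  unfolding Linf_norm_def using assms by (intro cInf_lower bdd_belowI[of _ 0]) (auto intro: loc_ae_I)

lemma Linf_I:
  assumes "continuous_map T euclidean f" "\<And>x. x \<in> carrier G \<Longrightarrow> cmod (f x) \<le> C"
  shows "f \<in> Linf T \<mu>"
proof -
  have "f \<in> borel_measurable (borel_of T)"
  proof (rule borel_measurableI)
    fix S :: "complex set" assume "open S"
    then have "openin T {x \<in> topspace T. f x \<in> S}"
      by (intro openin_continuous_map_preimage[OF assms(1)]) simp
    moreover have "{U. openin T U} \<subseteq> Pow (topspace T)" using openin_subset by fast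
    moreover have "f -` S \<inter> space (borel_of T) = {x \<in> topspace T. f x \<in> S}"
      by (auto simp: borel_of_def space_measure_of_conv)
    ultimately show "f -` S \<inter> space (borel_of T) \<in> sets (borel_of T)"
      by (simp only: borel_of_def in_measure_of mem_Collect_eq)
  qed
  moreover have "loc_ae T \<mu> (\<lambda>x. cmod (f x) \<le> C)" by (rule loc_ae_I) (rule assms(2))
  ultimately show ?thesis unfolding Linf_def by blast
qed

text \<open>The generator \<open>\<omega> (\<cdot>, \<one>)\<close> is \<open>1\<close> on the group but unspecified outside of it; as \<open>D\<close> is closed for the
  seminorm of \<open>L\<^sup>\<infinity>\<close>, it also contains the constant function on the whole type.\<close>

lemma D_one: "(\<lambda>t. 1) \<in> D"
proof (rule D_closed)
  show "(\<lambda>t. 1) \<in> Linf T \<mu>" by (rule Linf_I[of _ 1]) auto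
  fix \<epsilon> :: real assume "\<epsilon> > 0"
  moreover have "Linf_norm T \<mu> (\<lambda>x. 1 - \<omega> (x, \<one>)) \<le> 0" by (rule Linf_norm_le) auto
  ultimately show "\<exists>h\<in>D. Linf_norm T \<mu> (\<lambda>x. 1 - h x) < \<epsilon>"
    using D_gen_cocycle[OF one_closed] by (intro bexI[of _ "\<lambda>t. \<omega> (t, \<one>)"]) auto
qed

lemma D_sum_inner:
  assumes "ps \<in> lists (C0_iota G \<omega> T\<omega> \<times> C0_iota G \<omega> T\<omega>)"
  shows "(\<lambda>g. \<Sum>(\<xi>, \<eta>)\<leftarrow>ps. cnj (\<xi> (csec g)) * \<eta> (csec g)) \<in> D \<inter> C0 T"
  using assms
proof (induction ps)
  case (Cons p ps)
  obtain \<xi> \<eta> where p: "p = (\<xi>, \<eta>)" by force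
  have in_D: "(\<lambda>g. cnj (\<xi> (csec g)) * \<eta> (csec g)) \<in> D"
    using D_mult[OF D_cnj[OF D_gen_C0_iota[of \<xi>]] D_gen_C0_iota[of \<eta>]] Cons p
    by (auto simp: o_def)
  show ?case
    using Cons p D_add[OF in_D] C0_add[OF C0_iota_inner[of \<xi> \<eta>]] by simp
qed (simp add: D_zero C0_zero)

text \<open>By fullness of the bimodule, functions in \<open>C\<^sub>0(G)\<close> are uniform limits of sums of the products
  \<open>cnj (\<xi> \<circ> csec) * (\<eta> \<circ> csec)\<close>.\<close>

lemma C0_subset_D: "C0 T \<subseteq> D"
proof
  fix f assume f: "f \<in> C0 T"
  obtain M where "\<And>x. cmod (f x) \<le> M" using C0_bounded[OF f] by blast
  then have "f \<in> Linf T \<mu>" by (intro Linf_I C0_continuous[OF f])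
  then show "f \<in> D"
  proof (rule D_closed)
    fix \<epsilon> :: real assume e: "\<epsilon> > 0"
    obtain ps where ps: "ps \<in> lists (C0_iota G \<omega> T\<omega> \<times> C0_iota G \<omega> T\<omega>)"
      "\<forall>g. cmod (f g - (\<Sum>(\<xi>, \<eta>)\<leftarrow>ps. cnj (\<xi> (csec g)) * \<eta> (csec g))) < \<epsilon> / 2"
      using C0_approx_inner[OF f, of "\<epsilon> / 2"] e by auto
    have "Linf_norm T \<mu> (\<lambda>g. f g - (\<Sum>(\<xi>, \<eta>)\<leftarrow>ps. cnj (\<xi> (csec g)) * \<eta> (csec g))) \<le> \<epsilon> / 2"
      using ps(2) e by (intro Linf_norm_le) (auto intro: less_imp_le)
    then show "\<exists>h\<in>D. Linf_norm T \<mu> (\<lambda>x. f x - h x) < \<epsilon>"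
      using D_sum_inner[OF ps(1)] e
      by (intro bexI[of _ "\<lambda>g. \<Sum>(\<xi>, \<eta>)\<leftarrow>ps. cnj (\<xi> (csec g)) * \<eta> (csec g)"]) auto
  qed
qed

section \<open>The extended homomorphism\<close>

lemma \<phi>'_cong:
  assumes "f \<in> D" "h \<in> D" "\<And>t. t \<in> carrier G \<Longrightarrow> f t = h t"
  shows "\<phi>' f = \<phi>' h"
  using respects assms loc_ae_I[of "\<lambda>x. f x = h x"] by (auto simp: respects_loc_ae_def)

lemma \<phi>'_adjointable: "f \<in> D \<Longrightarrow> \<phi>' f \<in> adjointables self_module"
  and \<phi>'_add: "f \<in> D \<Longrightarrow> h \<in> D \<Longrightarrow> \<phi>' (\<lambda>x. f x + h x) b = \<phi>' f b + \<phi>' h b"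
  and \<phi>'_scale: "f \<in> D \<Longrightarrow> \<phi>' (\<lambda>x. c * f x) b = c *\<^sub>C \<phi>' f b"
  and \<phi>'_mult: "f \<in> D \<Longrightarrow> h \<in> D \<Longrightarrow> \<phi>' (\<lambda>x. f x * h x) b = \<phi>' f (\<phi>' h b)"
  and \<phi>'_star: "f \<in> D \<Longrightarrow> \<phi>' (\<lambda>x. cnj (f x)) = (THE S. is_adjoint self_module (\<phi>' f) S)"
  using hom by (auto simp: star_hom_def fun_alg_def multiplier_alg_def adjointable_alg_def
      self_module_def compose_def)

lemma \<phi>'_adjoint:
  assumes "f \<in> D"
  shows "is_adjoint self_module (\<phi>' f) (\<phi>' (\<lambda>x. cnj (f x)))"
  using \<phi>'_adjointable[OF assms] \<phi>'_star[OF assms] the_adjoint_self_module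
  by (auto simp: adjointables_self_module)

lemma \<phi>'_zero: "\<phi>' (\<lambda>x. 0) b = 0"
  using \<phi>'_scale[OF D_zero, of 0] by simp

lemma \<phi>'_diff: "f \<in> D \<Longrightarrow> h \<in> D \<Longrightarrow> \<phi>' (\<lambda>x. f x - h x) b = \<phi>' f b - \<phi>' h b"
  using \<phi>'_add[of f "\<lambda>x. (-1) * h x"] D_scale[of h "-1"] \<phi>'_scale[of h "-1"]
  by (simp add: scaleC_minus_one)

text \<open>A real \<open>f\<close> with values in \<open>[-1, 1]\<close> satisfies \<open>f\<^sup>2 + (1 - h)\<^sup>2 = 1\<close> for
  \<open>h = 1 - sqrt (1 - f\<^sup>2)\<close>, which vanishes at infinity as well.\<close>

lemma \<phi>'_real_contractive:
  assumes f: "(\<lambda>x. complex_of_real (f x)) \<in> C0 T" and le: "\<And>x. \<bar>f x\<bar> \<le> 1"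
  shows "norm (\<phi>' (\<lambda>x. complex_of_real (f x)) b) \<le> norm b"
proof -
  define h where "h x = 1 - sqrt (1 - (f x)\<^sup>2)" for x
  have f2: "(f x)\<^sup>2 \<le> 1" for x using le[of x] by (simp add: abs_square_le_1)
  have h_eq: "(f x)\<^sup>2 + (h x)\<^sup>2 = h x + h x" for x
    using f2[of x] by (simp add: h_def power2_diff)
  have h: "(\<lambda>x. complex_of_real (h x)) \<in> C0 T"
  proof (rule C0_dominated[OF _ f, of _ 1])
    have "continuous_map T euclidean (\<lambda>x. Re (complex_of_real (f x)))"
      using C0_continuous[OF f] unfolding continuous_map_euclidean_iff by (intro ballI tendsto_Re) blast
    then have "continuous_map T euclidean f" by simp
    then show "continuous_map T euclidean (\<lambda>x. complex_of_real (h x))"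
      unfolding continuous_map_euclidean_iff h_def by (intro ballI tendsto_intros) blast
    show "cmod (complex_of_real (h x)) \<le> 1 * cmod (complex_of_real (f x))" for x
    proof -
      have "0 \<le> h x" using f2[of x] by (simp add: h_def)
      moreover have "1 - (f x)\<^sup>2 \<le> sqrt (1 - (f x)\<^sup>2)"
        using f2[of x] by (intro real_le_rsqrt) (simp add: power2_eq_square mult_left_le)
      then have "h x \<le> (f x)\<^sup>2" by (simp add: h_def)
      moreover have "(f x)\<^sup>2 \<le> \<bar>f x\<bar>"
        using mult_left_le[OF le[of x], of "\<bar>f x\<bar>"] by (simp add: power2_eq_square)
      ultimately show ?thesis by simp
    qed
  qed
  note D = subsetD[OF C0_subset_D f] subsetD[OF C0_subset_D h]
  show ?thesis
  proof (rule norm_le_of_pythagoras)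
    show "is_adjoint self_module (\<phi>' (\<lambda>x. complex_of_real (f x))) (\<phi>' (\<lambda>x. complex_of_real (f x)))"
      "is_adjoint self_module (\<phi>' (\<lambda>x. complex_of_real (h x))) (\<phi>' (\<lambda>x. complex_of_real (h x)))"
      using \<phi>'_adjoint[OF D(1)] \<phi>'_adjoint[OF D(2)] by simp_all
    fix c
    show "\<phi>' (\<lambda>x. complex_of_real (f x)) (\<phi>' (\<lambda>x. complex_of_real (h x)) c)
        = \<phi>' (\<lambda>x. complex_of_real (h x)) (\<phi>' (\<lambda>x. complex_of_real (f x)) c)"
      using D by (simp add: mult.commute flip: \<phi>'_mult)
    have "complex_of_real (f x) * complex_of_real (f x) + complex_of_real (h x) * complex_of_real (h x)
        = complex_of_real (h x) + complex_of_real (h x)" for x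
      using h_eq[of x] by (simp add: power2_eq_square flip: of_real_mult of_real_add)
    then show "\<phi>' (\<lambda>x. complex_of_real (f x)) (\<phi>' (\<lambda>x. complex_of_real (f x)) c)
        + \<phi>' (\<lambda>x. complex_of_real (h x)) (\<phi>' (\<lambda>x. complex_of_real (h x)) c)
        = \<phi>' (\<lambda>x. complex_of_real (h x)) c + \<phi>' (\<lambda>x. complex_of_real (h x)) c"
      using D by (simp add: D_mult flip: \<phi>'_mult \<phi>'_add)
  qed
qed

text \<open>The C*-identity reduces the estimate to \<open>\<bar>f\<bar>\<^sup>2\<close>, where the real case applies.  It is used both
  for functions in \<open>C\<^sub>0(G)\<close> and for sections \<open>\<xi> \<circ> csec\<close>, which need not be continuous.\<close>

lemma \<phi>'_bound:
  assumes f: "f \<in> D" and ff: "(\<lambda>x. cnj (f x) * f x) \<in> C0 T" and M: "\<And>x. cmod (f x) \<le> M" "M > 0"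
  shows "norm (\<phi>' f b) \<le> M * norm b"
proof -
  define k where "k x = (cmod (f x) / M)\<^sup>2" for x
  have k_eq: "(\<lambda>x. cnj (f x) * f x) = (\<lambda>x. complex_of_real (M\<^sup>2) * complex_of_real (k x))"
    using M by (auto simp: k_def power_divide complex_norm_square mult.commute
        simp del: of_real_power simp flip: of_real_mult)
  have k: "(\<lambda>x. complex_of_real (k x)) \<in> C0 T"
  proof -
    have "(\<lambda>x. complex_of_real (1 / M\<^sup>2) * (cnj (f x) * f x)) \<in> C0 T" by (rule C0_scale[OF ff])
    also have "(\<lambda>x. complex_of_real (1 / M\<^sup>2) * (cnj (f x) * f x)) = (\<lambda>x. complex_of_real (k x))"
      using M(2) fun_cong[OF k_eq] by (simp add: fun_eq_iff)
    finally show ?thesis .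
  qed
  have "\<bar>k x\<bar> \<le> 1" for x
    using M(1)[of x] M(2) by (simp add: k_def power_le_one)
  note contr = \<phi>'_real_contractive[OF k this]
  have "star (\<phi>' f b) * \<phi>' f b = star b * \<phi>' (\<lambda>x. cnj (f x)) (\<phi>' f b)"
    using \<phi>'_adjoint[OF f] by (simp add: is_adjoint_self_module)
  also have "\<dots> = star b * \<phi>' (\<lambda>x. cnj (f x) * f x) b"
    using f by (simp add: \<phi>'_mult D_cnj)
  also have "\<dots> = star b * (complex_of_real (M\<^sup>2) *\<^sub>C \<phi>' (\<lambda>x. complex_of_real (k x)) b)"
    unfolding k_eq using subsetD[OF C0_subset_D k] by (simp only: \<phi>'_scale)
  finally have "(norm (\<phi>' f b))\<^sup>2 \<le> norm b * (M\<^sup>2 * norm (\<phi>' (\<lambda>x. complex_of_real (k x)) b))"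
    using cstar_identity[of "\<phi>' f b"]
      norm_mult_ineq[of "star b" "complex_of_real (M\<^sup>2) *\<^sub>C \<phi>' (\<lambda>x. complex_of_real (k x)) b"]
    by (simp add: norm_scaleC norm_power)
  also have "\<dots> \<le> norm b * (M\<^sup>2 * norm b)"
    using contr by (intro mult_left_mono) auto
  also have "\<dots> = (M * norm b)\<^sup>2" by (simp add: power2_eq_square)
  finally show ?thesis by (rule power2_le_imp_le) (use M(2) in simp)
qed

lemma \<phi>'_bound_C0:
  assumes "f \<in> C0 T" "\<And>x. cmod (f x) \<le> M" "M > 0"
  shows "norm (\<phi>' f b) \<le> M * norm b"
  by (rule \<phi>'_bound[OF subsetD[OF C0_subset_D assms(1)] C0_mult[OF C0_cnj[OF assms(1)] assms(1)]])
    (use assms in auto)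

lemma \<phi>'_bound_C0_iota:
  assumes "\<xi> \<in> C0_iota G \<omega> T\<omega>" "\<And>x. cmod (\<xi> x) \<le> M" "M > 0"
  shows "norm (\<phi>' (\<xi> \<circ> csec) b) \<le> M * norm b"
proof (rule \<phi>'_bound[OF D_gen_C0_iota[OF assms(1)]])
  show "(\<lambda>x. cnj ((\<xi> \<circ> csec) x) * (\<xi> \<circ> csec) x) \<in> C0 T"
    using C0_iota_inner[OF assms(1,1)] by simp
qed (use assms in auto)

end

lemma subspace_closure:
  fixes S :: "'a::real_normed_vector set"
  assumes S: "subspace S"
  shows "subspace (closure S)"
proof (rule subspaceI)
  show "0 \<in> closure S" using subspace_0[OF S] closure_subset by blast
  fix x assume "x \<in> closure S"
  then obtain u where u: "\<And>n. u n \<in> S" "u \<longlonglongrightarrow> x" by (auto simp: closure_sequential)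
  show "c *\<^sub>R x \<in> closure S" for c
    unfolding closure_sequential
    using u by (intro exI[of _ "\<lambda>n. c *\<^sub>R u n"]) (auto intro: tendsto_scaleR subspace_scale[OF S])
  fix y assume "y \<in> closure S"
  then obtain v where v: "\<And>n. v n \<in> S" "v \<longlonglongrightarrow> y" by (auto simp: closure_sequential)
  show "x + y \<in> closure S"
    unfolding closure_sequential
    using u v by (intro exI[of _ "\<lambda>n. u n + v n"]) (auto intro: tendsto_add subspace_add[OF S])
qed

context extended_weak_algebra
begin

section \<open>The module isomorphism\<close>

abbreviation P :: "((('g \<times> complex \<Rightarrow> complex) \<times> 'b) list, 'b) hmod" where
  "P \<equiv> formal_tensor (C0_iota_module G \<omega> T\<omega>) \<phi>"

abbreviation E :: "((nat \<Rightarrow> (('g \<times> complex \<Rightarrow> complex) \<times> 'b) list) set, 'b) hmod" where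
  "E \<equiv> L_mod G \<omega> T\<omega> \<phi>"

text \<open>The candidate for the module isomorphism, before separation and completion.\<close>

definition \<Theta> :: "(('g \<times> complex \<Rightarrow> complex) \<times> 'b) list \<Rightarrow> 'b" where
  "\<Theta> u = (\<Sum>(\<xi>, b)\<leftarrow>u. \<phi>' (\<xi> \<circ> csec) b)"

lemma \<Theta>_simps [simp]:
  "\<Theta> [] = 0" "\<Theta> ((\<xi>, b) # u) = \<phi>' (\<xi> \<circ> csec) b + \<Theta> u" "\<Theta> (u @ v) = \<Theta> u + \<Theta> v"
  by (simp_all add: \<Theta>_def)

lemma carrier_P: "hm_carrier P = lists (C0_iota G \<omega> T\<omega> \<times> UNIV)"
  by (simp add: formal_tensor_def C0_iota_module_def)

lemma carrier_P_induct [consumes 1, case_names Nil Cons]: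
  assumes "u \<in> hm_carrier P" "Q []"
    and "\<And>\<xi> b u. \<xi> \<in> C0_iota G \<omega> T\<omega> \<Longrightarrow> u \<in> hm_carrier P \<Longrightarrow> Q u \<Longrightarrow> Q ((\<xi>, b) # u)"
  shows "Q u"
  using assms(1) unfolding carrier_P by (induction u) (auto intro: assms(2,3) simp: carrier_P)

text \<open>The inner product of \<open>\<xi>\<close> and \<open>\<eta>\<close> is literally \<open>cnj (\<xi> \<circ> csec) * (\<eta> \<circ> csec)\<close>, so multiplicativity
  of \<open>\<phi>'\<close> makes \<open>\<Theta>\<close> preserve inner products.\<close>

lemma \<phi>'_section_inner:
  assumes "\<xi> \<in> C0_iota G \<omega> T\<omega>" "\<eta> \<in> C0_iota G \<omega> T\<omega>"
  shows "star b * \<phi> (\<lambda>g. cnj (\<xi> (csec g)) * \<eta> (csec g)) c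
    = star (\<phi>' (\<xi> \<circ> csec) b) * \<phi>' (\<eta> \<circ> csec) c"
proof -
  have D: "\<xi> \<circ> csec \<in> D" "\<eta> \<circ> csec \<in> D" using assms by (auto intro: D_gen_C0_iota)
  have "\<phi> (\<lambda>g. cnj (\<xi> (csec g)) * \<eta> (csec g)) c = \<phi>' (\<lambda>g. cnj (\<xi> (csec g)) * \<eta> (csec g)) c"
    using extends C0_iota_inner[OF assms] by simp
  also have "\<dots> = \<phi>' (\<lambda>g. cnj ((\<xi> \<circ> csec) g)) (\<phi>' (\<eta> \<circ> csec) c)"
    using \<phi>'_mult[OF D_cnj[OF D(1)] D(2)] by (simp add: o_def)
  finally show ?thesis
    using \<phi>'_adjoint[OF D(1)] by (simp add: is_adjoint_self_module)
qed

lemma \<Theta>_inner: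
  assumes u: "u \<in> hm_carrier P" and v: "v \<in> hm_carrier P"
  shows "hm_inner P u v = star (\<Theta> u) * \<Theta> v"
proof -
  have inner_P: "hm_inner P u v = (\<Sum>(\<xi>, b)\<leftarrow>u. \<Sum>(\<eta>, c)\<leftarrow>v.
      star b * \<phi> (\<lambda>g. cnj (\<xi> (csec g)) * \<eta> (csec g)) c)"
    by (simp add: formal_tensor_def C0_iota_module_def)
  have row: "(\<Sum>(\<eta>, c)\<leftarrow>v. star b * \<phi> (\<lambda>g. cnj (\<xi> (csec g)) * \<eta> (csec g)) c)
      = star (\<phi>' (\<xi> \<circ> csec) b) * \<Theta> v" if "\<xi> \<in> C0_iota G \<omega> T\<omega>" for \<xi> b
    using v
    by (induction rule: carrier_P_induct) (simp_all add: \<phi>'_section_inner that distrib_left o_def)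
  show ?thesis
    unfolding inner_P using u
    by (induction rule: carrier_P_induct) (simp_all add: row star_add distrib_right)
qed

lemma \<Theta>_scale:
  assumes "u \<in> hm_carrier P"
  shows "\<Theta> (map (\<lambda>(\<xi>, b). (\<xi>, c *\<^sub>C b)) u) = c *\<^sub>C \<Theta> u"
  using assms
  by (induction rule: carrier_P_induct)
    (simp_all add: scaleC_add_right adjointable_scaleC[OF \<phi>'_adjoint[OF D_gen_C0_iota]])

lemma \<Theta>_act:
  assumes "u \<in> hm_carrier P"
  shows "\<Theta> (map (\<lambda>(\<xi>, b). (\<xi>, b * a)) u) = \<Theta> u * a"
  using assms
  by (induction rule: carrier_P_induct)
    (simp_all add: distrib_right adjointable_mult[OF \<phi>'_adjoint[OF D_gen_C0_iota]])

text \<open>\<open>\<phi> (cnj \<xi> \<eta>) b\<close> is the image of \<open>\<eta> \<otimes> \<phi>' (cnj \<xi>) b\<close>, so fullness of the bimodule and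
  nondegeneracy of \<open>\<phi>\<close> give density.\<close>

lemma \<Theta>_dense:
  assumes "\<epsilon> > 0"
  shows "\<exists>u\<in>hm_carrier P. norm (b - \<Theta> u) < \<epsilon>"
proof -
  have sub: "subspace (\<Theta> ` hm_carrier P)"
  proof (rule subspaceI)
    show "0 \<in> \<Theta> ` hm_carrier P" by (rule image_eqI[of _ _ "[]"]) (auto simp: carrier_P)
    fix x assume "x \<in> \<Theta> ` hm_carrier P"
    then obtain u where u: "u \<in> hm_carrier P" "x = \<Theta> u" by blast
    show "c *\<^sub>R x \<in> \<Theta> ` hm_carrier P" for c
      using u \<Theta>_scale[OF u(1), of "complex_of_real c"]
      by (intro image_eqI[of _ _ "map (\<lambda>(\<xi>, b). (\<xi>, complex_of_real c *\<^sub>C b)) u"])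
        (auto simp: carrier_P scaleR_scaleC)
    fix y assume "y \<in> \<Theta> ` hm_carrier P"
    then obtain v where v: "v \<in> hm_carrier P" "y = \<Theta> v" by blast
    show "x + y \<in> \<Theta> ` hm_carrier P"
      using u v by (intro image_eqI[of _ _ "u @ v"]) (auto simp: carrier_P)
  qed
  have gen: "\<phi> f c \<in> closure (\<Theta> ` hm_carrier P)" if f: "f \<in> C0 T" for f c
    unfolding closure_approachable
  proof (intro allI impI)
    fix e :: real assume e: "e > 0"
    define \<delta> where "\<delta> = e / (norm c + 1)"
    have \<delta>: "\<delta> > 0" using e by (simp add: \<delta>_def add_nonneg_pos)
    obtain ps where ps: "ps \<in> lists (C0_iota G \<omega> T\<omega> \<times> C0_iota G \<omega> T\<omega>)"
      "\<forall>g. cmod (f g - (\<Sum>(\<xi>, \<eta>)\<leftarrow>ps. cnj (\<xi> (csec g)) * \<eta> (csec g))) < \<delta>"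
      using C0_approx_inner[OF f \<delta>] by blast
    define h where "h g = (\<Sum>(\<xi>, \<eta>)\<leftarrow>ps. cnj (\<xi> (csec g)) * \<eta> (csec g))" for g
    have h: "h \<in> D" "h \<in> C0 T" using D_sum_inner[OF ps(1)] by (simp_all add: h_def[abs_def])
    define u where "u = map (\<lambda>(\<xi>, \<eta>). (\<eta>, \<phi>' (\<lambda>g. cnj (\<xi> (csec g))) c)) ps"
    have u: "u \<in> hm_carrier P" using ps(1) by (auto simp: u_def carrier_P)
    have "\<phi>' h c = \<Theta> u"
      unfolding h_def[abs_def] u_def using ps(1)
    proof (induction ps)
      case Nil
      then show ?case by (simp add: \<phi>'_zero)
    next
      case (Cons p ps)
      obtain \<xi> \<eta> where p: "p = (\<xi>, \<eta>)" by force
      have \<xi>\<eta>: "\<xi> \<in> C0_iota G \<omega> T\<omega>" "\<eta> \<in> C0_iota G \<omega> T\<omega>" and ps: "ps \<in> lists (C0_iota G \<omega> T\<omega> \<times> C0_iota G \<omega> T\<omega>)"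
        using Cons p by auto
      have D1: "\<eta> \<circ> csec \<in> D" "(\<lambda>g. cnj (\<xi> (csec g))) \<in> D"
        using D_gen_C0_iota[OF \<xi>\<eta>(2)] D_cnj[OF D_gen_C0_iota[OF \<xi>\<eta>(1)]] by (simp_all add: o_def)
      have prod: "(\<lambda>g. cnj (\<xi> (csec g)) * \<eta> (csec g)) = (\<lambda>g. (\<eta> \<circ> csec) g * cnj (\<xi> (csec g)))"
        by (simp add: fun_eq_iff mult.commute)
      have D2: "(\<lambda>g. cnj (\<xi> (csec g)) * \<eta> (csec g)) \<in> D"
        unfolding prod by (rule D_mult[OF D1])
      have "\<phi>' (\<lambda>g. cnj (\<xi> (csec g)) * \<eta> (csec g)) c = \<phi>' (\<eta> \<circ> csec) (\<phi>' (\<lambda>g. cnj (\<xi> (csec g))) c)"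
        unfolding prod by (rule \<phi>'_mult[OF D1])
      then show ?case
        using Cons D_sum_inner[OF ps] by (simp add: p \<phi>'_add[OF D2])
    qed
    moreover have "norm (\<phi>' (\<lambda>g. f g - h g) c) \<le> \<delta> * norm c"
    proof (rule \<phi>'_bound_C0)
      show "(\<lambda>g. f g - h g) \<in> C0 T"
        using C0_add[OF f C0_scale[OF h(2), of "-1"]] by simp
      show "cmod (f g - h g) \<le> \<delta>" for g using ps(2) by (simp add: h_def less_imp_le)
    qed (rule \<delta>)
    moreover have "\<delta> * norm c < e"
      using e by (simp add: \<delta>_def divide_less_eq add_nonneg_pos)
    ultimately have "dist (\<Theta> u) (\<phi> f c) < e"
      using extends f \<phi>'_diff[OF subsetD[OF C0_subset_D f] h(1)]
      by (simp add: dist_norm norm_minus_commute)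
    then show "\<exists>y\<in>\<Theta> ` hm_carrier P. dist y (\<phi> f c) < e" using u by blast
  qed
  have "span {\<phi> f b | f b. f \<in> C0 T} \<subseteq> closure (\<Theta> ` hm_carrier P)"
    using gen by (intro span_minimal subspace_closure sub) auto
  then have "closure (span {\<phi> f b | f b. f \<in> C0 T}) \<subseteq> closure (\<Theta> ` hm_carrier P)"
    by (intro closure_minimal) auto
  then have "b \<in> closure (\<Theta> ` hm_carrier P)"
    using weak unfolding weak_algebra_def by auto
  then show ?thesis
    using assms by (fastforce simp: closure_approachable dist_norm norm_minus_commute)
qed

sublocale coords: dense_coordinates P \<Theta>
proof
  show "hm_inner P u v = star (\<Theta> u) * \<Theta> v" if "u \<in> hm_carrier P" "v \<in> hm_carrier P" for u v
    using that by (rule \<Theta>_inner)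
  show "\<exists>u\<in>hm_carrier P. norm (b - \<Theta> u) < \<epsilon>" if "\<epsilon> > 0" for \<epsilon> b
    using that by (rule \<Theta>_dense)
qed (auto simp: formal_tensor_def \<Theta>_scale[simplified carrier_P] \<Theta>_act[simplified carrier_P]
    C0_iota_module_def)

sublocale iso: self_module_iso E coords.coord
  using coords.self_module_iso_completion by (simp add: L_mod_def internal_tensor_def)

lemma coord_elem_tensor:
  assumes "\<xi> \<in> C0_iota G \<omega> T\<omega>"
  shows "coords.coord (elem_tensor (C0_iota_module G \<omega> T\<omega>) \<phi> \<xi> b) = \<phi>' (\<xi> \<circ> csec) b"
  unfolding elem_tensor_def
  by (rule coords.coord_hm_class) (use assms in \<open>auto simp: carrier_P\<close>)

lemma phi_omega_coord:
  assumes f: "f \<in> C0 T" and x: "x \<in> hm_carrier E"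
  shows "phi_omega G \<omega> T\<omega> \<phi> f x \<in> hm_carrier E"
    and "coords.coord (phi_omega G \<omega> T\<omega> \<phi> f x) = \<phi> f (coords.coord x)"
proof -
  have fD: "f \<in> D" using f C0_subset_D by blast
  obtain M where M: "M > 0" "\<And>x. cmod (f x) \<le> M" using C0_bounded[OF f] by blast
  have "isCont (\<phi>' f) b" for b
    using adjointable_diff[OF \<phi>'_adjoint[OF fD]] \<phi>'_bound_C0[OF f M(2,1)] by (rule isCont_of_norm_le)
  then have cont: "isCont (\<phi> f) b" for b using extends f by simp
  let ?m = "map (\<lambda>(\<xi>, b). ((\<lambda>x. f (fst x) * \<xi> x), id b))"
  have m_in: "?m u \<in> hm_carrier P" if "u \<in> hm_carrier P" for u
    using that by (induction rule: carrier_P_induct) (auto simp: carrier_P C0_iota_mult_C0[OF f])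
  have m_\<Theta>: "\<Theta> (?m u) = \<phi> f (\<Theta> u)" if "u \<in> hm_carrier P" for u
    using that
  proof (induction rule: carrier_P_induct)
    case Nil
    then show ?case using extends f adjointable_zero[OF \<phi>'_adjoint[OF fD]] by simp
  next
    case (Cons \<xi> b u)
    have "(\<lambda>x. f (fst x) * \<xi> x) \<circ> csec = (\<lambda>g. f g * (\<xi> \<circ> csec) g)"
      by (simp add: fun_eq_iff csec_def)
    then have "\<phi>' ((\<lambda>x. f (fst x) * \<xi> x) \<circ> csec) b = \<phi>' f (\<phi>' (\<xi> \<circ> csec) b)"
      using \<phi>'_mult[OF fD D_gen_C0_iota[OF Cons(1)]] by simp
    then show ?case
      using Cons extends f adjointable_add[OF \<phi>'_adjoint[OF fD]] by simp
  qed
  have x': "x \<in> hm_carrier (hm_completion P)" using x by (simp add: L_mod_def internal_tensor_def)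
  show "phi_omega G \<omega> T\<omega> \<phi> f x \<in> hm_carrier E"
    "coords.coord (phi_omega G \<omega> T\<omega> \<phi> f x) = \<phi> f (coords.coord x)"
    using coords.completion_map_coord[OF m_in m_\<Theta> cont x']
    by (simp_all add: phi_omega_def tensor_map_def L_mod_def internal_tensor_def)
qed

section \<open>The twisted action\<close>

lemma \<beta>_iso: "g \<in> carrier G \<Longrightarrow> star_iso self_alg self_alg (\<beta> g)"
  and \<beta>_one: "\<beta> \<one> = id"
  and \<beta>_mult: "g \<in> carrier G \<Longrightarrow> h \<in> carrier G \<Longrightarrow> \<beta> (g \<otimes> h) = \<beta> g \<circ> \<beta> h"
  and \<beta>_cont: "continuous_map T euclidean (\<lambda>g. \<beta> g b)"
  using weak by (auto simp: weak_algebra_def cstar_action_def)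

lemma \<beta>_hom:
  assumes "g \<in> carrier G"
  shows "\<beta> g (x + y) = \<beta> g x + \<beta> g y" "\<beta> g (c *\<^sub>C x) = c *\<^sub>C \<beta> g x" "\<beta> g (x * y) = \<beta> g x * \<beta> g y"
    "\<beta> g (star x) = star (\<beta> g x)" "\<beta> g (x - y) = \<beta> g x - \<beta> g y" "bij (\<beta> g)"
  using \<beta>_iso[OF assms] star_hom_self_alg[of "\<beta> g"] by (auto simp: star_iso_def self_alg_def)

lemma \<phi>'_rt:
  assumes "g \<in> carrier G" "f \<in> D"
  shows "\<phi>' (rt G g f) (\<beta> g b) = \<beta> g (\<phi>' f b)"
  using equivar assms \<beta>_hom(6)[OF assms(1)]
  by (simp add: equivariant_def mult_ext_def bij_is_inj)

definition U :: "'g \<Rightarrow> 'b \<Rightarrow> 'b" where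
  "U s = \<phi>' (u_omega \<omega> s)"

lemma u_omega_D: "s \<in> carrier G \<Longrightarrow> u_omega \<omega> s \<in> D"
  unfolding u_omega_def by (intro D_cnj D_gen_cocycle)

lemma cocycle_unit: "s \<in> carrier G \<Longrightarrow> t \<in> carrier G \<Longrightarrow> cnj (\<omega> (t, s)) * \<omega> (t, s) = 1"
  using complex_norm_square[of "\<omega> (t, s)"] by (simp add: mult.commute)

lemma u_omega_unitary: "s \<in> carrier G \<Longrightarrow> u_omega \<omega> s \<in> unitaries T \<mu> D"
  unfolding unitaries_def using u_omega_D cocycle_unit
  by (auto simp: u_omega_def mult.commute intro!: loc_ae_I)

lemma U_unitary:
  assumes s: "s \<in> carrier G"
  shows "unitary_multiplier (U s) (\<phi>' (\<lambda>t. \<omega> (t, s)))"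
proof -
  note D = D_gen_cocycle[OF s] D_cnj[OF D_gen_cocycle[OF s]]
  have "\<phi>' (\<lambda>t. cnj (\<omega> (t, s)) * \<omega> (t, s)) = \<phi>' (\<lambda>t. 1)"
    using D s by (intro \<phi>'_cong D_mult D_one) (auto simp: cocycle_unit)
  then have "\<phi>' (\<lambda>t. cnj (\<omega> (t, s)) * \<omega> (t, s)) = id" by (simp add: unital)
  moreover have "(\<lambda>t. \<omega> (t, s) * cnj (\<omega> (t, s))) = (\<lambda>t. cnj (\<omega> (t, s)) * \<omega> (t, s))"
    by (simp add: fun_eq_iff mult.commute)
  ultimately have "U s (\<phi>' (\<lambda>t. \<omega> (t, s)) b) = b" "\<phi>' (\<lambda>t. \<omega> (t, s)) (U s b) = b" for b
    using \<phi>'_mult[OF D(2,1), of b] \<phi>'_mult[OF D, of b] by (simp_all add: U_def u_omega_def)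
  moreover have "is_adjoint self_module (U s) (\<phi>' (\<lambda>t. \<omega> (t, s)))"
    using \<phi>'_adjoint[OF D(2)] by (simp add: U_def u_omega_def)
  ultimately show ?thesis by (simp add: unitary_multiplier_def fun_eq_iff)
qed

lemma U_linear:
  assumes "s \<in> carrier G"
  shows "U s (x + y) = U s x + U s y" "U s (c *\<^sub>C x) = c *\<^sub>C U s x" "U s (x * y) = U s x * y"
    "U s (x - y) = U s x - U s y"
proof -
  have "is_adjoint self_module (U s) (\<phi>' (\<lambda>t. \<omega> (t, s)))"
    using U_unitary[OF assms] by (simp add: unitary_multiplier_def)
  then show "U s (x + y) = U s x + U s y" "U s (c *\<^sub>C x) = c *\<^sub>C U s x" "U s (x * y) = U s x * y"
    "U s (x - y) = U s x - U s y"
    by (rule adjointable_linear adjointable_diff)+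
qed

text \<open>The isometry of \<open>B\<close> that corresponds to right translation by \<open>csec s\<close> tensored with \<open>\<beta> s\<close>.\<close>

definition \<gamma> :: "'g \<Rightarrow> 'b \<Rightarrow> 'b" where
  "\<gamma> s b = U s (\<beta> s b)"

lemma \<gamma>_linear:
  assumes "s \<in> carrier G"
  shows "\<gamma> s (x + y) = \<gamma> s x + \<gamma> s y" "\<gamma> s (c *\<^sub>C x) = c *\<^sub>C \<gamma> s x"
    "\<gamma> s (x - y) = \<gamma> s x - \<gamma> s y" "norm (\<gamma> s x) = norm x" "bij (\<gamma> s)"
proof -
  show "\<gamma> s (x + y) = \<gamma> s x + \<gamma> s y" "\<gamma> s (c *\<^sub>C x) = c *\<^sub>C \<gamma> s x" "\<gamma> s (x - y) = \<gamma> s x - \<gamma> s y"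
    using assms by (simp_all add: \<gamma>_def \<beta>_hom U_linear)
  show "norm (\<gamma> s x) = norm x"
    unfolding \<gamma>_def using unitary_multiplier_norm[OF U_unitary[OF assms]] star_iso_norm[OF \<beta>_iso[OF assms]]
    by simp
  have "bij (U s)"
    using U_unitary[OF assms] by (intro o_bij) (auto simp: unitary_multiplier_def)
  then have "bij (U s \<circ> \<beta> s)" using \<beta>_hom(6)[OF assms] by (rule bij_comp[rotated])
  then show "bij (\<gamma> s)" by (simp add: \<gamma>_def[abs_def] comp_def)
qed

definition \<alpha> :: "'g \<Rightarrow> 'b \<Rightarrow> 'b" where
  "\<alpha> s = Ad_mult (U s) \<circ> \<beta> s"

text \<open>The isometry \<open>\<gamma> s\<close> implements the automorphism \<open>\<alpha> s\<close>.\<close>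

lemma \<alpha>_\<gamma>:
  assumes "s \<in> carrier G"
  shows "\<alpha> s b * \<gamma> s a = \<gamma> s (b * a)"
  using assms
  by (simp add: \<alpha>_def \<gamma>_def Ad_mult_mult[OF U_unitary] unitary_multiplier_inverse[OF U_unitary] \<beta>_hom)

lemma \<alpha>_rank_one:
  assumes "s \<in> carrier G"
  shows "\<alpha> s (a * star c) = \<gamma> s a * star (\<gamma> s c)"
  using assms by (simp add: \<alpha>_def \<gamma>_def \<beta>_hom Ad_mult_rank_one[OF U_unitary])

lemma \<alpha>_star_iso:
  assumes "s \<in> carrier G"
  shows "star_iso self_alg self_alg (\<alpha> s)"
  using Ad_mult_star_iso[OF U_unitary[OF assms]] \<beta>_iso[OF assms]
  unfolding \<alpha>_def star_iso_def
  by (auto simp: star_hom_def self_alg_def intro: bij_comp)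

lemma \<alpha>_norm_diff: "s \<in> carrier G \<Longrightarrow> norm (\<alpha> s x - \<alpha> s y) = norm (x - y)"
  using star_iso_norm[OF \<alpha>_star_iso, of s "x - y"] star_hom_self_alg(5)[of "\<alpha> s" x y] \<alpha>_star_iso[of s]
  by (simp add: star_iso_def)

lemma \<alpha>_one: "\<alpha> \<one> = id"
proof -
  have "U \<one> = \<phi>' (\<lambda>t. 1)"
    unfolding U_def using u_omega_D[OF one_closed] by (intro \<phi>'_cong D_one) (auto simp: u_omega_def)
  then have "U \<one> = id" by (simp add: unital)
  then show ?thesis by (simp add: \<alpha>_def \<beta>_one fun_eq_iff Ad_mult_def star_star)
qed

text \<open>The cocycle identity: the isometries \<open>\<gamma> s\<close> form a projective representation.\<close>

lemma \<gamma>_mult: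
  assumes g: "g \<in> carrier G" and h: "h \<in> carrier G"
  shows "\<gamma> g (\<gamma> h a) = cnj (\<omega> (g, h)) *\<^sub>C \<gamma> (g \<otimes> h) a"
proof -
  note D = u_omega_D[OF g] D_rt[OF g u_omega_D[OF h]] u_omega_D[OF m_closed[OF g h]]
  have "\<gamma> g (\<gamma> h a) = U g (\<phi>' (rt G g (u_omega \<omega> h)) (\<beta> g (\<beta> h a)))"
    unfolding \<gamma>_def U_def[of h] by (simp add: \<phi>'_rt[OF g u_omega_D[OF h]])
  also have "\<dots> = \<phi>' (\<lambda>t. u_omega \<omega> g t * rt G g (u_omega \<omega> h) t) (\<beta> (g \<otimes> h) a)"
    using D g h by (simp add: U_def \<phi>'_mult \<beta>_mult)
  also have "\<phi>' (\<lambda>t. u_omega \<omega> g t * rt G g (u_omega \<omega> h) t)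
      = \<phi>' (\<lambda>t. cnj (\<omega> (g, h)) * u_omega \<omega> (g \<otimes> h) t)"
  proof (rule \<phi>'_cong)
    fix t assume t: "t \<in> carrier G"
    have "\<omega> (t, g) * \<omega> (t \<otimes> g, h) = \<omega> (t, g \<otimes> h) * \<omega> (g, h)" by (rule cocycle_eq[OF t g h])
    then have "cnj (\<omega> (t, g)) * cnj (\<omega> (t \<otimes> g, h)) = cnj (\<omega> (t, g \<otimes> h)) * cnj (\<omega> (g, h))"
      by (metis complex_cnj_mult)
    then show "u_omega \<omega> g t * rt G g (u_omega \<omega> h) t = cnj (\<omega> (g, h)) * u_omega \<omega> (g \<otimes> h) t"
      using t by (simp add: rt_def u_omega_def mult.commute)
  qed (use D in \<open>auto intro: D_mult D_scale\<close>)
  also have "\<dots> (\<beta> (g \<otimes> h) a) = cnj (\<omega> (g, h)) *\<^sub>C \<gamma> (g \<otimes> h) a"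
    using D(3) by (simp add: \<phi>'_scale \<gamma>_def U_def)
  finally show ?thesis .
qed

text \<open>Since \<open>\<alpha> s\<close> is conjugation by \<open>\<gamma> s\<close>, the scalar in the previous lemma cancels.\<close>

lemma \<alpha>_mult:
  assumes g: "g \<in> carrier G" and h: "h \<in> carrier G"
  shows "\<alpha> (g \<otimes> h) = \<alpha> g \<circ> \<alpha> h"
proof
  fix b
  show "\<alpha> (g \<otimes> h) b = (\<alpha> g \<circ> \<alpha> h) b"
  proof (rule cstar_eqI_right)
    fix y
    obtain a where y: "y = \<gamma> g (\<gamma> h a)"
      using \<gamma>_linear(5)[OF g] \<gamma>_linear(5)[OF h] by (metis bij_pointE)
    have "\<alpha> (g \<otimes> h) b * y = cnj (\<omega> (g, h)) *\<^sub>C \<gamma> (g \<otimes> h) (b * a)"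
      unfolding y \<gamma>_mult[OF g h] using g h by (simp add: mult_scaleC_right \<alpha>_\<gamma>)
    also have "\<dots> = (\<alpha> g \<circ> \<alpha> h) b * y"
      unfolding y using g h by (simp add: \<alpha>_\<gamma> flip: \<gamma>_mult)
    finally show "\<alpha> (g \<otimes> h) b * y = (\<alpha> g \<circ> \<alpha> h) b * y" .
  qed
qed

subsection \<open>Continuity of the twisted action\<close>

text \<open>Right translation by \<open>(s, z)\<close> on the bimodule, tensored with \<open>\<beta> s\<close>, is \<open>cnj z \<gamma> s\<close> in the
  coordinates of \<open>B\<close>.\<close>

lemma section_rt:
  assumes \<xi>: "\<xi> \<in> C0_iota G \<omega> T\<omega>" and s: "s \<in> carrier G" and z: "z \<in> circle"
  shows "\<phi>' (rt G\<omega> (s, z) \<xi> \<circ> csec) (\<beta> s b) = cnj z *\<^sub>C \<gamma> s (\<phi>' (\<xi> \<circ> csec) b)"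
proof -
  note D = u_omega_D[OF s] D_gen_C0_iota[OF \<xi>] D_rt[OF s D_gen_C0_iota[OF \<xi>]]
  have "rt G\<omega> (s, z) \<xi> \<circ> csec = (\<lambda>t. cnj z * (u_omega \<omega> s t * rt G s (\<xi> \<circ> csec) t))"
  proof
    fix t
    show "(rt G\<omega> (s, z) \<xi> \<circ> csec) t = cnj z * (u_omega \<omega> s t * rt G s (\<xi> \<circ> csec) t)"
    proof (cases "t \<in> carrier G")
      case True
      then have "\<xi> (t \<otimes> s, \<omega> (t, s) * z) = cnj (\<omega> (t, s) * z) * \<xi> (csec (t \<otimes> s))"
        using s z by (intro C0_iota_csec[OF \<xi>]) (auto simp: norm_mult)
      then show ?thesis using True s by (simp add: rt_def csec_def u_omega_def mult_ac)
    qed (simp add: rt_def csec_def)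
  qed
  then have "\<phi>' (rt G\<omega> (s, z) \<xi> \<circ> csec) (\<beta> s b)
      = cnj z *\<^sub>C U s (\<phi>' (rt G s (\<xi> \<circ> csec)) (\<beta> s b))"
    using D by (simp add: \<phi>'_scale \<phi>'_mult D_mult U_def)
  then show ?thesis using D by (simp add: \<phi>'_rt[OF s] \<gamma>_def)
qed

definition \<gamma>_ext :: "'g \<times> complex \<Rightarrow> 'b \<Rightarrow> 'b" where
  "\<gamma>_ext x b = cnj (snd x) *\<^sub>C \<gamma> (fst x) b"

lemma \<gamma>_ext_linear:
  assumes "x \<in> topspace T\<omega>"
  shows "\<gamma>_ext x (a + b) = \<gamma>_ext x a + \<gamma>_ext x b" "\<gamma>_ext x (a - b) = \<gamma>_ext x a - \<gamma>_ext x b"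
    "norm (\<gamma>_ext x b) = norm b"
  using assms
  by (auto simp: \<gamma>_ext_def \<gamma>_linear scaleC_add_right scaleC_diff_right norm_scaleC)

text \<open>Translation is norm continuous on \<open>C\<^sub>0\<close> of the extension, \<open>\<beta>\<close> is point-norm continuous, and
  \<open>\<phi>'\<close> is contractive on sections.\<close>

lemma \<gamma>_ext_elementary_continuous:
  assumes \<xi>: "\<xi> \<in> C0_iota G \<omega> T\<omega>"
  shows "continuous_map T\<omega> euclidean (\<lambda>x. \<gamma>_ext x (\<phi>' (\<xi> \<circ> csec) b))"
  unfolding continuous_map_metric_iff
proof (intro ballI allI impI)
  fix x0 and \<epsilon> :: real assume x0: "x0 \<in> topspace T\<omega>" and e: "\<epsilon> > 0"
  obtain M where M: "M > 0" "\<And>x. cmod (\<xi> x) \<le> M" using C0_bounded[OF C0_iota_C0[OF \<xi>]] by blast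
  define \<delta> where "\<delta> = \<epsilon> / (2 * (norm b + 1))"
  have \<delta>: "\<delta> > 0" using e by (simp add: \<delta>_def add_nonneg_pos)
  have \<delta>b: "\<delta> * norm b < \<epsilon> / 2"
  proof -
    have "\<delta> * norm b < \<delta> * (norm b + 1)" using \<delta> by simp
    also have "\<dots> = \<epsilon> / 2" using norm_ge_zero[of b] by (simp add: \<delta>_def field_simps add_nonneg_eq_0_iff)
    finally show ?thesis .
  qed
  have rep: "\<gamma>_ext x (\<phi>' (\<xi> \<circ> csec) b) = \<phi>' (rt G\<omega> x \<xi> \<circ> csec) (\<beta> (fst x) b)" if "x \<in> topspace T\<omega>" for x
    using that section_rt[OF \<xi>, of "fst x" "snd x"] by (auto simp: \<gamma>_ext_def)
  obtain V where V: "openin T\<omega> V" "x0 \<in> V"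
    "\<And>x y. x \<in> V \<Longrightarrow> y \<in> carrier G\<omega> \<Longrightarrow> cmod (\<xi> (y \<otimes>\<^bsub>G\<omega>\<^esub> x) - \<xi> (y \<otimes>\<^bsub>G\<omega>\<^esub> x0)) < \<delta>"
    using C0_translation_continuous[OF lcg_ext C0_iota_C0[OF \<xi>] \<delta>, of x0] x0 by auto
  have \<beta>c: "continuous_map T\<omega> euclidean (\<lambda>x. \<beta> (fst x) b)"
    using continuous_map_compose[OF fst_continuous \<beta>_cont] by (simp add: o_def)
  have "\<epsilon> / (2 * M) > 0" using e M by simp
  from \<beta>c[unfolded continuous_map_metric_iff, rule_format, OF x0 this] obtain W where W: "openin T\<omega> W" "x0 \<in> W"
    "\<And>x. x \<in> W \<Longrightarrow> dist (\<beta> (fst x) b) (\<beta> (fst x0) b) < \<epsilon> / (2 * M)"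
    by blast
  have "dist (\<gamma>_ext x (\<phi>' (\<xi> \<circ> csec) b)) (\<gamma>_ext x0 (\<phi>' (\<xi> \<circ> csec) b)) < \<epsilon>" if x: "x \<in> V \<inter> W" for x
  proof -
    have xT: "x \<in> topspace T\<omega>" using x V(1) openin_subset by blast
    then have fx: "fst x \<in> carrier G" by auto
    define \<eta> where "\<eta> = rt G\<omega> x \<xi>"
    define \<eta>0 where "\<eta>0 = rt G\<omega> x0 \<xi>"
    have \<eta>: "\<eta> \<in> C0_iota G \<omega> T\<omega>" "\<eta>0 \<in> C0_iota G \<omega> T\<omega>"
      unfolding \<eta>_def \<eta>0_def using xT x0 by (auto intro!: C0_iota_rt[OF _ \<xi>] simp del: carrier_ext simp flip: carrier_ext)
    have diff_in: "(\<lambda>y. \<eta> y - \<eta>0 y) \<in> C0_iota G \<omega> T\<omega>"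
      using C0_iota_add[OF \<eta>(1) C0_iota_mult_bounded[OF _ _ \<eta>(2), of "\<lambda>x. -1" 1]] by simp
    have le: "cmod (\<eta> y - \<eta>0 y) \<le> \<delta>" for y
      using V(3)[of x y] x \<delta> by (auto simp: \<eta>_def \<eta>0_def rt_def less_imp_le simp del: carrier_ext)
    have "norm (\<phi>' (\<eta> \<circ> csec) (\<beta> (fst x) b) - \<phi>' (\<eta>0 \<circ> csec) (\<beta> (fst x) b)) \<le> \<delta> * norm (\<beta> (fst x) b)"
      using \<phi>'_bound_C0_iota[OF diff_in le \<delta>]
        \<phi>'_diff[OF D_gen_C0_iota[OF \<eta>(1)] D_gen_C0_iota[OF \<eta>(2)]] by (simp add: o_def)
    also have "\<dots> < \<epsilon> / 2" using \<delta>b star_iso_norm[OF \<beta>_iso[OF fx]] by simp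
    finally have 1: "norm (\<phi>' (\<eta> \<circ> csec) (\<beta> (fst x) b) - \<phi>' (\<eta>0 \<circ> csec) (\<beta> (fst x) b)) < \<epsilon> / 2" .
    have "cmod (\<eta>0 y) \<le> M" for y using M by (simp add: \<eta>0_def rt_def less_imp_le)
    from \<phi>'_bound_C0_iota[OF \<eta>(2) this M(1), of "\<beta> (fst x) b - \<beta> (fst x0) b"]
    have "norm (\<phi>' (\<eta>0 \<circ> csec) (\<beta> (fst x) b) - \<phi>' (\<eta>0 \<circ> csec) (\<beta> (fst x0) b))
        \<le> M * norm (\<beta> (fst x) b - \<beta> (fst x0) b)"
      by (simp add: adjointable_diff[OF \<phi>'_adjoint[OF D_gen_C0_iota[OF \<eta>(2)]]])
    also have "\<dots> < \<epsilon> / 2" using W(3)[of x] x M by (simp add: dist_norm field_simps)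
    finally have 2: "norm (\<phi>' (\<eta>0 \<circ> csec) (\<beta> (fst x) b) - \<phi>' (\<eta>0 \<circ> csec) (\<beta> (fst x0) b)) < \<epsilon> / 2" .
    have "norm (\<phi>' (\<eta> \<circ> csec) (\<beta> (fst x) b) - \<phi>' (\<eta>0 \<circ> csec) (\<beta> (fst x0) b)) < \<epsilon>"
      using norm_triangle_lt[of "\<phi>' (\<eta> \<circ> csec) (\<beta> (fst x) b) - \<phi>' (\<eta>0 \<circ> csec) (\<beta> (fst x) b)"
        "\<phi>' (\<eta>0 \<circ> csec) (\<beta> (fst x) b) - \<phi>' (\<eta>0 \<circ> csec) (\<beta> (fst x0) b)" \<epsilon>] 1 2 by simp
    then show ?thesis unfolding rep[OF xT] rep[OF x0] by (simp add: dist_norm \<eta>_def \<eta>0_def)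
  qed
  then show "\<exists>U. openin T\<omega> U \<and> x0 \<in> U \<and>
      (\<forall>x\<in>U. dist (\<gamma>_ext x (\<phi>' (\<xi> \<circ> csec) b)) (\<gamma>_ext x0 (\<phi>' (\<xi> \<circ> csec) b)) < \<epsilon>)"
    using V W by (intro exI[of _ "V \<inter> W"]) auto
qed

lemma \<gamma>_ext_continuous: "continuous_map T\<omega> euclidean (\<lambda>x. \<gamma>_ext x a)"
proof (rule continuous_map_uniform_approx)
  fix \<epsilon> :: real assume "\<epsilon> > 0"
  then obtain u where u: "u \<in> hm_carrier P" "norm (a - \<Theta> u) < \<epsilon>" using \<Theta>_dense by blast
  have "continuous_map T\<omega> euclidean (\<lambda>x. \<gamma>_ext x (\<Theta> u))"
    using u(1)
  proof (induction rule: carrier_P_induct)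
    case Nil
    have "continuous_map T\<omega> euclidean (\<lambda>x. 0 :: 'b)" by simp
    then show ?case
      by (rule continuous_map_eq) (use \<gamma>_ext_linear(2)[of _ 0 0] in simp)
  next
    case (Cons \<xi> b u)
    have "continuous_map T\<omega> euclidean (\<lambda>x. \<gamma>_ext x (\<phi>' (\<xi> \<circ> csec) b) + \<gamma>_ext x (\<Theta> u))"
      using \<gamma>_ext_elementary_continuous[OF Cons(1)] Cons(3)
      unfolding continuous_map_euclidean_iff by (auto intro!: tendsto_add)
    then show ?case by (rule continuous_map_eq) (simp add: \<gamma>_ext_linear)
  qed
  moreover have "norm (\<gamma>_ext x a - \<gamma>_ext x (\<Theta> u)) < \<epsilon>" if "x \<in> topspace T\<omega>" for x
    using u(2) \<gamma>_ext_linear(2,3)[OF that] by metis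
  ultimately show "\<exists>g. continuous_map T\<omega> euclidean g \<and> (\<forall>x\<in>topspace T\<omega>. norm (\<gamma>_ext x a - g x) < \<epsilon>)"
    by blast
qed

text \<open>The function \<open>u_omega\<close> is merely Borel in the group variable, so continuity of \<open>\<alpha>\<close> is
  obtained on the extension, where \<open>\<gamma>_ext\<close> is continuous, and descends along the open quotient map
  to \<open>G\<close>, because \<open>\<alpha>\<close> does not depend on the circle coordinate.\<close>

lemma \<alpha>_continuous: "continuous_map T euclidean (\<lambda>s. \<alpha> s b)"
proof (rule continuous_compose_quotient_map[OF fst_quotient])
  have "continuous_map T\<omega> euclidean (\<lambda>x. \<alpha> (fst x) b)"
  proof (rule continuous_map_uniform_approx)
    fix \<epsilon> :: real assume "\<epsilon> > 0"
    then obtain q where q: "q \<in> product_sums" "norm (b - q) < \<epsilon>" using approx_product_sums by blast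
    then obtain ps where ps: "q = (\<Sum>(a, c)\<leftarrow>ps. a * star c)" by (auto simp: product_sums_def)
    have "continuous_map T\<omega> euclidean (\<lambda>x. \<alpha> (fst x) q)"
      unfolding ps
    proof (induction ps)
      case Nil
      have "continuous_map T\<omega> euclidean (\<lambda>x. 0 :: 'b)" by simp
      then show ?case
        by (rule continuous_map_eq) (use \<alpha>_norm_diff star_iso_norm[OF \<alpha>_star_iso, of _ 0] in auto)
    next
      case (Cons p ps)
      obtain a c where p: "p = (a, c)" by force
      have "continuous_map T\<omega> euclidean (\<lambda>x. \<gamma>_ext x a * star (\<gamma>_ext x c) + \<alpha> (fst x) (\<Sum>(a, c)\<leftarrow>ps. a * star c))"
        using \<gamma>_ext_continuous[of a] \<gamma>_ext_continuous[of c] Cons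
        unfolding continuous_map_euclidean_iff by (auto intro!: tendsto_intros)
      then show ?case
      proof (rule continuous_map_eq)
        fix x assume x: "x \<in> topspace T\<omega>"
        then have s: "fst x \<in> carrier G" and z: "cmod (snd x) = 1" by auto
        have "cnj (snd x) * snd x = 1"
          using z complex_norm_square[of "snd x"] by (simp add: mult.commute)
        then have "\<gamma>_ext x a * star (\<gamma>_ext x c) = \<alpha> (fst x) (a * star c)"
          by (simp add: \<alpha>_rank_one[OF s] \<gamma>_ext_def star_scaleC mult_scaleC_left mult_scaleC_right scaleC_scaleC mult.commute)
        then show "\<gamma>_ext x a * star (\<gamma>_ext x c) + \<alpha> (fst x) (\<Sum>(a, c)\<leftarrow>ps. a * star c)
            = \<alpha> (fst x) (\<Sum>(a, c)\<leftarrow>p # ps. a * star c)"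
          using \<alpha>_star_iso[OF s] star_hom_self_alg(1)[of "\<alpha> (fst x)"] by (simp add: p star_iso_def)
      qed
    qed
    moreover have "norm (\<alpha> (fst x) b - \<alpha> (fst x) q) < \<epsilon>" if "x \<in> topspace T\<omega>" for x
      using that q(2) by (auto simp: \<alpha>_norm_diff)
    ultimately show "\<exists>g. continuous_map T\<omega> euclidean g \<and> (\<forall>x\<in>topspace T\<omega>. norm (\<alpha> (fst x) b - g x) < \<epsilon>)"
      by blast
  qed
  then show "continuous_map T\<omega> euclidean ((\<lambda>s. \<alpha> s b) \<circ> fst)" by (simp add: o_def)
qed

lemma cstar_action_\<alpha>: "cstar_action G T \<alpha>"
  unfolding cstar_action_def
  using \<alpha>_star_iso \<alpha>_one \<alpha>_mult \<alpha>_continuous by blast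

section \<open>The action on the compact operators\<close>

lemma rt_tensor_beta_coord:
  assumes s: "s \<in> carrier G" and x: "x \<in> hm_carrier E"
  shows "rt_tensor_beta G \<omega> T\<omega> \<phi> \<beta> (csec s) x \<in> hm_carrier E"
    and "coords.coord (rt_tensor_beta G \<omega> T\<omega> \<phi> \<beta> (csec s) x) = \<gamma> s (coords.coord x)"
proof -
  have cont: "isCont (\<gamma> s) b" for b
    by (rule isCont_of_norm_le[where M = 1]) (simp_all add: \<gamma>_linear s)
  let ?m = "map (\<lambda>(\<xi>, b). (rt G\<omega> (csec s) \<xi>, \<beta> (fst (csec s)) b))"
  have s_in: "csec s \<in> carrier G\<omega>" using s by (simp add: csec_def)
  have m_in: "?m u \<in> hm_carrier P" if "u \<in> hm_carrier P" for u
    using that by (induction rule: carrier_P_induct) (auto simp: carrier_P C0_iota_rt[OF s_in] simp del: carrier_ext)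
  have m_\<Theta>: "\<Theta> (?m u) = \<gamma> s (\<Theta> u)" if "u \<in> hm_carrier P" for u
    using that
  proof (induction rule: carrier_P_induct)
    case Nil
    then show ?case using \<gamma>_linear(3)[OF s, of 0 0] by simp
  next
    case (Cons \<xi> b u)
    then show ?case
      using section_rt[OF Cons(1) s, of 1 b] by (simp add: csec_def \<gamma>_linear[OF s])
  qed
  have x': "x \<in> hm_carrier (hm_completion P)" using x by (simp add: L_mod_def internal_tensor_def)
  show "rt_tensor_beta G \<omega> T\<omega> \<phi> \<beta> (csec s) x \<in> hm_carrier E"
    "coords.coord (rt_tensor_beta G \<omega> T\<omega> \<phi> \<beta> (csec s) x) = \<gamma> s (coords.coord x)"
    using coords.completion_map_coord[OF m_in m_\<Theta> cont x']
    by (simp_all add: rt_tensor_beta_def tensor_map_def L_mod_def internal_tensor_def)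
qed

text \<open>In coordinates this is \<open>\<gamma> s (b * inverse (\<gamma> s) a) = \<alpha> s b * a\<close>.\<close>

lemma beta_omega_left_op:
  assumes s: "s \<in> carrier G"
  shows "beta_omega G \<omega> T\<omega> \<phi> \<beta> s (iso.left_op b) = iso.left_op (\<alpha> s b)"
proof (rule iso.left_op_eqI)
  let ?\<gamma> = "rt_tensor_beta G \<omega> T\<omega> \<phi> \<beta> (csec s)"
  have def: "beta_omega G \<omega> T\<omega> \<phi> \<beta> s k
      = (\<lambda>x\<in>hm_carrier E. ?\<gamma> (k (inv_into (hm_carrier E) ?\<gamma> x)))" for k
    by (simp add: beta_omega_def Let_def)
  show "beta_omega G \<omega> T\<omega> \<phi> \<beta> s (iso.left_op b) \<in> extensional (hm_carrier E)"
    unfolding def by simp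
  fix x assume x: "x \<in> hm_carrier E"
  define y where "y = inv_into (hm_carrier E) ?\<gamma> x"
  have x_image: "x \<in> ?\<gamma> ` hm_carrier E"
  proof -
    obtain a where a: "\<gamma> s a = coords.coord x" using \<gamma>_linear(5)[OF s] by (metis bij_pointE)
    have "?\<gamma> (iso.vec a) = x"
      using rt_tensor_beta_coord[OF s, of "iso.vec a"] a x by (intro iso.\<Phi>_inj) auto
    then show ?thesis using iso.vec_in by blast
  qed
  have y: "y \<in> hm_carrier E" "?\<gamma> y = x"
    unfolding y_def by (rule inv_into_into[OF x_image], rule f_inv_into_f[OF x_image])
  have "beta_omega G \<omega> T\<omega> \<phi> \<beta> s (iso.left_op b) x = ?\<gamma> (iso.vec (b * coords.coord y))"
    unfolding def using x y by (simp add: y_def)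
  also have "\<dots> = iso.vec (\<gamma> s (b * coords.coord y))"
    using rt_tensor_beta_coord[OF s, of "iso.vec (b * coords.coord y)"]
    by (intro iso.\<Phi>_inj) auto
  also have "\<gamma> s (b * coords.coord y) = \<alpha> s b * coords.coord x"
    using rt_tensor_beta_coord(2)[OF s y(1)] y(2) by (simp flip: \<alpha>_\<gamma>[OF s])
  finally show "beta_omega G \<omega> T\<omega> \<phi> \<beta> s (iso.left_op b) x = iso.vec (\<alpha> s b * coords.coord x)" .
qed

lemma phi_omega_left_op:
  assumes f: "f \<in> C0 T"
  shows "compose (hm_carrier E) (phi_omega G \<omega> T\<omega> \<phi> f) (iso.left_op b) = iso.left_op (\<phi> f b)"
proof (rule iso.left_op_eqI)
  fix x assume x: "x \<in> hm_carrier E"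
  have "f \<in> D" using f C0_subset_D by blast
  then have "\<phi> f (b * coords.coord x) = \<phi> f b * coords.coord x"
    using extends f adjointable_mult[OF \<phi>'_adjoint] by fastforce
  then have "phi_omega G \<omega> T\<omega> \<phi> f (iso.vec (b * coords.coord x)) = iso.vec (\<phi> f b * coords.coord x)"
    using phi_omega_coord[OF f, of "iso.vec (b * coords.coord x)"] by (intro iso.\<Phi>_inj) auto
  then show "compose (hm_carrier E) (phi_omega G \<omega> T\<omega> \<phi> f) (iso.left_op b) x
      = iso.vec (\<phi> f b * coords.coord x)"
    using x by (simp add: compose_def)
qed (simp add: compose_def)

end

theorem proposition5p13:
  fixes G :: "('g, 'm) monoid_scheme" and T :: "'g topology" and \<mu> :: "'g measure"
    and \<beta> :: "'g \<Rightarrow> 'b \<Rightarrow> 'b::cstar_algebra"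
    and \<phi> \<phi>' :: "('g \<Rightarrow> complex) \<Rightarrow> 'b \<Rightarrow> 'b"
    and \<omega> :: "'g \<times> 'g \<Rightarrow> complex" and T\<omega> :: "('g \<times> complex) topology"
  defines "D \<equiv> D_alg G T \<mu> \<omega> T\<omega>"
    and "X \<equiv> C0_iota_module G \<omega> T\<omega>"
    and "E \<equiv> L_mod G \<omega> T\<omega> \<phi>"
    and "U \<equiv> \<lambda>s. \<phi>' (u_omega \<omega> s)"
  assumes "locally_compact_group G T"
    and "haar_measure G T \<mu>"
    and "weak_algebra G T \<beta> \<phi>"
    and "\<omega> \<in> Z2 G T"
    and "extension_topology G T \<omega> T\<omega>"
    and "star_hom (fun_alg D) multiplier_alg \<phi>'"
    and "respects_loc_ae T \<mu> D \<phi>'"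
    and "\<phi>' (\<lambda>t. 1) = id"
    and "equivariant G \<beta> D \<phi>'"
    and "\<forall>f\<in>C0 T. \<phi>' f = \<phi> f"
  shows "(\<forall>s\<in>carrier G. u_omega \<omega> s \<in> unitaries T \<mu> D) \<and>
    cstar_action G T (\<lambda>s. Ad_mult (U s) \<circ> \<beta> s) \<and>
    (\<exists>\<Phi>. hm_iso E self_module \<Phi> \<and>
      (\<forall>f\<in>C0_iota G \<omega> T\<omega>. \<forall>b. \<Phi> (elem_tensor X \<phi> f b) = \<phi>' (f \<circ> csec) b) \<and>
      (\<forall>f\<in>C0 T. \<forall>x\<in>hm_carrier E. \<Phi> (phi_omega G \<omega> T\<omega> \<phi> f x) = \<phi> f (\<Phi> x)) \<and>
      (\<exists>\<Psi>. star_iso (compact_alg E) self_alg \<Psi> \<and>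
        (\<forall>k\<in>compacts E. \<forall>x\<in>hm_carrier E. \<Psi> k * \<Phi> x = \<Phi> (k x)) \<and>
        (\<forall>f\<in>C0 T. \<forall>k\<in>compacts E.
           \<Psi> (compose (hm_carrier E) (phi_omega G \<omega> T\<omega> \<phi> f) k) = \<phi> f (\<Psi> k)) \<and>
        (\<forall>s\<in>carrier G. \<forall>k\<in>compacts E.
           \<Psi> (beta_omega G \<omega> T\<omega> \<phi> \<beta> s k) = Ad_mult (U s) (\<beta> s (\<Psi> k)))))"
proof -
  interpret A: extended_weak_algebra G T \<omega> T\<omega> \<mu> \<beta> \<phi> \<phi>'
    using assms by unfold_locales (auto simp: haar_measure_def D_def)
  have U_eq: "U = A.U" by (simp add: fun_eq_iff U_def A.U_def)
  have \<alpha>_eq: "(\<lambda>s. Ad_mult (U s) \<circ> \<beta> s) = A.\<alpha>" by (simp add: fun_eq_iff A.\<alpha>_def U_eq)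
  have \<Psi>: "star_iso (compact_alg E) self_alg A.iso.compact_coord \<and>
        (\<forall>k\<in>compacts E. \<forall>x\<in>hm_carrier E. A.iso.compact_coord k * A.coords.coord x = A.coords.coord (k x)) \<and>
        (\<forall>f\<in>C0 T. \<forall>k\<in>compacts E.
           A.iso.compact_coord (compose (hm_carrier E) (phi_omega G \<omega> T\<omega> \<phi> f) k) = \<phi> f (A.iso.compact_coord k)) \<and>
        (\<forall>s\<in>carrier G. \<forall>k\<in>compacts E.
           A.iso.compact_coord (beta_omega G \<omega> T\<omega> \<phi> \<beta> s k) = Ad_mult (U s) (\<beta> s (A.iso.compact_coord k)))"
    using A.iso.star_iso_compact_coord
    by (auto simp: E_def A.iso.compacts_eq A.phi_omega_left_op A.beta_omega_left_op A.\<alpha>_def U_eq)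
  have "hm_iso E self_module A.coords.coord \<and>
      (\<forall>f\<in>C0_iota G \<omega> T\<omega>. \<forall>b. A.coords.coord (elem_tensor X \<phi> f b) = \<phi>' (f \<circ> csec) b) \<and>
      (\<forall>f\<in>C0 T. \<forall>x\<in>hm_carrier E. A.coords.coord (phi_omega G \<omega> T\<omega> \<phi> f x) = \<phi> f (A.coords.coord x))"
    using A.iso.iso A.coord_elem_tensor A.phi_omega_coord(2) by (simp add: E_def X_def)
  then show ?thesis
    unfolding \<alpha>_eq using A.u_omega_unitary A.cstar_action_\<alpha> \<Psi> unfolding D_def by blast
qed

end
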